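(* Let $\theta(t)$, $t\ge1$, be any increasing function such that $$0<\theta(t)\le 2t\quad(t\ge1),\qquad \int_1^\infty\frac{\theta^2(t)\,dt}{t^3}=\infty .$$ Then there exists a set $E\subset\overline{\mathbb{R}}$, which is the complement $E=\overline{\mathbb{C}}\setminus\Omega$ of a Denjoy domain $\Omega$ and all of whose points (including $\infty\in E$) are regular for the Dirichlet problem in $\Omega$, such that $$\theta_E(t)\le\theta(t)\quad(t>2),$$ where $\theta_E(t)=|(\mathbb{R}\setminus E)\cap[-t,t]|$, and such that $\dim\mathcal{P}_\infty(\Omega)=1$ and $\limsup_{\Omega\ni t\to\infty}g_\Omega(t,z)\,|t|=\infty$ for some $z\in\Omega$.
   Context: $\overline{\mathbb{C}}=\mathbb{C}\cup\{\infty\}$, $\overline{\mathbb{R}}=\mathbb{R}\cup\{\infty\}$. A Denjoy domain is an open subset $\Omega$ of $\mathbb{C}$ whose complement $E=\overline{\mathbb{C}}\setminus\Omega$ is a subset of $\overline{\mathbb{R}}$. $|S|$ denotes the one-dimensional Lebesgue measure of a Borel set $S\subset\mathbb{R}$. $g_\Omega(\cdot,z)$ is the Green function of $\Omega$ with pole at $z\in\Omega$. $\mathcal{P}_\infty=\mathcal{P}_\infty(\Omega)$ is the cone of positive harmonic functions on $\Omega$ which have vanishing boundary values at every point of $E\setminus\{\infty\}$. By a known theorem (Ancona, Benedicks), either all functions in $\mathcal{P}_\infty$ are proportional, written $\dim\mathcal{P}_\infty=1$, or $\mathcal{P}_\infty$ is generated by two linearly independent minimal positive harmonic functions, written $\dim\mathcal{P}_\infty=2$.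 *)

theory Defs
  imports "HOL-Analysis.Analysis"
begin

section \<open>The extended plane\<close>

text \<open>
  The extended plane is the library's one-point compactification of the plane: its points are of
  type \<^typ>\<open>complex option\<close>, with \<^term>\<open>None\<close> as the point at infinity.
\<close>

abbreviation ext_plane :: "complex option topology" where
  "ext_plane \<equiv> Alexandroff_compactification euclidean"

definition ext_real_line :: "complex option set" where
  "ext_real_line = insert None (Some ` \<real>)"

definition ext_compl :: "complex set \<Rightarrow> complex option set" where
  "ext_compl \<Omega> = topspace ext_plane - Some ` \<Omega>"

definition ext_frontier :: "complex set \<Rightarrow> complex option set" where
  "ext_frontier \<Omega> = ext_plane frontier_of (Some ` \<Omega>)"

text \<open>The filter of a variable point of \<open>\<Omega>\<close> tending to \<open>\<zeta>\<close> in the extended plane.\<close>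

definition tending_to :: "complex set \<Rightarrow> complex option \<Rightarrow> complex filter" where
  "tending_to \<Omega> \<zeta> = inf (filtercomap Some (nhdsin ext_plane \<zeta>)) (principal \<Omega>)"

lemma filtercomap_Some_finite: "filtercomap Some (nhdsin ext_plane (Some a)) = nhds a"
proof (rule filter_eqI)
  fix P :: "complex \<Rightarrow> bool"
  have top: "Some a \<in> topspace ext_plane" by simp
  show "eventually P (filtercomap Some (nhdsin ext_plane (Some a))) \<longleftrightarrow> eventually P (nhds a)"
  proof
    assume "eventually P (filtercomap Some (nhdsin ext_plane (Some a)))"
    then obtain Q where Q: "eventually Q (nhdsin ext_plane (Some a))" "\<And>z. Q (Some z) \<Longrightarrow> P z"
      unfolding eventually_filtercomap by blast
    then obtain S where S: "openin ext_plane S" "Some a \<in> S" "\<And>x. x \<in> S \<Longrightarrow> Q x"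
      using top unfolding eventually_nhdsin by blast
    have "open (Some -` S)"
      using S(1) unfolding openin_Alexandroff_compactification
    proof (elim disjE exE conjE)
      fix U assume "openin euclidean U" "S = Some ` U"
      moreover from this have "Some -` S = U" by blast
      ultimately show ?thesis by simp
    next
      fix C :: "complex set"
      assume "closedin euclidean C" "S = insert None (Some ` (topspace euclidean - C))"
      moreover from this have "Some -` S = - C" by force
      ultimately show ?thesis by (simp add: open_Compl)
    qed
    then show "eventually P (nhds a)"
      unfolding eventually_nhds using S Q(2) by (intro exI[of _ "Some -` S"]) simp
  next
    assume "eventually P (nhds a)"
    then obtain U where U: "open U" "a \<in> U" "\<And>z. z \<in> U \<Longrightarrow> P z"
      unfolding eventually_nhds by blast
    have "openin ext_plane (Some ` U)"
      using U(1) unfolding openin_Alexandroff_compactification by auto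
    then have "eventually (\<lambda>x. x \<in> Some ` U) (nhdsin ext_plane (Some a))"
      using U(2) unfolding eventually_nhdsin by blast
    then show "eventually P (filtercomap Some (nhdsin ext_plane (Some a)))"
      unfolding eventually_filtercomap using U(3) by blast
  qed
qed

lemma filtercomap_Some_infinity: "filtercomap Some (nhdsin ext_plane None) = at_infinity"
proof (rule filter_eqI)
  fix P :: "complex \<Rightarrow> bool"
  have top: "None \<in> topspace ext_plane" by simp
  show "eventually P (filtercomap Some (nhdsin ext_plane None)) \<longleftrightarrow> eventually P at_infinity"
  proof
    assume "eventually P (filtercomap Some (nhdsin ext_plane None))"
    then obtain Q where Q: "eventually Q (nhdsin ext_plane None)" "\<And>z. Q (Some z) \<Longrightarrow> P z"
      unfolding eventually_filtercomap by blast
    then obtain S where S: "openin ext_plane S" "None \<in> S" "\<And>x. x \<in> S \<Longrightarrow> Q x"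
      using top unfolding eventually_nhdsin by blast
    then obtain C :: "complex set" where C: "compact C" "S = insert None (Some ` (- C))"
      unfolding openin_Alexandroff_compactification by (auto simp: Compl_eq_Diff_UNIV)
    obtain b where b: "\<And>z. z \<in> C \<Longrightarrow> norm z \<le> b"
      using compact_imp_bounded[OF C(1)] unfolding bounded_iff by blast
    have "P z" if "b + 1 \<le> norm z" for z
    proof -
      have "z \<notin> C" using b[of z] that by linarith
      then show ?thesis using C(2) S(3) Q(2) by blast
    qed
    then show "eventually P at_infinity"
      unfolding eventually_at_infinity by blast
  next
    assume "eventually P at_infinity"
    then obtain b where b: "\<And>z. b \<le> norm z \<Longrightarrow> P z"
      unfolding eventually_at_infinity by blast
    let ?S = "insert None (Some ` (topspace euclidean - cball (0::complex) b))"
    have "compactin euclidean (cball (0::complex) b)" "closedin euclidean (cball (0::complex) b)"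
      by simp_all
    then have "openin ext_plane ?S"
      unfolding openin_Alexandroff_compactification by blast
    then have "eventually (\<lambda>x. x \<in> ?S) (nhdsin ext_plane None)"
      unfolding eventually_nhdsin by blast
    moreover have "P z" if "Some z \<in> ?S" for z
      using that by (intro b) auto
    ultimately show "eventually P (filtercomap Some (nhdsin ext_plane None))"
      unfolding eventually_filtercomap by blast
  qed
qed

lemma tending_to_Some: "a \<notin> \<Omega> \<Longrightarrow> tending_to \<Omega> (Some a) = at a within \<Omega>"
  by (simp add: tending_to_def filtercomap_Some_finite at_within_def)

lemma tending_to_None: "tending_to \<Omega> None = inf at_infinity (principal \<Omega>)"
  by (simp add: tending_to_def filtercomap_Some_infinity)

section \<open>Denjoy domains\<close>

definition Denjoy_domain :: "complex set \<Rightarrow> bool" where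
  "Denjoy_domain \<Omega> \<longleftrightarrow> open \<Omega> \<and> ext_compl \<Omega> \<subseteq> ext_real_line"

definition theta_compl :: "complex option set \<Rightarrow> real \<Rightarrow> real" where
  "theta_compl E t = measure lborel ({x. Some (complex_of_real x) \<notin> E} \<inter> {-t..t})"

section \<open>Harmonic and subharmonic functions\<close>

text \<open>
  \<open>u\<close> is twice continuously differentiable with gradient \<open>G\<close> and second derivative \<open>H\<close>, and the
  Laplacian, which is the trace of \<open>H\<close>, vanishes.
\<close>

definition harmonic_on :: "(complex \<Rightarrow> real) \<Rightarrow> complex set \<Rightarrow> bool" where
  "harmonic_on u S \<longleftrightarrow>
     (\<exists>G H. (\<forall>z\<in>S. GDERIV u z :> G z \<and> (G has_derivative H z) (at z) \<and>
                     Re (H z 1) + Im (H z \<i>) = 0) \<and>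
            continuous_on S (\<lambda>z. H z 1) \<and> continuous_on S (\<lambda>z. H z \<i>))"

definition subharmonic_on :: "(complex \<Rightarrow> real) \<Rightarrow> complex set \<Rightarrow> bool" where
  "subharmonic_on u S \<longleftrightarrow> continuous_on S u \<and>
     (\<forall>a r. 0 < r \<and> cball a r \<subseteq> S \<longrightarrow>
        u a \<le> integral {0..2 * pi} (\<lambda>t. u (a + of_real r * cis t)) / (2 * pi))"

section \<open>Regular points for the Dirichlet problem\<close>

text \<open>
  The Perron solution of the Dirichlet problem; the boundary is taken in the extended plane, so
  the point at infinity carries a boundary value when \<open>\<Omega>\<close> is unbounded.
\<close>

definition Perron_family :: "complex set \<Rightarrow> (complex option \<Rightarrow> real) \<Rightarrow> (complex \<Rightarrow> real) set" where
  "Perron_family \<Omega> \<phi> = {u. subharmonic_on u \<Omega> \<and>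
     (\<forall>\<zeta>\<in>ext_frontier \<Omega>. Limsup (tending_to \<Omega> \<zeta>) (\<lambda>w. ereal (u w)) \<le> ereal (\<phi> \<zeta>))}"

definition Perron_solution :: "complex set \<Rightarrow> (complex option \<Rightarrow> real) \<Rightarrow> complex \<Rightarrow> real" where
  "Perron_solution \<Omega> \<phi> w = (SUP u\<in>Perron_family \<Omega> \<phi>. u w)"

definition Dirichlet_regular :: "complex set \<Rightarrow> complex option \<Rightarrow> bool" where
  "Dirichlet_regular \<Omega> \<zeta> \<longleftrightarrow> \<zeta> \<in> ext_frontier \<Omega> \<and>
     (\<forall>\<phi>. continuous_map (subtopology ext_plane (ext_frontier \<Omega>)) euclideanreal \<phi> \<longrightarrow>
        (Perron_solution \<Omega> \<phi> \<longlongrightarrow> \<phi> \<zeta>) (tending_to \<Omega> \<zeta>))"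

section \<open>The Green function\<close>

text \<open>
  The Green function is the least nonnegative harmonic function on \<open>\<Omega> - {z}\<close> with a normalised
  logarithmic pole at \<open>z\<close>. It need not exist, hence the relational form; the value
  \<open>g z\<close> at the pole itself is irrelevant.
\<close>

definition has_log_pole :: "complex set \<Rightarrow> complex \<Rightarrow> (complex \<Rightarrow> real) \<Rightarrow> bool" where
  "has_log_pole \<Omega> z h \<longleftrightarrow>
     (\<exists>k. harmonic_on k \<Omega> \<and> (\<forall>w\<in>\<Omega> - {z}. k w = h w + ln (cmod (w - z))))"

definition Green_candidates :: "complex set \<Rightarrow> complex \<Rightarrow> (complex \<Rightarrow> real) set" where
  "Green_candidates \<Omega> z = {h. harmonic_on h (\<Omega> - {z}) \<and> (\<forall>w\<in>\<Omega> - {z}. 0 \<le> h w) \<and> has_log_pole \<Omega> z h}"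

definition is_Green_function :: "complex set \<Rightarrow> complex \<Rightarrow> (complex \<Rightarrow> real) \<Rightarrow> bool" where
  "is_Green_function \<Omega> z g \<longleftrightarrow> z \<in> \<Omega> \<and> g \<in> Green_candidates \<Omega> z \<and>
     (\<forall>h\<in>Green_candidates \<Omega> z. \<forall>w\<in>\<Omega> - {z}. g w \<le> h w)"

section \<open>The cone of positive harmonic functions vanishing on the finite boundary\<close>

definition P_infinity :: "complex set \<Rightarrow> (complex \<Rightarrow> real) set" where
  "P_infinity \<Omega> = {u. harmonic_on u \<Omega> \<and> (\<forall>z\<in>\<Omega>. 0 < u z) \<and>
     (\<forall>\<zeta>\<in>ext_compl \<Omega> - {None}. (u \<longlongrightarrow> 0) (tending_to \<Omega> \<zeta>))}"

definition P_infinity_dim_one :: "complex set \<Rightarrow> bool" where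
  "P_infinity_dim_one \<Omega> \<longleftrightarrow> P_infinity \<Omega> \<noteq> {} \<and>
     (\<forall>u\<in>P_infinity \<Omega>. \<forall>v\<in>P_infinity \<Omega>. \<exists>c::real. \<forall>z\<in>\<Omega>. v z = c * u z)"

end

theory Submission
  imports Defs "HOL-Complex_Analysis.Complex_Analysis"
begin

text \<open>
  The set \<open>E\<close> is the real line, with \<open>\<infinity>\<close>, minus gaps
  \<open>(ctr j - l j, ctr j + l j)\<close>, where \<open>ctr j = 2 * 4 ^ j\<close> and \<open>l j\<close> is one
  eighth of the increment of \<open>\<theta>\<close> from \<open>4 ^ (j - 1)\<close> to \<open>4 ^ j\<close>, or of
  \<open>\<theta> 1\<close> if \<open>j = 0\<close>. The increments telescope, which bounds
  \<open>\<theta>\<^sub>E\<close> by \<open>\<theta>\<close>, and by a discrete Hardy inequality the divergence of the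
  integral becomes \<open>\<Sum> (l j / 4 ^ j)\<^sup>2 = \<infinity>\<close>
  (\<open>power4_increments_not_summable\<close>).

  One mechanism, \<open>gap_minorant\<close>, turns this divergence into both conclusions. Suppose that
  \<open>h \<ge> 0\<close> is harmonic and \<open>h w \<ge> c * Im w\<close> in the upper half of the disc over the
  gap \<open>j\<close>. The mean value property gives \<open>h \<ge> c * l j / 8\<close> on the middle part of the
  gap, and this part, having length comparable with \<open>l j\<close>, contributes to \<open>h\<close> at each point
  of the upper half plane the corresponding multiple of its harmonic measure.

  For the Green function with pole in some gap, \<open>g w \<ge> c * Im w / norm w ^ 2\<close> for large
  \<open>w\<close> in the upper half plane, so that, as \<open>Y\<close> grows, \<open>Y * g (\<i> * Y)\<close>
  eventually exceeds a fixed multiple of each partial sum of \<open>\<Sum> (l j / 4 ^ j)\<^sup>2\<close>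
  (\<open>Green_Limsup\<close>).

  For the uniqueness of positive harmonic functions \<open>u\<close> vanishing on the finite boundary: linear growth
  of \<open>u\<close> along the imaginary axis would give \<open>u w \<ge> c * Im w\<close> and then
  \<open>u \<i> = \<infinity>\<close>; hence \<open>u (\<i> * R) / R\<close> is small for arbitrarily large
  \<open>R = 4 ^ k\<close> (\<open>vanishing_positive_small\<close>). The difference \<open>u z - u (cnj z)\<close>
  vanishes on the real axis, and the boundary Harnack inequality on the circle of radius \<open>4 ^ k\<close>, which
  stays away from the gaps, bounds it by a small multiple of \<open>Im z\<close>; so \<open>u\<close> is symmetric. On
  the same circles the boundary Harnack inequality makes any two such functions comparable with constants independent
  of \<open>k\<close>, and the symmetry makes the comparison the same in both half planes. The maximum principle
  yields comparability on the whole domain (\<open>P_infinity_comparable\<close>), and subtracting the largest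
  possible multiple of one function from the other leaves zero.

  Existence rests on least harmonic majorants, constructed by repeated Poisson modification
  (\<open>least_harmonic_majorant\<close>). The Green function is the least harmonic majorant of
  \<open>ln (norm (w - z))\<close> minus this logarithm. A member of \<open>P_infinity\<close> is a pointwise cluster
  point of normalised solutions in the domain truncated to discs; the boundary Harnack inequality bounds them, and
  barriers keep the boundary values zero. Each boundary point is an endpoint of a segment contained in the boundary
  (\<open>\<infinity>\<close> of a half line), and the real part of a fourth root on the complement of this segment is
  a barrier, so all points are regular.
\<close>

section \<open>Harmonic functions and the second derivative test\<close>

lemma harmonic_on_subset: "harmonic_on u S \<Longrightarrow> T \<subseteq> S \<Longrightarrow> harmonic_on u T"
  unfolding harmonic_on_def by (meson continuous_on_subset subsetD)

lemma harmonic_on_imp_continuous_on: "harmonic_on u S \<Longrightarrow> continuous_on S u"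
  unfolding harmonic_on_def gderiv_def
  by (metis continuous_at_imp_continuous_on has_derivative_continuous)

lemma harmonic_on_Re:
  assumes f: "f holomorphic_on S" and S: "open S"
  shows "harmonic_on (\<lambda>z. Re (f z)) S"
proof -
  have d1: "(f has_field_derivative deriv f z) (at z)" if "z \<in> S" for z
    using f S that holomorphic_derivI by blast
  have h1: "deriv f holomorphic_on S" and h2: "deriv (deriv f) holomorphic_on S"
    using f S by (auto intro: holomorphic_deriv)
  have d2: "(deriv f has_field_derivative deriv (deriv f) z) (at z)" if "z \<in> S" for z
    using h1 S that holomorphic_derivI by blast
  have c2: "continuous_on S (deriv (deriv f))"
    using h2 holomorphic_on_imp_continuous_on by blast
  show ?thesis
    unfolding harmonic_on_def
  proof (intro exI conjI ballI)
    fix z assume z: "z \<in> S"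
    have "((\<lambda>z. Re (f z)) has_derivative (\<lambda>h. Re (deriv f z * h))) (at z)"
      using d1[OF z] unfolding has_field_derivative_def
      by (auto intro!: derivative_eq_intros)
    moreover have "(\<lambda>h. Re (deriv f z * h)) = (\<lambda>h. inner h (cnj (deriv f z)))"
      by (auto simp: inner_complex_def algebra_simps)
    ultimately show "GDERIV (\<lambda>z. Re (f z)) z :> cnj (deriv f z)"
      unfolding gderiv_def by simp
    show "((\<lambda>z. cnj (deriv f z)) has_derivative (\<lambda>h. cnj (deriv (deriv f) z * h))) (at z)"
      using d2[OF z] unfolding has_field_derivative_def
      by (auto intro!: derivative_eq_intros)
    show "Re (cnj (deriv (deriv f) z * 1)) + Im (cnj (deriv (deriv f) z * \<i>)) = 0"
      by simp
  next
    show "continuous_on S (\<lambda>z. cnj (deriv (deriv f) z * 1))"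
      "continuous_on S (\<lambda>z. cnj (deriv (deriv f) z * \<i>))"
      using c2 by (auto intro!: continuous_intros)
  qed
qed

lemma harmonic_on_cong:
  assumes "harmonic_on u S" "open S" "\<And>z. z \<in> S \<Longrightarrow> u z = v z"
  shows "harmonic_on v S"
proof -
  obtain G H where GH: "\<forall>z\<in>S. GDERIV u z :> G z \<and> (G has_derivative H z) (at z) \<and>
                     Re (H z 1) + Im (H z \<i>) = 0"
    "continuous_on S (\<lambda>z. H z 1)" "continuous_on S (\<lambda>z. H z \<i>)"
    using assms(1) unfolding harmonic_on_def by blast
  have "GDERIV v z :> G z" if "z \<in> S" for z
    using GH(1) assms(2,3) that unfolding gderiv_def
    by (metis has_derivative_transform_within_open)
  with GH show ?thesis unfolding harmonic_on_def by blast
qed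

lemma harmonic_on_const [simp]: "harmonic_on (\<lambda>_. c) S"
  unfolding harmonic_on_def
  by (rule exI[of _ "\<lambda>_. 0"], rule exI[of _ "\<lambda>_ _. 0"]) (auto simp: gderiv_def)

lemma harmonic_on_add:
  assumes "harmonic_on u S" "harmonic_on v S"
  shows "harmonic_on (\<lambda>z. u z + v z) S"
proof -
  obtain G H where GH: "\<forall>z\<in>S. GDERIV u z :> G z \<and> (G has_derivative H z) (at z) \<and>
                     Re (H z 1) + Im (H z \<i>) = 0"
    "continuous_on S (\<lambda>z. H z 1)" "continuous_on S (\<lambda>z. H z \<i>)"
    using assms(1) unfolding harmonic_on_def by blast
  obtain G' H' where GH': "\<forall>z\<in>S. GDERIV v z :> G' z \<and> (G' has_derivative H' z) (at z) \<and>
                     Re (H' z 1) + Im (H' z \<i>) = 0"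
    "continuous_on S (\<lambda>z. H' z 1)" "continuous_on S (\<lambda>z. H' z \<i>)"
    using assms(2) unfolding harmonic_on_def by blast
  show ?thesis
    unfolding harmonic_on_def
    by (intro exI[of _ "\<lambda>z. G z + G' z"] exI[of _ "\<lambda>z h. H z h + H' z h"] conjI ballI
        GDERIV_add has_derivative_add continuous_on_add) (use GH GH' in force)+
qed

lemma harmonic_on_cmult:
  assumes "harmonic_on u S"
  shows "harmonic_on (\<lambda>z. c * u z) S"
proof -
  obtain G H where GH: "\<forall>z\<in>S. GDERIV u z :> G z \<and> (G has_derivative H z) (at z) \<and>
                     Re (H z 1) + Im (H z \<i>) = 0"
    "continuous_on S (\<lambda>z. H z 1)" "continuous_on S (\<lambda>z. H z \<i>)"
    using assms(1) unfolding harmonic_on_def by blast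
  have "GDERIV (\<lambda>z. c * u z) z :> c *\<^sub>R G z" if "z \<in> S" for z
    using GH(1) that GDERIV_mult[OF GDERIV_const, of u z "G z" c] by simp
  moreover have "Re (c *\<^sub>R H z 1) + Im (c *\<^sub>R H z \<i>) = 0" if "z \<in> S" for z
    using GH(1) that by (simp flip: distrib_left)
  ultimately show ?thesis
    unfolding harmonic_on_def
    by (intro exI[of _ "\<lambda>z. c *\<^sub>R G z"] exI[of _ "\<lambda>z h. c *\<^sub>R H z h"] conjI ballI
        continuous_on_scaleR continuous_on_const has_derivative_scaleR_right) (use GH in auto)
qed

lemma harmonic_on_uminus: "harmonic_on u S \<Longrightarrow> harmonic_on (\<lambda>z. - u z) S"
  using harmonic_on_cmult[of u S "-1"] by simp

lemma harmonic_on_diff: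
  "harmonic_on u S \<Longrightarrow> harmonic_on v S \<Longrightarrow> harmonic_on (\<lambda>z. u z - v z) S"
  using harmonic_on_add[of u S "\<lambda>z. - v z"] harmonic_on_uminus[of v S] by simp

lemma harmonic_on_Im: "harmonic_on (\<lambda>w. c * Im w) S"
proof -
  have "harmonic_on (\<lambda>w. Re (- \<i> * of_real c * w)) UNIV" by (intro harmonic_on_Re holomorphic_intros) auto
  then show ?thesis using harmonic_on_subset by fastforce
qed

text \<open>
  Gradient and second derivative are determined pointwise, so local choices of them agree with a canonical one.
\<close>

lemma harmonic_on_locally:
  assumes "\<And>z. z \<in> S \<Longrightarrow> \<exists>T. open T \<and> z \<in> T \<and> harmonic_on u T"
  shows "harmonic_on u S"
proof -
  define G where "G z = (THE D. GDERIV u z :> D)" for z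
  define H where "H z = frechet_derivative G (at z)" for z
  have loc: "GDERIV u z :> G z \<and> (G has_derivative H z) (at z) \<and> Re (H z 1) + Im (H z \<i>) = 0
     \<and> isCont (\<lambda>z. H z 1) z \<and> isCont (\<lambda>z. H z \<i>) z" if zS: "z \<in> S" for z
  proof -
    obtain T where T: "open T" "z \<in> T" "harmonic_on u T" using assms zS by blast
    obtain G' H' where GH: "\<forall>z\<in>T. GDERIV u z :> G' z \<and> (G' has_derivative H' z) (at z) \<and>
                     Re (H' z 1) + Im (H' z \<i>) = 0"
    "continuous_on T (\<lambda>z. H' z 1)" "continuous_on T (\<lambda>z. H' z \<i>)"
      using T(3) unfolding harmonic_on_def by blast
    have GG: "G w = G' w" if w: "w \<in> T" for w
    proof -
      have "GDERIV u w :> G' w" using GH w by blast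
      moreover have "D = G' w" if "GDERIV u w :> D" for D
      proof -
        have "(\<lambda>h. inner h D) = (\<lambda>h. inner h (G' w))"
          using that \<open>GDERIV u w :> G' w\<close> unfolding gderiv_def
          by (rule has_derivative_unique)
        then have "inner (D - G' w) D = inner (D - G' w) (G' w)" by metis
        then show ?thesis by (simp add: inner_diff_left inner_diff_right)
           (smt (verit, best) inner_commute inner_eq_zero_iff inner_diff_left inner_diff_right right_minus_eq)
      qed
      ultimately show ?thesis unfolding G_def by (metis the_equality)
    qed
    have dG: "(G has_derivative H' w) (at w)" if w: "w \<in> T" for w
      using GH(1) w T(1) GG by (metis has_derivative_transform_within_open)
    have HH: "H w = H' w" if w: "w \<in> T" for w
      unfolding H_def using dG[OF w] by (metis frechet_derivative_at)
    have "isCont (\<lambda>z. H' z 1) z" "isCont (\<lambda>z. H' z \<i>) z"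
      using GH(2,3) T(1,2) by (auto simp: continuous_on_eq_continuous_at)
    moreover have ev: "eventually (\<lambda>w. w \<in> T) (nhds z)"
      using T(1,2) by (simp add: eventually_nhds_in_open)
    then have "eventually (\<lambda>w. H w 1 = H' w 1) (nhds z)" "eventually (\<lambda>w. H w \<i> = H' w \<i>) (nhds z)"
      by (auto elim: eventually_mono simp: HH)
    ultimately have "isCont (\<lambda>z. H z 1) z" "isCont (\<lambda>z. H z \<i>) z"
      using isCont_cong[of "\<lambda>w. H w 1" "\<lambda>w. H' w 1" z] isCont_cong[of "\<lambda>w. H w \<i>" "\<lambda>w. H' w \<i>" z]
      by simp_all
    then show ?thesis using GH T(2) GG HH dG by (metis)
  qed
  then show ?thesis
    unfolding harmonic_on_def by (meson continuous_at_imp_continuous_on)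
qed

lemma second_derivative_le_0_at_max:
  fixes \<phi> :: "real \<Rightarrow> real"
  assumes d: "0 < d" and D1: "\<And>t. \<bar>t\<bar> < d \<Longrightarrow> DERIV \<phi> t :> \<phi>' t"
    and D2: "DERIV \<phi>' 0 :> D" and mx: "\<And>t. \<bar>t\<bar> < d \<Longrightarrow> \<phi> t \<le> \<phi> 0"
  shows "D \<le> 0"
proof (rule ccontr)
  assume "\<not> D \<le> 0"
  have z: "\<phi>' 0 = 0"
    using DERIV_local_max[of \<phi> "\<phi>' 0" 0 d] D1[of 0] d mx by auto
  obtain e where e: "e > 0" "\<And>h. 0 < h \<Longrightarrow> h < e \<Longrightarrow> \<phi>' 0 < \<phi>' (0 + h)"
    using DERIV_pos_inc_right[OF D2] \<open>\<not> D \<le> 0\<close> by auto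
  define t where "t = min d e / 2"
  have t: "0 < t" "t < d" "t < e" using d e(1) by (auto simp: t_def)
  obtain c where c: "0 < c" "c < t" "\<phi> t - \<phi> 0 = (t - 0) * \<phi>' c"
    using MVT2[of 0 t \<phi> \<phi>'] t D1 by (smt (verit))
  then have "\<phi>' c > 0" using e(2)[of c] t z by simp
  then have "\<phi> t > \<phi> 0" using c t by (smt (verit) mult_pos_pos)
  then show False using mx[of t] t by simp
qed

text \<open>
  Adding \<open>\<epsilon> * norm (z - a) ^ 2\<close> makes the Laplacian strictly positive, which contradicts the
  second derivative test along the two axes at an interior maximum. The number \<open>\<epsilon>\<close> is so small
  that the maximum stays off the sphere.
\<close>

lemma harmonic_le_0_on_ball:
  assumes h: "harmonic_on u (ball a r)" and c: "continuous_on (cball a r) u"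
    and b: "\<And>z. z \<in> sphere a r \<Longrightarrow> u z \<le> 0" and p: "p \<in> ball a r"
  shows "u p \<le> 0"
proof (rule ccontr)
  assume "\<not> u p \<le> 0"
  have r: "r > 0" using p by (auto simp: dist_norm intro: le_less_trans[OF norm_ge_zero])
  define \<epsilon> where "\<epsilon> = u p / (2 * r\<^sup>2)"
  have \<epsilon>: "\<epsilon> > 0" using r \<open>\<not> u p \<le> 0\<close> by (simp add: \<epsilon>_def)
  define v where "v z = u z + \<epsilon> * (norm (z - a))\<^sup>2" for z
  have cv: "continuous_on (cball a r) v" unfolding v_def by (intro continuous_intros c)
  obtain q where q: "q \<in> cball a r" "\<And>z. z \<in> cball a r \<Longrightarrow> v z \<le> v q"
    using continuous_attains_sup[OF compact_cball _ cv] r by (metis cball_eq_empty less_le_not_le linorder_not_less)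
  have "u p \<le> v p" using \<epsilon> by (simp add: v_def)
  also have "v p \<le> v q" using q(2)[of p] p by simp
  finally have vq: "u p \<le> v q" .
  have "q \<notin> sphere a r"
  proof
    assume "q \<in> sphere a r"
    then have "v q \<le> \<epsilon> * r\<^sup>2" using b[of q] by (simp add: v_def dist_norm norm_minus_commute)
    also have "\<dots> = u p / 2" using r by (simp add: \<epsilon>_def field_simps)
    finally show False using vq \<open>\<not> u p \<le> 0\<close> by simp
  qed
  then have qb: "q \<in> ball a r" using q(1) by auto
  obtain G H where GH: "\<forall>z\<in>ball a r. GDERIV u z :> G z \<and> (G has_derivative H z) (at z) \<and>
                     Re (H z 1) + Im (H z \<i>) = 0"
    using h unfolding harmonic_on_def by blast
  obtain d where d: "d > 0" "ball q d \<subseteq> ball a r" using qb open_ball open_contains_ball by blast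
  have main: "inner (H q e) e + 2 * \<epsilon> \<le> 0" if e: "norm e = 1" for e
  proof -
    have mem: "q + t *\<^sub>R e \<in> ball a r" if "\<bar>t\<bar> < d" for t
    proof -
      have "q + t *\<^sub>R e \<in> ball q d" using that e by (simp add: dist_norm)
      then show ?thesis using d(2) by blast
    qed
    define \<phi>' where "\<phi>' t = inner e (G (q + t *\<^sub>R e)) + 2 * \<epsilon> * inner e (q + t *\<^sub>R e - a)" for t
    have D1: "DERIV (\<lambda>t. v (q + t *\<^sub>R e)) t :> \<phi>' t" if t: "\<bar>t\<bar> < d" for t
    proof -
      have "(u has_derivative (\<lambda>h. inner h (G (q + t *\<^sub>R e)))) (at (q + t *\<^sub>R e))"
        using GH mem[OF t] unfolding gderiv_def by blast
      moreover have "((\<lambda>t. q + t *\<^sub>R e) has_derivative (\<lambda>s. s *\<^sub>R e)) (at t)"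
        by (auto intro!: derivative_eq_intros)
      ultimately have "((\<lambda>t. u (q + t *\<^sub>R e)) has_derivative (\<lambda>s. inner (s *\<^sub>R e) (G (q + t *\<^sub>R e)))) (at t)"
        by (rule has_derivative_compose[rotated])
      moreover have "((\<lambda>t. \<epsilon> * inner (q + t *\<^sub>R e - a) (q + t *\<^sub>R e - a)) has_derivative 
            (\<lambda>s. \<epsilon> * (2 * inner (s *\<^sub>R e) (q + t *\<^sub>R e - a)))) (at t)"
        by (auto intro!: derivative_eq_intros simp: inner_commute)
      ultimately have "((\<lambda>t. u (q + t *\<^sub>R e) + \<epsilon> * inner (q + t *\<^sub>R e - a) (q + t *\<^sub>R e - a)) has_derivative
          (\<lambda>s. inner (s *\<^sub>R e) (G (q + t *\<^sub>R e)) + \<epsilon> * (2 * inner (s *\<^sub>R e) (q + t *\<^sub>R e - a)))) (at t)"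
        by (rule has_derivative_add)
      moreover have "(\<lambda>s. inner (s *\<^sub>R e) (G (q + t *\<^sub>R e)) + \<epsilon> * (2 * inner (s *\<^sub>R e) (q + t *\<^sub>R e - a)))
         = (\<lambda>s. \<phi>' t * s)"
        by (auto simp: \<phi>'_def algebra_simps)
      ultimately show ?thesis
        unfolding has_field_derivative_def v_def by (simp add: dot_square_norm)
    qed
    have D2: "DERIV \<phi>' 0 :> inner e (H q e) + 2 * \<epsilon>"
    proof -
      have "(G has_derivative H q) (at (q + 0 *\<^sub>R e))" using GH qb by simp
      moreover have "((\<lambda>t. q + t *\<^sub>R e) has_derivative (\<lambda>s. s *\<^sub>R e)) (at 0)"
        by (auto intro!: derivative_eq_intros)
      ultimately have "((\<lambda>t. G (q + t *\<^sub>R e)) has_derivative (\<lambda>s. H q (s *\<^sub>R e))) (at 0)"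
        by (rule has_derivative_compose[rotated])
      then have "(\<phi>' has_derivative (\<lambda>s. inner e (H q (s *\<^sub>R e)) + 2 * \<epsilon> * inner e (s *\<^sub>R e))) (at 0)"
        unfolding \<phi>'_def by (auto intro!: derivative_eq_intros)
      moreover have "linear (H q)"
        using GH qb has_derivative_linear by blast
      then have "(\<lambda>s. inner e (H q (s *\<^sub>R e)) + 2 * \<epsilon> * inner e (s *\<^sub>R e)) = (\<lambda>s. (inner e (H q e) + 2 * \<epsilon>) * s)"
        using e by (auto simp: linear_scale dot_square_norm algebra_simps)
      ultimately show ?thesis unfolding has_field_derivative_def by simp
    qed
    have "inner e (H q e) + 2 * \<epsilon> \<le> 0"
    proof (rule second_derivative_le_0_at_max[OF d(1) D1 D2])
      fix t assume t: "\<bar>t\<bar> < d"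
      show "v (q + t *\<^sub>R e) \<le> v (q + 0 *\<^sub>R e)" using q(2)[of "q + t *\<^sub>R e"] mem[OF t] by simp
    qed auto
    then show ?thesis by (simp add: inner_commute)
  qed
  have "inner (H q 1) 1 = Re (H q 1)" "inner (H q \<i>) \<i> = Im (H q \<i>)"
    by (simp_all add: inner_complex_def)
  moreover have "Re (H q 1) + Im (H q \<i>) = 0" using GH qb by blast
  ultimately show False using main[of 1] main[of \<i>] \<epsilon> by simp
qed

section \<open>The Poisson integral\<close>

definition circ_mean :: "(complex \<Rightarrow> real) \<Rightarrow> complex \<Rightarrow> real \<Rightarrow> real" where
  "circ_mean u a r = integral {0..2 * pi} (\<lambda>t. u (a + of_real r * cis t)) / (2 * pi)"

definition poisson_kernel :: "complex \<Rightarrow> real \<Rightarrow> complex \<Rightarrow> complex \<Rightarrow> real" where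
  "poisson_kernel a r z \<zeta> = (r\<^sup>2 - (norm (z - a))\<^sup>2) / (norm (\<zeta> - z))\<^sup>2"

definition poisson_integral :: "(complex \<Rightarrow> real) \<Rightarrow> complex \<Rightarrow> real \<Rightarrow> complex \<Rightarrow> real" where
  "poisson_integral f a r z = circ_mean (\<lambda>\<zeta>. poisson_kernel a r z \<zeta> * f \<zeta>) a r"

lemma circ_in_sphere [simp]: "r \<ge> 0 \<Longrightarrow> a + of_real r * cis t \<in> sphere a r"
  by (simp add: dist_norm norm_mult)

lemma circ_integrable:
  fixes f :: "complex \<Rightarrow> real"
  assumes "continuous_on (sphere a r) f" "r \<ge> 0"
  shows "(\<lambda>t. f (a + of_real r * cis t)) integrable_on {x..y::real}"
proof (rule integrable_continuous_real)
  show "continuous_on {x..y} (\<lambda>t. f (a + of_real r * cis t))"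
    by (rule continuous_on_compose2[OF assms(1), where f = "\<lambda>t. a + of_real r * cis t"])
      (use assms(2) circ_in_sphere in \<open>auto intro!: continuous_intros\<close>)
qed

lemma circ_mean_mono:
  assumes "continuous_on (sphere a r) f" "continuous_on (sphere a r) g" "r \<ge> 0"
    "\<And>z. z \<in> sphere a r \<Longrightarrow> f z \<le> g z"
  shows "circ_mean f a r \<le> circ_mean g a r"
  unfolding circ_mean_def
  by (intro divide_right_mono integral_le circ_integrable assms circ_in_sphere) auto

lemma circ_mean_cong:
  assumes "r \<ge> 0" "\<And>z. z \<in> sphere a r \<Longrightarrow> f z = g z"
  shows "circ_mean f a r = circ_mean g a r"
  unfolding circ_mean_def using assms by (metis circ_in_sphere)

lemma circ_mean_add:
  assumes "continuous_on (sphere a r) f" "continuous_on (sphere a r) g" "r \<ge> 0"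
  shows "circ_mean (\<lambda>z. f z + g z) a r = circ_mean f a r + circ_mean g a r"
  unfolding circ_mean_def
  by (simp add: integral_add circ_integrable assms add_divide_distrib)

lemma circ_mean_cmult: "circ_mean (\<lambda>z. c * f z) a r = c * circ_mean f a r"
  unfolding circ_mean_def by simp

lemma circ_mean_const [simp]: "circ_mean (\<lambda>z. c) a r = c"
  unfolding circ_mean_def by simp

lemma circ_mean_uminus: "circ_mean (\<lambda>z. - f z) a r = - circ_mean f a r"
  using circ_mean_cmult[of "-1" f a r] by simp

lemma circ_mean_diff:
  assumes "continuous_on (sphere a r) f" "continuous_on (sphere a r) g" "r \<ge> 0"
  shows "circ_mean (\<lambda>z. f z - g z) a r = circ_mean f a r - circ_mean g a r"
  unfolding circ_mean_def
  by (simp add: integral_diff circ_integrable assms diff_divide_distrib)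

lemma circ_mean_abs_le:
  assumes "continuous_on (sphere a r) f" "r \<ge> 0"
  shows "\<bar>circ_mean f a r\<bar> \<le> circ_mean (\<lambda>z. \<bar>f z\<bar>) a r"
proof -
  have c: "continuous_on (sphere a r) (\<lambda>z. \<bar>f z\<bar>)" "continuous_on (sphere a r) (\<lambda>z. - f z)"
    using assms(1) by (auto intro: continuous_intros)
  have "circ_mean f a r \<le> circ_mean (\<lambda>z. \<bar>f z\<bar>) a r"
    by (rule circ_mean_mono) (use assms c in auto)
  moreover have "circ_mean (\<lambda>z. - f z) a r \<le> circ_mean (\<lambda>z. \<bar>f z\<bar>) a r"
    by (rule circ_mean_mono) (use assms c in auto)
  ultimately show ?thesis by (simp add: circ_mean_uminus)
qed

lemma has_contour_integral_circlepath_iff: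
  "(f has_contour_integral I) (circlepath a r) \<longleftrightarrow>
     ((\<lambda>t. f (a + of_real r * cis t) * of_real r * \<i> * cis t) has_integral I) {0..2 * pi}"
  unfolding circlepath_def using has_contour_integral_part_circlepath_iff[of 0 "2*pi" f I a r] by simp

lemma Re_complex_of_real_mult: "Re (of_real x * z) = x * Re z"
  by simp

text \<open>
  The Poisson kernel is the real part of
  \<open>(\<zeta> + z - 2 * a) / (\<zeta> - z) = 2 * (\<zeta> - a) / (\<zeta> - z) - 1\<close>. Hence the Poisson
  integral is the real part of a combination of Cauchy integrals, from which harmonicity and, for constant data, the
  total mass of the kernel can be read off.
\<close>

lemma poisson_integral_eq_Re_Schwarz:
  fixes f :: "complex \<Rightarrow> real"
  assumes f: "continuous_on (sphere a r) f" and z: "z \<in> ball a r"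
  defines "g \<equiv> \<lambda>w. contour_integral (circlepath a r) (\<lambda>u. of_real (f u) / (u - w))"
  shows "poisson_integral f a r z = Re ((2 * g z - g a) / (2 * of_real pi * \<i>))"
proof -
  have r: "r > 0" using z by (auto simp: dist_norm intro: le_less_trans[OF norm_ge_zero])
  have fc: "continuous_on (sphere a r) (\<lambda>u. complex_of_real (f u))"
    using f by (intro continuous_intros)
  have gi: "((\<lambda>t. of_real (f (a + of_real r * cis t)) / (a + of_real r * cis t - w) * of_real r * \<i> * cis t)
        has_integral g w) {0..2*pi}" if w: "w \<in> ball a r" for w
  proof -
    have "continuous_on (path_image (circlepath a r)) (\<lambda>u. of_real (f u) / (u - w))"
      using fc r w by (auto intro!: continuous_intros simp: dist_norm)
    then have "(\<lambda>u. of_real (f u) / (u - w)) contour_integrable_on circlepath a r"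
      by (simp add: contour_integrable_continuous_circlepath)
    then show ?thesis
      unfolding g_def
      using has_contour_integral_circlepath_iff[of "\<lambda>u. of_real (f u) / (u - w)"] has_contour_integral_integral
      by (metis (no_types, lifting))
  qed
  let ?\<zeta> = "\<lambda>t. a + of_real r * cis t"
  let ?K = "\<lambda>t. (2 * (of_real (f (?\<zeta> t)) / (?\<zeta> t - z) * of_real r * \<i> * cis t)
        - of_real (f (?\<zeta> t)) / (?\<zeta> t - a) * of_real r * \<i> * cis t) / (2 * of_real pi * \<i>)"
  have "(?K has_integral ((2 * g z - g a) / (2 * of_real pi * \<i>))) {0..2*pi}"
    using gi[OF z] gi[of a] r
    by (intro has_integral_divide has_integral_diff has_integral_mult_right) auto
  then have "((\<lambda>t. Re (?K t)) has_integral Re ((2 * g z - g a) / (2 * of_real pi * \<i>))) {0..2*pi}"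
    by (rule has_integral_Re)
  moreover have "Re (?K t) = poisson_kernel a r z (?\<zeta> t) * f (?\<zeta> t) / (2 * pi)" for t
  proof -
    define c where "c = of_real r * cis t"
    have nc: "norm c = r" using r by (simp add: c_def norm_mult)
    have c0: "c \<noteq> 0" using nc r by auto
    have cz: "c \<noteq> z - a" using nc z by (auto simp: dist_norm norm_minus_commute)
    have k: "?K t = of_real (f (?\<zeta> t) / (2 * pi)) * ((c + (z - a)) / (c - (z - a)))"
    proof -
      have "?K t = of_real (f (?\<zeta> t)) * (2 * c / (c - (z - a)) - 1) / (2 * of_real pi)"
        using c0 cz by (simp add: c_def[symmetric] divide_simps) (simp add: c_def algebra_simps)
      also have "2 * c / (c - (z - a)) - 1 = (c + (z - a)) / (c - (z - a))"
        using cz by (simp add: divide_simps)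
      finally show ?thesis by simp
    qed
    have "Re ((c + (z - a)) / (c - (z - a))) = Re ((c + (z - a)) * cnj (c - (z - a))) / (norm (c - (z - a)))\<^sup>2"
      by (simp add: complex_div_cnj[of "c + (z - a)"] Re_divide_of_real flip: of_real_power)
    also have "Re ((c + (z - a)) * cnj (c - (z - a))) = (norm c)\<^sup>2 - (norm (z - a))\<^sup>2"
      unfolding cmod_power2 by (simp add: power2_eq_square algebra_simps)
    finally have "Re ((c + (z - a)) / (c - (z - a))) = poisson_kernel a r z (?\<zeta> t)"
      unfolding poisson_kernel_def nc by (simp add: c_def algebra_simps)
    moreover have "Re (?K t) = f (?\<zeta> t) / (2 * pi) * Re ((c + (z - a)) / (c - (z - a)))"
      unfolding k by (rule Re_complex_of_real_mult)
    ultimately show ?thesis by simp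
  qed
  ultimately have "((\<lambda>t. poisson_kernel a r z (?\<zeta> t) * f (?\<zeta> t) / (2 * pi)) has_integral
      Re ((2 * g z - g a) / (2 * of_real pi * \<i>))) {0..2*pi}" by simp
  from integral_unique[OF this] show ?thesis
    unfolding poisson_integral_def circ_mean_def by simp
qed

lemma poisson_integral_holomorphic:
  assumes f: "continuous_on (sphere a r) f"
  obtains F where "F holomorphic_on ball a r" "\<And>z. z \<in> ball a r \<Longrightarrow> poisson_integral f a r z = Re (F z)"
proof (cases "r > 0")
  case r: True
  define g where "g = (\<lambda>w. contour_integral (circlepath a r) (\<lambda>u. of_real (f u) / (u - w)))"
  have fc: "continuous_on (path_image (circlepath a r)) (\<lambda>u. complex_of_real (f u))"
    using f r by (auto intro!: continuous_intros)
  have int: "((\<lambda>u. of_real (f u) / (u - w)^1) has_contour_integral g w) (circlepath a r)"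
    if w: "w \<in> ball a r" for w
  proof -
    have "continuous_on (path_image (circlepath a r)) (\<lambda>u. of_real (f u) / (u - w))"
      using fc r w by (auto intro!: continuous_intros simp: dist_norm)
    then show ?thesis
      unfolding g_def by (simp add: contour_integrable_continuous_circlepath has_contour_integral_integral)
  qed
  have "g holomorphic_on ball a r"
    unfolding holomorphic_on_open[OF open_ball]
    using Cauchy_next_derivative_circlepath(2)[OF fc int] by fastforce
  then have "(\<lambda>z. (2 * g z - g a) / (2 * of_real pi * \<i>)) holomorphic_on ball a r"
    by (intro holomorphic_intros) auto
  then show ?thesis
    using poisson_integral_eq_Re_Schwarz[OF f] that unfolding g_def by blast
next
  case False
  then have "ball a r = {}" by simp
  then show ?thesis using that[of "\<lambda>_. 0"] by (metis empty_iff holomorphic_on_const)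
qed

lemma harmonic_on_poisson_integral:
  assumes "continuous_on (sphere a r) f"
  shows "harmonic_on (poisson_integral f a r) (ball a r)"
  using poisson_integral_holomorphic[OF assms] harmonic_on_Re harmonic_on_cong
  by (metis open_ball)

lemma poisson_integral_1:
  assumes z: "z \<in> ball a r"
  shows "poisson_integral (\<lambda>_. 1) a r z = 1"
proof -
  have r: "r > 0" using z by (auto simp: dist_norm intro: le_less_trans[OF norm_ge_zero])
  have "contour_integral (circlepath a r) (\<lambda>u. complex_of_real 1 / (u - w)) = 2 * of_real pi * \<i>"
    if "w \<in> ball a r" for w
    using Cauchy_integral_circlepath_simple[of "\<lambda>_. 1" a r w] that
    by (intro contour_integral_unique) (auto simp: dist_norm norm_minus_commute)
  then show ?thesis
    using poisson_integral_eq_Re_Schwarz[of a r "\<lambda>_. 1" z] z r by simp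
qed

lemma continuous_on_poisson_kernel:
  assumes "z \<in> ball a r" shows "continuous_on (sphere a r) (poisson_kernel a r z)"
  unfolding poisson_kernel_def using assms by (auto intro!: continuous_intros)

lemma poisson_kernel_nonneg: "z \<in> ball a r \<Longrightarrow> poisson_kernel a r z \<zeta> \<ge> 0"
  unfolding poisson_kernel_def
  by (intro divide_nonneg_nonneg) (auto simp: dist_norm norm_minus_commute abs_le_square_iff[symmetric])

lemma poisson_integral_cmult: "poisson_integral (\<lambda>\<zeta>. c * f \<zeta>) a r z = c * poisson_integral f a r z"
  unfolding poisson_integral_def using circ_mean_cmult[of c "\<lambda>\<zeta>. poisson_kernel a r z \<zeta> * f \<zeta>"]
  by (simp add: mult.left_commute)

lemma poisson_integral_const: "z \<in> ball a r \<Longrightarrow> poisson_integral (\<lambda>_. c) a r z = c"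
  using poisson_integral_cmult[of c "\<lambda>_. 1"] poisson_integral_1 by simp

lemma poisson_integral_diff:
  assumes "continuous_on (sphere a r) f" "continuous_on (sphere a r) g" "z \<in> ball a r"
  shows "poisson_integral (\<lambda>\<zeta>. f \<zeta> - g \<zeta>) a r z = poisson_integral f a r z - poisson_integral g a r z"
proof -
  have r: "r \<ge> 0" using assms(3) by (auto simp: dist_norm intro: order_trans[OF norm_ge_zero less_imp_le])
  show ?thesis
  unfolding poisson_integral_def 
    using circ_mean_diff[of a r "\<lambda>\<zeta>. poisson_kernel a r z \<zeta> * f \<zeta>" "\<lambda>\<zeta>. poisson_kernel a r z \<zeta> * g \<zeta>"]
      assms r continuous_on_poisson_kernel[OF assms(3)]
    by (simp add: right_diff_distrib continuous_on_mult)
qed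

lemma poisson_integral_center: "r > 0 \<Longrightarrow> poisson_integral f a r a = circ_mean f a r"
  unfolding poisson_integral_def 
  by (intro circ_mean_cong) (auto simp: poisson_kernel_def dist_norm norm_minus_commute)

text \<open>
  By continuity \<open>\<bar>f \<zeta> - f b\<bar> \<le> e / 2 + C * norm (\<zeta> - b) ^ 2\<close> on the whole
  circle, and the square is harmless because
  \<open>norm (\<zeta> - b) ^ 2 \<le> 2 * norm (\<zeta> - z) ^ 2 + 2 * norm (z - b) ^ 2\<close>, where the first term
  cancels the denominator of the kernel.
\<close>

lemma poisson_integral_boundary:
  assumes f: "continuous_on (sphere a r) f" and r: "r > 0" and b: "b \<in> sphere a r"
  shows "(poisson_integral f a r \<longlongrightarrow> f b) (at b within ball a r)"
proof (rule tendstoI)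
  fix e :: real assume e: "e > 0"
  obtain M where M: "\<And>z. z \<in> sphere a r \<Longrightarrow> \<bar>f z\<bar> \<le> M" 
    using compact_imp_bounded[OF compact_continuous_image[OF f compact_sphere]]
    unfolding bounded_iff by (metis imageI real_norm_def)
  have M0: "M \<ge> 0" using M[OF b] by linarith
  obtain d where d: "d > 0" "\<And>z. z \<in> sphere a r \<Longrightarrow> dist z b < d \<Longrightarrow> \<bar>f z - f b\<bar> < e/2"
    using f b e unfolding continuous_on_iff dist_real_def by (metis half_gt_zero)
  define C where "C = 2 * M / d\<^sup>2"
  have C0: "C \<ge> 0" using M0 by (simp add: C_def)
  have pt: "\<bar>f z - f b\<bar> \<le> e/2 + C * (norm (z - b))\<^sup>2" if z: "z \<in> sphere a r" for z
  proof (cases "dist z b < d")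
    case True
    then show ?thesis using d(2)[OF z True] C0 by (smt (verit) mult_nonneg_nonneg zero_le_power2)
  next
    case False
    then have "d\<^sup>2 \<le> (norm (z - b))\<^sup>2" using d(1) by (simp add: dist_norm power_mono)
    then have "C * d\<^sup>2 \<le> C * (norm (z - b))\<^sup>2" using C0 by (rule mult_left_mono)
    then have "2 * M \<le> C * (norm (z - b))\<^sup>2" using d(1) by (simp add: C_def)
    then show ?thesis using M[OF z] M[OF b] e by linarith
  qed
  let ?w = "\<lambda>z. 2 * C * (r\<^sup>2 - (norm (z - a))\<^sup>2) + 2 * C * (norm (z - b))\<^sup>2"
  have main: "\<bar>poisson_integral f a r z - f b\<bar> \<le> e/2 + ?w z" if z: "z \<in> ball a r" for z
  proof -
    define P where "P = poisson_kernel a r z"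
    have cP: "continuous_on (sphere a r) P" unfolding P_def by (rule continuous_on_poisson_kernel[OF z])
    have P0: "P \<zeta> \<ge> 0" for \<zeta> unfolding P_def by (rule poisson_kernel_nonneg[OF z])
    have "poisson_integral f a r z - f b = poisson_integral (\<lambda>\<zeta>. f \<zeta> - f b) a r z"
      using poisson_integral_diff[OF f continuous_on_const z] poisson_integral_const[OF z] by simp
    also have "\<bar>\<dots>\<bar> \<le> circ_mean (\<lambda>\<zeta>. \<bar>P \<zeta> * (f \<zeta> - f b)\<bar>) a r"
      unfolding poisson_integral_def P_def[symmetric]
      by (rule circ_mean_abs_le) (use r f cP in \<open>auto intro!: continuous_intros\<close>)
    also have "\<dots> \<le> circ_mean (\<lambda>\<zeta>. (e/2 + 2 * C * (norm (z - b))\<^sup>2) * P \<zeta> + 2 * C * (r\<^sup>2 - (norm (z - a))\<^sup>2)) a r"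
    proof (rule circ_mean_mono)
      fix \<zeta> assume \<zeta>: "\<zeta> \<in> sphere a r"
      have nz: "norm (\<zeta> - z) \<noteq> 0" using \<zeta> z by auto
      have "(norm (\<zeta> - b))\<^sup>2 \<le> (norm (\<zeta> - z) + norm (z - b))\<^sup>2"
        by (intro power_mono) (use norm_triangle_ineq[of "\<zeta> - z" "z - b"] in auto)
      also have "\<dots> \<le> 2 * (norm (\<zeta> - z))\<^sup>2 + 2 * (norm (z - b))\<^sup>2"
        using sum_squares_bound[of "norm (\<zeta> - z)" "norm (z - b)"] by (simp add: power2_sum)
      finally have "P \<zeta> * (norm (\<zeta> - b))\<^sup>2 \<le> P \<zeta> * (2 * (norm (\<zeta> - z))\<^sup>2 + 2 * (norm (z - b))\<^sup>2)"
        using P0 by (intro mult_left_mono)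
      also have "\<dots> = 2 * (r\<^sup>2 - (norm (z - a))\<^sup>2) + 2 * (norm (z - b))\<^sup>2 * P \<zeta>"
        using nz by (simp add: P_def poisson_kernel_def field_simps)
      finally have 1: "P \<zeta> * (norm (\<zeta> - b))\<^sup>2 \<le> \<dots>" .
      have "\<bar>P \<zeta> * (f \<zeta> - f b)\<bar> \<le> P \<zeta> * (e/2 + C * (norm (\<zeta> - b))\<^sup>2)"
        using pt[OF \<zeta>] P0[of \<zeta>] by (simp add: abs_mult mult_left_mono)
      also have "\<dots> = e/2 * P \<zeta> + C * (P \<zeta> * (norm (\<zeta> - b))\<^sup>2)" by (simp add: algebra_simps)
      also have "\<dots> \<le> e/2 * P \<zeta> + C * (2 * (r\<^sup>2 - (norm (z - a))\<^sup>2) + 2 * (norm (z - b))\<^sup>2 * P \<zeta>)"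
        using 1 C0 by (intro add_left_mono mult_left_mono)
      also have "\<dots> = (e/2 + 2 * C * (norm (z - b))\<^sup>2) * P \<zeta> + 2 * C * (r\<^sup>2 - (norm (z - a))\<^sup>2)"
        by (simp add: algebra_simps)
      finally show "\<bar>P \<zeta> * (f \<zeta> - f b)\<bar> \<le> \<dots>" .
    qed (use r f cP in \<open>auto intro!: continuous_intros\<close>)
    also have "\<dots> = (e/2 + 2 * C * (norm (z - b))\<^sup>2) * poisson_integral (\<lambda>_. 1) a r z + 2 * C * (r\<^sup>2 - (norm (z - a))\<^sup>2)"
      unfolding poisson_integral_def P_def[symmetric]
      by (subst circ_mean_add) (use r cP in \<open>auto intro!: continuous_intros simp: circ_mean_cmult\<close>)
    also have "\<dots> = e/2 + ?w z" using poisson_integral_1[OF z] by simp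
    finally show ?thesis by simp
  qed
  have "(?w \<longlongrightarrow> 2 * C * (r\<^sup>2 - (norm (b - a))\<^sup>2) + 2 * C * (norm (b - b))\<^sup>2) (at b within ball a r)"
    by (intro tendsto_intros)
  also have "2 * C * (r\<^sup>2 - (norm (b - a))\<^sup>2) + 2 * C * (norm (b - b))\<^sup>2 = 0"
    using b by (simp add: dist_norm norm_minus_commute)
  finally have "eventually (\<lambda>z. ?w z < e/2) (at b within ball a r)"
    using e by (intro order_tendstoD(2)) auto
  moreover have "eventually (\<lambda>z. z \<in> ball a r) (at b within ball a r)"
    by (simp add: eventually_at_filter)
  ultimately show "eventually (\<lambda>z. dist (poisson_integral f a r z) (f b) < e) (at b within ball a r)"
    by eventually_elim (use main in \<open>fastforce simp: dist_real_def\<close>)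
qed

text \<open>
  On the disc this solves the Dirichlet problem with boundary values \<open>f\<close>; for a function \<open>f\<close>
  given on a larger set it is the Poisson modification of \<open>f\<close>.
\<close>

definition poisson_ext :: "(complex \<Rightarrow> real) \<Rightarrow> complex \<Rightarrow> real \<Rightarrow> complex \<Rightarrow> real" where
  "poisson_ext f a r z = (if z \<in> ball a r then poisson_integral f a r z else f z)"

lemma harmonic_on_poisson_ext:
  "continuous_on (sphere a r) f \<Longrightarrow> harmonic_on (poisson_ext f a r) (ball a r)"
  using harmonic_on_cong[OF harmonic_on_poisson_integral open_ball] by (simp add: poisson_ext_def)

lemma continuous_on_poisson_ext:
  assumes f: "continuous_on (S - ball a r) f" and S: "cball a r \<subseteq> S" and r: "r > 0"
  shows "continuous_on S (poisson_ext f a r)"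
proof -
  have fs: "continuous_on (sphere a r) f"
    by (rule continuous_on_subset[OF f]) (use S in auto)
  have "continuous_on (cball a r) (poisson_ext f a r)"
    unfolding continuous_on_def
  proof
    fix b assume b: "b \<in> cball a r"
    show "(poisson_ext f a r \<longlongrightarrow> poisson_ext f a r b) (at b within cball a r)"
    proof (cases "b \<in> ball a r")
      case True
      then have "isCont (poisson_ext f a r) b"
        using harmonic_on_imp_continuous_on[OF harmonic_on_poisson_ext[OF fs]]
        by (simp add: continuous_on_eq_continuous_at)
      then show ?thesis
        by (simp add: continuous_within_subset[OF _ subset_UNIV] flip: continuous_within)
    next
      case False
      then have bs: "b \<in> sphere a r" using b by auto
      have "(poisson_ext f a r \<longlongrightarrow> f b) (at b within ball a r)"
        using poisson_integral_boundary[OF fs r bs]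
        by (rule Lim_transform_eventually) (auto simp: eventually_at_filter poisson_ext_def)
      moreover have "(poisson_ext f a r \<longlongrightarrow> f b) (at b within sphere a r)"
      proof -
        have "(f \<longlongrightarrow> f b) (at b within sphere a r)" using fs bs by (simp add: continuous_on_def)
        then show ?thesis
          by (rule Lim_transform_eventually) (auto simp: eventually_at_filter poisson_ext_def)
      qed
      ultimately have "(poisson_ext f a r \<longlongrightarrow> f b) (at b within (ball a r \<union> sphere a r))"
        by (simp add: Lim_within_Un)
      moreover have "ball a r \<union> sphere a r = cball a r" by auto
      ultimately show ?thesis using False by (simp add: poisson_ext_def)
    qed
  qed
  moreover have "continuous_on (S - ball a r) (poisson_ext f a r)"
    by (rule continuous_on_eq[OF f]) (simp add: poisson_ext_def)
  moreover have "closedin (top_of_set S) (cball a r)"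
    using S by (meson closed_cball closed_subset)
  moreover have "closedin (top_of_set S) (S - ball a r)"
    unfolding Diff_eq by (intro closedin_closed_Int) auto
  moreover have "cball a r \<union> (S - ball a r) = S" using S by auto
  ultimately show ?thesis using continuous_on_Un_local[of "cball a r" "S - ball a r" "poisson_ext f a r"] by simp
qed

lemma harmonic_eq_poisson_integral:
  assumes h: "harmonic_on u (ball a r)" and c: "continuous_on (cball a r) u" and z: "z \<in> ball a r"
  shows "u z = poisson_integral u a r z"
proof -
  have r: "r > 0" using z by (auto simp: dist_norm intro: le_less_trans[OF norm_ge_zero])
  have cs: "continuous_on (sphere a r) u" using c continuous_on_subset sphere_cball by blast
  have cp: "continuous_on (cball a r) (poisson_ext u a r)"
    by (rule continuous_on_poisson_ext[OF _ order_refl r])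
      (rule continuous_on_subset[OF c], auto)
  have "u z - poisson_ext u a r z \<le> 0"
    by (rule harmonic_le_0_on_ball[OF harmonic_on_diff[OF h harmonic_on_poisson_ext[OF cs]] _ _ z])
      (use c cp in \<open>auto intro!: continuous_on_diff\<close>, auto simp: poisson_ext_def)
  moreover have "poisson_ext u a r z - u z \<le> 0"
    by (rule harmonic_le_0_on_ball[OF harmonic_on_diff[OF harmonic_on_poisson_ext[OF cs] h] _ _ z])
      (use c cp in \<open>auto intro!: continuous_on_diff\<close>, auto simp: poisson_ext_def)
  ultimately show ?thesis using z by (simp add: poisson_ext_def)
qed

section \<open>Sub-mean-value functions and the maximum principle\<close>

lemma harmonic_on_mean:
  assumes "harmonic_on u (ball a r)" "continuous_on (cball a r) u" "r > 0"
  shows "u a = circ_mean u a r"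
  using harmonic_eq_poisson_integral[OF assms(1,2), of a] poisson_integral_center[OF assms(3)] assms(3) by simp

lemma harmonic_imp_subharmonic_on:
  assumes "harmonic_on u S"
  shows "subharmonic_on u S"
  unfolding subharmonic_on_def circ_mean_def[symmetric]
proof (intro conjI allI impI)
  show c: "continuous_on S u" using assms by (rule harmonic_on_imp_continuous_on)
  fix a r assume ar: "0 < r \<and> cball a r \<subseteq> S"
  then have "ball a r \<subseteq> S" by auto
  then have "u a = circ_mean u a r" using ar 
    by (intro harmonic_on_mean harmonic_on_subset[OF assms] continuous_on_subset[OF c]) auto
  then show "u a \<le> circ_mean u a r" by simp
qed

text \<open>
  The sub-mean-value inequality is demanded on small circles only. In this form it is a local property, it is easily
  seen to survive Poisson modification, and it suffices for the maximum principle.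
\<close>

definition submean_on :: "(complex \<Rightarrow> real) \<Rightarrow> complex set \<Rightarrow> bool" where
  "submean_on u S \<longleftrightarrow> continuous_on S u \<and>
     (\<forall>a\<in>S. \<exists>d>0. \<forall>r. 0 < r \<and> r < d \<longrightarrow> cball a r \<subseteq> S \<and> u a \<le> circ_mean u a r)"

lemma submean_on_imp_open: "submean_on u S \<Longrightarrow> open S"
proof -
  assume u: "submean_on u S"
  have "\<exists>e>0. cball a e \<subseteq> S" if a: "a \<in> S" for a
  proof -
    obtain d where "d > 0" "\<And>r. 0 < r \<Longrightarrow> r < d \<Longrightarrow> cball a r \<subseteq> S"
      using u a unfolding submean_on_def by metis
    then show ?thesis by (intro exI[of _ "d/2"]) auto
  qed
  then show ?thesis unfolding open_contains_cball by blast
qed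

lemma subharmonic_imp_submean_on:
  assumes "subharmonic_on u S" "open S" shows "submean_on u S"
proof -
  have c: "continuous_on S u" and
    sm: "\<And>a r. 0 < r \<Longrightarrow> cball a r \<subseteq> S \<Longrightarrow> u a \<le> circ_mean u a r"
    using assms(1) unfolding subharmonic_on_def circ_mean_def by auto
  have "\<exists>d>0. \<forall>r. 0 < r \<and> r < d \<longrightarrow> cball a r \<subseteq> S \<and> u a \<le> circ_mean u a r" if a: "a \<in> S" for a
  proof -
    obtain d where d: "d > 0" "cball a d \<subseteq> S" using assms(2) a unfolding open_contains_cball by blast
    have sub: "cball a r \<subseteq> S" if "r < d" for r using d(2) subset_cball[of r d a] that by auto
    then show ?thesis using d(1) sm by (intro exI[of _ d]) simp
  qed
  then show ?thesis using c by (simp add: submean_on_def)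
qed

lemma harmonic_imp_submean_on: "harmonic_on u S \<Longrightarrow> open S \<Longrightarrow> submean_on u S"
  by (simp add: harmonic_imp_subharmonic_on subharmonic_imp_submean_on)

lemma submean_on_add:
  assumes u: "submean_on u S" and v: "submean_on v S"
  shows "submean_on (\<lambda>z. u z + v z) S"
  unfolding submean_on_def
proof (intro conjI ballI)
  have c: "continuous_on S u" "continuous_on S v" using assms by (auto simp: submean_on_def)
  then show "continuous_on S (\<lambda>z. u z + v z)" by (intro continuous_intros)
  fix a assume a: "a \<in> S"
  obtain d e where d: "d > 0" "\<And>r. 0 < r \<Longrightarrow> r < d \<Longrightarrow> cball a r \<subseteq> S \<and> u a \<le> circ_mean u a r"
    and e: "e > 0" "\<And>r. 0 < r \<Longrightarrow> r < e \<Longrightarrow> cball a r \<subseteq> S \<and> v a \<le> circ_mean v a r"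
    using u v a unfolding submean_on_def by metis
  have "cball a r \<subseteq> S \<and> u a + v a \<le> circ_mean (\<lambda>z. u z + v z) a r" if r: "0 < r" "r < min d e" for r
  proof -
    have S: "cball a r \<subseteq> S" using d r by auto
    then have "sphere a r \<subseteq> S" by auto
    then have "continuous_on (sphere a r) u" "continuous_on (sphere a r) v"
      using c continuous_on_subset by blast+
    then have "circ_mean (\<lambda>z. u z + v z) a r = circ_mean u a r + circ_mean v a r"
      using r by (intro circ_mean_add) auto
    moreover have "u a \<le> circ_mean u a r" "v a \<le> circ_mean v a r"
      using d e r by auto
    ultimately show ?thesis using S by linarith
  qed
  then show "\<exists>d>0. \<forall>r. 0 < r \<and> r < d \<longrightarrow> cball a r \<subseteq> S \<and> u a + v a \<le> circ_mean (\<lambda>z. u z + v z) a r"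
    using d(1) e(1) by (metis min_less_iff_conj)
qed

lemma submean_on_max:
  assumes u: "submean_on u S" and v: "submean_on v S"
  shows "submean_on (\<lambda>z. max (u z) (v z)) S"
  unfolding submean_on_def
proof (intro conjI ballI)
  have c: "continuous_on S u" "continuous_on S v" using assms by (auto simp: submean_on_def)
  then show cm: "continuous_on S (\<lambda>z. max (u z) (v z))" by (intro continuous_intros)
  fix a assume a: "a \<in> S"
  obtain d e where d: "d > 0" "\<And>r. 0 < r \<Longrightarrow> r < d \<Longrightarrow> cball a r \<subseteq> S \<and> u a \<le> circ_mean u a r"
    and e: "e > 0" "\<And>r. 0 < r \<Longrightarrow> r < e \<Longrightarrow> cball a r \<subseteq> S \<and> v a \<le> circ_mean v a r"
    using u v a unfolding submean_on_def by metis
  have "cball a r \<subseteq> S \<and> max (u a) (v a) \<le> circ_mean (\<lambda>z. max (u z) (v z)) a r" if r: "0 < r" "r < min d e" for r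
  proof -
    have S: "cball a r \<subseteq> S" using d r by auto
    then have "sphere a r \<subseteq> S" by auto
    then have "continuous_on (sphere a r) u" "continuous_on (sphere a r) v"
       "continuous_on (sphere a r) (\<lambda>z. max (u z) (v z))"
      using c cm continuous_on_subset by blast+
    then have "circ_mean u a r \<le> circ_mean (\<lambda>z. max (u z) (v z)) a r"
      "circ_mean v a r \<le> circ_mean (\<lambda>z. max (u z) (v z)) a r"
      using r by (auto intro!: circ_mean_mono)
    moreover have "u a \<le> circ_mean u a r" "v a \<le> circ_mean v a r"
      using d e r by auto
    ultimately show ?thesis using S by linarith
  qed
  then show "\<exists>d>0. \<forall>r. 0 < r \<and> r < d \<longrightarrow> cball a r \<subseteq> S \<and> max (u a) (v a) \<le> circ_mean (\<lambda>z. max (u z) (v z)) a r"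
    using d(1) e(1) by (metis min_less_iff_conj)
qed

lemma submean_on_local:
  assumes "continuous_on S u" "\<And>a. a \<in> S \<Longrightarrow> \<exists>T. a \<in> T \<and> T \<subseteq> S \<and> submean_on u T"
  shows "submean_on u S"
  using assms unfolding submean_on_def by (meson subset_trans)

lemma submean_on_subset: "submean_on u S \<Longrightarrow> open T \<Longrightarrow> T \<subseteq> S \<Longrightarrow> submean_on u T"
  unfolding submean_on_def
proof (intro conjI ballI)
  assume A: "continuous_on S u \<and> (\<forall>a\<in>S. \<exists>d>0. \<forall>r. 0 < r \<and> r < d \<longrightarrow> cball a r \<subseteq> S \<and> u a \<le> circ_mean u a r)"
   and T: "open T" "T \<subseteq> S"
  show "continuous_on T u" using A T continuous_on_subset by blast
  fix a assume a: "a \<in> T"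
  obtain d where d: "d > 0" "\<And>r. 0 < r \<Longrightarrow> r < d \<Longrightarrow> u a \<le> circ_mean u a r"
    using A T a by blast
  obtain e where e: "e > 0" "cball a e \<subseteq> T" using T(1) a unfolding open_contains_cball by blast
  have "cball a r \<subseteq> T" if "r < e" for r using e(2) subset_cball[of r e a] that by auto
  then show "\<exists>d>0. \<forall>r. 0 < r \<and> r < d \<longrightarrow> cball a r \<subseteq> T \<and> u a \<le> circ_mean u a r"
    using d e(1) by (intro exI[of _ "min d e"]) auto
qed

text \<open>
  The two boundary conditions make the set where \<open>s\<close> exceeds a positive level compact. Among the points
  where a positive maximum is attained choose one with largest real part: the inequality forces the maximum on a whole
  small circle around it, including a point further to the right.
\<close>

theorem maximum_principle:
  assumes s: "submean_on s U"
    and b: "\<And>a e. a \<notin> U \<Longrightarrow> e > 0 \<Longrightarrow> eventually (\<lambda>w. s w < e) (at a within U)"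
    and inf: "\<And>e. e > 0 \<Longrightarrow> eventually (\<lambda>w. w \<in> U \<longrightarrow> s w < e) at_infinity"
    and z: "z \<in> U"
  shows "s z \<le> 0"
proof (rule ccontr)
  assume "\<not> s z \<le> 0"
  define e where "e = s z"
  have e: "e > 0" using \<open>\<not> s z \<le> 0\<close> by (simp add: e_def)
  have cs: "continuous_on U s" using s by (simp add: submean_on_def)
  define K where "K = {w \<in> U. s w \<ge> e}"
  have "bounded K"
  proof -
    obtain B where "\<And>w. norm w \<ge> B \<Longrightarrow> w \<in> U \<longrightarrow> s w < e"
      using inf[OF e] unfolding eventually_at_infinity by blast
    then have "\<forall>w\<in>K. norm w \<le> B" unfolding K_def by force
    then show ?thesis unfolding bounded_iff by blast
  qed
  moreover have "closed K"
    unfolding closed_limpt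
  proof (intro allI impI)
    fix p assume p: "p islimpt K"
    then have nt: "at p within K \<noteq> bot" using trivial_limit_within by blast
    show "p \<in> K"
    proof (cases "p \<in> U")
      case True
      then have "(s \<longlongrightarrow> s p) (at p within U)" using cs by (auto simp: continuous_on_def)
      then have "(s \<longlongrightarrow> s p) (at p within K)" by (rule tendsto_within_subset) (auto simp: K_def)
      moreover have "eventually (\<lambda>w. e \<le> s w) (at p within K)"
        by (simp add: eventually_at_filter K_def)
      ultimately have "e \<le> s p" using nt tendsto_lowerbound by blast
      then show ?thesis using True by (simp add: K_def)
    next
      case False
      have "eventually (\<lambda>w. s w < e) (at p within K)"
        using b[OF False e] by (rule filter_leD[rotated]) (intro at_le, auto simp: K_def)
      moreover have "eventually (\<lambda>w. e \<le> s w) (at p within K)"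
        by (simp add: eventually_at_filter K_def)
      ultimately have "eventually (\<lambda>w. False) (at p within K)"
        by eventually_elim auto
      then show ?thesis using nt by (simp add: trivial_limit_def)
    qed
  qed
  ultimately have cK: "compact K" by (simp add: compact_eq_bounded_closed)
  have "z \<in> K" using z by (simp add: K_def e_def)
  have "continuous_on K s" using cs by (rule continuous_on_subset) (auto simp: K_def)
  then obtain m where m: "m \<in> K" "\<And>w. w \<in> K \<Longrightarrow> s w \<le> s m"
    using continuous_attains_sup[OF cK] \<open>z \<in> K\<close> by (metis empty_iff)
  have mU: "s w \<le> s m" if "w \<in> U" for w
    using m that unfolding K_def by fastforce
  define M where "M = K \<inter> s -` {s m}"
  have "compact M"
  proof -
    have "closed M" unfolding M_def
      by (rule continuous_closed_preimage[OF \<open>continuous_on K s\<close> compact_imp_closed[OF cK]]) simp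
    then have "compact (K \<inter> M)" using cK by (rule compact_Int_closed[rotated])
    then show ?thesis by (simp add: M_def)
  qed
  moreover have "m \<in> M" using m by (simp add: M_def)
  ultimately obtain a where a: "a \<in> M" "\<And>w. w \<in> M \<Longrightarrow> Re w \<le> Re a"
    using continuous_attains_sup[of M Re] continuous_on_Re[OF continuous_on_id, of M] by auto
  have aU: "a \<in> U" "s a = s m" using a(1) by (auto simp: M_def K_def)
  obtain d where d: "d > 0" "\<And>r. 0 < r \<Longrightarrow> r < d \<Longrightarrow> cball a r \<subseteq> U \<and> s a \<le> circ_mean s a r"
    using s aU unfolding submean_on_def by metis
  define r where "r = d / 2"
  have r: "r > 0" "cball a r \<subseteq> U" "s a \<le> circ_mean s a r" using d by (auto simp: r_def)
  have "sphere a r \<subseteq> U" using r(2) by auto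
  then have csp: "continuous_on (sphere a r) s" using cs continuous_on_subset by blast
  let ?f = "\<lambda>t. s m - s (a + of_real r * cis t)"
  have inn: "a + of_real r * cis t \<in> U" for t using \<open>sphere a r \<subseteq> U\<close> r(1) circ_in_sphere by (meson less_imp_le subsetD)
  have cf: "continuous_on {0..2*pi} ?f"
    by (intro continuous_intros continuous_on_compose2[OF csp, where f = "\<lambda>t. a + of_real r * cis t"])
      (use r(1) in \<open>auto intro!: circ_in_sphere\<close>)
  have int0: "integral {0..2*pi} ?f = 0"
  proof -
    have "integral {0..2*pi} ?f = 2*pi * (circ_mean (\<lambda>_. s m) a r - circ_mean s a r)"
      unfolding circ_mean_def
      by (subst integral_diff) (use circ_integrable[OF csp] r(1) in \<open>auto simp: field_simps\<close>)
    also have "\<dots> \<le> 0" using r(3) aU by (simp add: mult_le_0_iff)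
    finally have "integral {0..2*pi} ?f \<le> 0" .
    moreover have "integral {0..2*pi} ?f \<ge> 0"
      by (rule integral_nonneg) (use cf mU inn in \<open>auto intro: integrable_continuous_real\<close>)
    ultimately show ?thesis by simp
  qed
  have "\<forall>t\<in>{0..2*pi}. ?f t = 0"
    using integral_eq_0_iff[OF cf _] int0 mU inn by simp
  then have "?f 0 = 0" by (rule bspec) simp
  then have "s (a + of_real r) = s m" by simp
  then have "a + of_real r \<in> M" using inn[of 0] m(1) by (simp add: M_def K_def)
  then show False using a(2)[of "a + of_real r"] r(1) by simp
qed

corollary maximum_principle_compare:
  assumes u: "submean_on u U" and v: "submean_on (\<lambda>z. - v z) U"
    and b: "\<And>a e. a \<notin> U \<Longrightarrow> e > 0 \<Longrightarrow> eventually (\<lambda>w. u w < v w + e) (at a within U)"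
    and inf: "\<And>e. e > 0 \<Longrightarrow> eventually (\<lambda>w. w \<in> U \<longrightarrow> u w < v w + e) at_infinity"
    and z: "z \<in> U"
  shows "u z \<le> v z"
proof -
  have "u z + - v z \<le> 0"
    by (rule maximum_principle[OF submean_on_add[OF u v]])
      (use b inf z in \<open>auto simp: algebra_simps\<close>)
  then show ?thesis by simp
qed

lemma maximum_principle_ball:
  assumes u: "submean_on u (ball a r)" and v: "submean_on (\<lambda>z. - v z) (ball a r)"
    and cu: "continuous_on (cball a r) u" and cv: "continuous_on (cball a r) v"
    and le: "\<And>z. z \<in> sphere a r \<Longrightarrow> u z \<le> v z" and z: "z \<in> ball a r"
  shows "u z \<le> v z"
proof (rule maximum_principle_compare[OF u v _ _ z])
  fix b and e :: real assume b: "b \<notin> ball a r" and e: "e > 0"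
  show "eventually (\<lambda>w. u w < v w + e) (at b within ball a r)"
  proof (cases "b \<in> sphere a r")
    case True
    have "continuous_on (cball a r) (\<lambda>w. u w - v w)" using cu cv by (intro continuous_intros)
    then have "((\<lambda>w. u w - v w) \<longlongrightarrow> u b - v b) (at b within cball a r)"
      using True by (auto simp: continuous_on_def)
    then have lim: "((\<lambda>w. u w - v w) \<longlongrightarrow> u b - v b) (at b within ball a r)"
      by (rule tendsto_within_subset) auto
    have "eventually (\<lambda>w. u w - v w < e) (at b within ball a r)"
      by (rule order_tendstoD(2)[OF lim]) (use le[OF True] e in linarith)
    then show ?thesis by (rule eventually_mono) auto
  next
    case False
    then have "b \<notin> cball a r" using b by auto
    then have "b \<notin> closure (ball a r)" using closure_minimal[OF ball_subset_cball closed_cball] by blast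
    then have "at b within ball a r = bot" by (rule not_in_closure_trivial_limitI)
    then show ?thesis by simp
  qed
next
  fix e :: real assume "e > 0"
  have "bounded (ball a r)" by simp
  then obtain B where B: "\<And>w. w \<in> ball a r \<Longrightarrow> norm w \<le> B" unfolding bounded_iff by blast
  show "eventually (\<lambda>w. w \<in> ball a r \<longrightarrow> u w < v w + e) at_infinity"
    unfolding eventually_at_infinity by (rule exI[of _ "B + 1"]) (use B in force)
qed

text \<open>
  The Poisson integral over a small circle has the same boundary values, so the maximum principle applies to the
  difference in both directions.
\<close>

lemma harmonic_on_of_mean_value:
  assumes "submean_on u S" "submean_on (\<lambda>z. - u z) S"
  shows "harmonic_on u S"
proof (rule harmonic_on_locally)
  fix z assume z: "z \<in> S"
  have S: "open S" using assms submean_on_imp_open by blast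
  then obtain r where r: "r > 0" "cball z r \<subseteq> S" using z unfolding open_contains_cball by blast
  have cu: "continuous_on (cball z r) u" using assms(1) r(2) continuous_on_subset unfolding submean_on_def by blast
  have cs: "continuous_on (sphere z r) u" using cu continuous_on_subset sphere_cball by blast
  have cp: "continuous_on (cball z r) (poisson_ext u z r)"
    by (rule continuous_on_poisson_ext[OF _ order_refl r(1)]) (rule continuous_on_subset[OF cu], auto)
  have h: "harmonic_on (poisson_ext u z r) (ball z r)" by (rule harmonic_on_poisson_ext[OF cs])
  have b: "ball z r \<subseteq> S" using r by auto
  have "u w = poisson_ext u z r w" if w: "w \<in> ball z r" for w
  proof (rule antisym)
    show "u w \<le> poisson_ext u z r w"
      by (rule maximum_principle_ball[OF submean_on_subset[OF assms(1) open_ball b]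
            harmonic_imp_submean_on[OF harmonic_on_uminus[OF h] open_ball] cu cp _ w])
         (simp add: poisson_ext_def)
    have "- u w \<le> - poisson_ext u z r w"
      by (rule maximum_principle_ball[OF submean_on_subset[OF assms(2) open_ball b] _ _ _ _ w])
         (use harmonic_imp_submean_on[OF h open_ball] in \<open>auto intro!: continuous_on_minus cu cp\<close>, simp add: poisson_ext_def)
    then show "poisson_ext u z r w \<le> u w" by simp
  qed
  then have "harmonic_on u (ball z r)" using harmonic_on_cong[OF h open_ball] by simp
  then show "\<exists>T. open T \<and> z \<in> T \<and> harmonic_on u T" using r(1) by (metis open_ball centre_in_ball)
qed

text \<open>
  Through a local holomorphic completion the invariance of harmonicity under holomorphic changes of variable and under
  conjugation reduces to the chain rule for holomorphic functions.
\<close>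

lemma harmonic_on_locally_Re:
  assumes u: "harmonic_on u S" and S: "open S" and z: "z \<in> S"
  obtains F r where "r > 0" "ball z r \<subseteq> S" "F holomorphic_on ball z r" "\<And>w. w \<in> ball z r \<Longrightarrow> u w = Re (F w)"
proof -
  obtain r where r: "r > 0" "cball z r \<subseteq> S" using z S unfolding open_contains_cball by blast
  have cu: "continuous_on (cball z r) u" using u r(2) continuous_on_subset harmonic_on_imp_continuous_on by blast
  have cs: "continuous_on (sphere z r) u" using cu continuous_on_subset sphere_cball by blast
  have b: "ball z r \<subseteq> S" using r by auto
  obtain F where "F holomorphic_on ball z r" "\<And>w. w \<in> ball z r \<Longrightarrow> poisson_integral u z r w = Re (F w)"
    using poisson_integral_holomorphic[OF cs] by blast
  then show ?thesis
    using that[of r F] r b harmonic_eq_poisson_integral[OF harmonic_on_subset[OF u b] cu] by simp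
qed

lemma harmonic_on_compose_holomorphic:
  assumes u: "harmonic_on u S" and S: "open S" and f: "f holomorphic_on T" and T: "open T" and fT: "f ` T \<subseteq> S"
  shows "harmonic_on (\<lambda>z. u (f z)) T"
proof (rule harmonic_on_locally)
  fix z assume z: "z \<in> T"
  then have "f z \<in> S" using fT by blast
  then obtain F r where F: "r > 0" "F holomorphic_on ball (f z) r" "\<And>w. w \<in> ball (f z) r \<Longrightarrow> u w = Re (F w)"
    using harmonic_on_locally_Re[OF u S] by metis
  define V where "V = T \<inter> f -` ball (f z) r"
  have V: "open V" unfolding V_def
    using continuous_open_preimage[OF holomorphic_on_imp_continuous_on[OF f] T open_ball] .
  have "F \<circ> f holomorphic_on V"
    by (rule holomorphic_on_compose_gen[OF holomorphic_on_subset[OF f] F(2)]) (auto simp: V_def)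
  then have "harmonic_on (\<lambda>z. Re ((F \<circ> f) z)) V" by (rule harmonic_on_Re[OF _ V])
  then have "harmonic_on (\<lambda>z. u (f z)) V"
    by (rule harmonic_on_cong[OF _ V]) (simp add: V_def F(3))
  then show "\<exists>T. open T \<and> z \<in> T \<and> harmonic_on (\<lambda>z. u (f z)) T"
    using V z F(1) by (intro exI[of _ V]) (auto simp: V_def)
qed

lemma dist_cnj_cnj: "dist (cnj z) (cnj w) = dist z w"
  by (simp add: dist_norm flip: complex_cnj_diff)

lemma dist_cnj: "dist z (cnj w) = dist (cnj z) w"
  using dist_cnj_cnj[of z "cnj w"] by simp

lemma image_cnj_cnj: "cnj ` cnj ` S = S"
  by (simp add: image_image)

lemma harmonic_on_cnj:
  assumes u: "harmonic_on u S" and S: "open S"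
  shows "harmonic_on (\<lambda>z. u (cnj z)) (cnj ` S)"
proof (rule harmonic_on_locally)
  fix z assume "z \<in> cnj ` S"
  then have "cnj z \<in> S" by force
  then obtain F r where F: "r > 0" "F holomorphic_on ball (cnj z) r" "\<And>w. w \<in> ball (cnj z) r \<Longrightarrow> u w = Re (F w)"
    using harmonic_on_locally_Re[OF u S] by metis
  have im: "cnj ` ball (cnj z) r = ball z r"
  proof (intro set_eqI iffI)
    fix w assume "w \<in> ball z r"
    then show "w \<in> cnj ` ball (cnj z) r"
      by (intro image_eqI[of _ _ "cnj w"]) (simp_all add: dist_cnj_cnj)
  qed (auto simp: dist_cnj)
  have "(cnj \<circ> F \<circ> cnj) holomorphic_on (cnj ` ball (cnj z) r)"
    using holomorphic_on_compose_cnj_cnj[of F "ball z r"] F(2) im 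
    by (metis (no_types, lifting) open_ball image_cnj_cnj)
  then have "harmonic_on (\<lambda>w. Re ((cnj \<circ> F \<circ> cnj) w)) (ball z r)" unfolding im
    by (rule harmonic_on_Re[OF _ open_ball])
  then have "harmonic_on (\<lambda>w. u (cnj w)) (ball z r)"
    by (rule harmonic_on_cong[OF _ open_ball])
      (simp add: F(3) dist_cnj_cnj)
  then show "\<exists>T. open T \<and> z \<in> T \<and> harmonic_on (\<lambda>z. u (cnj z)) T" using F(1) by (metis open_ball centre_in_ball)
qed

section \<open>Harnack's inequality and limits of harmonic functions\<close>

text \<open>
  With \<open>d = norm (z - a)\<close>, the kernel lies between \<open>(s - d) / (s + d)\<close> and
  \<open>(s + d) / (s - d)\<close> on the circle of radius \<open>s\<close>. The smaller radius provides continuity up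
  to the circle.
\<close>

lemma harnack_aux:
  assumes h: "harmonic_on h (ball a r)" and nn: "\<And>z. z \<in> ball a r \<Longrightarrow> h z \<ge> 0"
    and z: "norm (z - a) < s" and s: "s < r"
  shows "h z * (s - norm (z - a)) \<le> (s + norm (z - a)) * h a"
    "h a * (s - norm (z - a)) \<le> (s + norm (z - a)) * h z"
proof -
  define d where "d = norm (z - a)"
  have d: "0 \<le> d" "d < s" using z by (auto simp: d_def)
  have zb: "z \<in> ball a s" using z by (simp add: dist_norm norm_minus_commute)
  have sub: "cball a s \<subseteq> ball a r" using s by auto
  have c: "continuous_on (cball a s) h"
    using harmonic_on_imp_continuous_on[OF h] sub continuous_on_subset by blast
  have cs: "continuous_on (sphere a s) h" using c continuous_on_subset sphere_cball by blast
  have hs: "harmonic_on h (ball a s)" using harmonic_on_subset[OF h, of "ball a s"] sub ball_subset_cball by blast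
  have hz: "h z = circ_mean (\<lambda>\<zeta>. poisson_kernel a s z \<zeta> * h \<zeta>) a s"
    using harmonic_eq_poisson_integral[OF hs c zb] by (simp add: poisson_integral_def)
  have ha: "h a = circ_mean h a s" using harmonic_on_mean[OF hs c] d by auto
  have cP: "continuous_on (sphere a s) (poisson_kernel a s z)" by (rule continuous_on_poisson_kernel[OF zb])
  have bd: "(s - d) / (s + d) \<le> poisson_kernel a s z \<zeta>" "poisson_kernel a s z \<zeta> \<le> (s + d) / (s - d)"
    if \<zeta>: "\<zeta> \<in> sphere a s" for \<zeta>
  proof -
    have n: "norm (\<zeta> - a) = s" using \<zeta> by (simp add: dist_norm norm_minus_commute)
    have l: "norm (\<zeta> - z) \<le> s + d" using norm_triangle_ineq4[of "\<zeta> - a" "z - a"] n by (simp add: d_def)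
    have g: "norm (\<zeta> - z) \<ge> s - d" using norm_triangle_ineq2[of "\<zeta> - a" "z - a"] n by (simp add: d_def)
    have k: "poisson_kernel a s z \<zeta> = (s - d) * (s + d) / (norm (\<zeta> - z))\<^sup>2"
      by (simp add: poisson_kernel_def d_def power2_eq_square algebra_simps)
    have "(s - d) * (s + d) / (s + d)\<^sup>2 \<le> poisson_kernel a s z \<zeta>"
      unfolding k using l g d by (intro divide_left_mono power_mono mult_pos_pos zero_less_power) auto
    then show "(s - d) / (s + d) \<le> poisson_kernel a s z \<zeta>"
      using d by (simp add: power2_eq_square)
    have "poisson_kernel a s z \<zeta> \<le> (s - d) * (s + d) / (s - d)\<^sup>2"
      unfolding k using l g d by (intro divide_left_mono power_mono mult_pos_pos zero_less_power) auto
    then show "poisson_kernel a s z \<zeta> \<le> (s + d) / (s - d)"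
      using d by (simp add: power2_eq_square)
  qed
  have nns: "h \<zeta> \<ge> 0" if "\<zeta> \<in> sphere a s" for \<zeta> using nn sub that by auto
  have "h z \<le> circ_mean (\<lambda>\<zeta>. (s + d) / (s - d) * h \<zeta>) a s"
    unfolding hz by (rule circ_mean_mono, rule continuous_on_mult[OF cP cs], rule continuous_on_mult[OF continuous_on_const cs],
        use d in simp, rule mult_right_mono[OF bd(2) nns], assumption+)
  then have "h z \<le> (s + d) / (s - d) * h a" by (simp add: circ_mean_cmult ha[symmetric] del: times_divide_eq_left)
  then show "h z * (s - norm (z - a)) \<le> (s + norm (z - a)) * h a"
    using d by (simp add: d_def[symmetric] field_simps)
  have "circ_mean (\<lambda>\<zeta>. (s - d) / (s + d) * h \<zeta>) a s \<le> h z"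
    unfolding hz by (rule circ_mean_mono, rule continuous_on_mult[OF continuous_on_const cs], rule continuous_on_mult[OF cP cs],
        use d in simp, rule mult_right_mono[OF bd(1) nns], assumption+)
  then have "(s - d) / (s + d) * h a \<le> h z" by (simp add: circ_mean_cmult ha[symmetric] del: times_divide_eq_left)
  then show "h a * (s - norm (z - a)) \<le> (s + norm (z - a)) * h z"
    using d by (simp add: d_def[symmetric] field_simps)
qed

lemma harnack:
  assumes h: "harmonic_on h (ball a r)" and nn: "\<And>z. z \<in> ball a r \<Longrightarrow> h z \<ge> 0"
    and z: "z \<in> ball a r"
  shows "h z * (r - norm (z - a)) \<le> (r + norm (z - a)) * h a"
    "h a * (r - norm (z - a)) \<le> (r + norm (z - a)) * h z"
proof -
  have d: "norm (z - a) < r" using z by (simp add: dist_norm norm_minus_commute)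
  have ev: "eventually (\<lambda>s. norm (z - a) < s \<and> s < r) (at_left r)"
    using eventually_at_left[of "norm (z - a)" r] d by blast
  have l: "((\<lambda>s. x * (s - norm (z - a))) \<longlongrightarrow> x * (r - norm (z - a))) (at_left r)"
    "((\<lambda>s. (s + norm (z - a)) * x) \<longlongrightarrow> (r + norm (z - a)) * x) (at_left r)" for x :: real
    by (auto intro!: tendsto_intros)
  show "h z * (r - norm (z - a)) \<le> (r + norm (z - a)) * h a"
    by (rule tendsto_le[OF _ l(2) l(1)])
      (use ev in \<open>auto elim!: eventually_mono intro: harnack_aux[OF h nn]\<close>)
  show "h a * (r - norm (z - a)) \<le> (r + norm (z - a)) * h z"
    by (rule tendsto_le[OF _ l(2) l(1)])
      (use ev in \<open>auto elim!: eventually_mono intro: harnack_aux[OF h nn]\<close>)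
qed

lemma harnack_half:
  assumes h: "harmonic_on h (ball a r)" and nn: "\<And>z. z \<in> ball a r \<Longrightarrow> h z \<ge> 0"
    and z: "norm (z - a) \<le> r / 2" and r: "r > 0"
  shows "h z \<le> 3 * h a" "h a \<le> 3 * h z"
proof -
  have zb: "z \<in> ball a r" using z r by (simp add: dist_norm norm_minus_commute)
  have ab: "h a \<ge> 0" "h z \<ge> 0" using nn zb r by auto
  note H = harnack[OF h nn zb]
  have "h z * (r/2) \<le> h z * (r - norm (z - a))" "h a * (r/2) \<le> h a * (r - norm (z - a))"
    "(r + norm (z - a)) * h a \<le> (r + r/2) * h a" "(r + norm (z - a)) * h z \<le> (r + r/2) * h z"
    using z ab by (intro mult_left_mono mult_right_mono; linarith)+
  then have "h z * (r/2) \<le> (r + r/2) * h a" "h a * (r/2) \<le> (r + r/2) * h z" using H by linarith+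
  then have "r * h z \<le> r * (3 * h a)" "r * h a \<le> r * (3 * h z)" by (simp_all add: algebra_simps)
  then show "h z \<le> 3 * h a" "h a \<le> 3 * h z" using r by simp_all
qed

lemma harnack_lipschitz:
  assumes h: "harmonic_on h (ball a r)" and nn: "\<And>z. z \<in> ball a r \<Longrightarrow> h z \<ge> 0"
    and z: "norm (z - a) \<le> r / 2" and r: "r > 0"
  shows "\<bar>h z - h a\<bar> \<le> 4 * h a / r * norm (z - a)"
proof -
  define d where "d = norm (z - a)"
  have zb: "z \<in> ball a r" using z r by (simp add: dist_norm norm_minus_commute)
  have ab: "h a \<ge> 0" "h z \<ge> 0" using nn zb r by auto
  have d: "0 \<le> d" "d \<le> r/2" using z by (auto simp: d_def)
  note H = harnack[OF h nn zb, folded d_def]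
  have "(h z - h a) * (r/2) \<le> 2 * d * h a" if "h z \<ge> h a"
  proof -
    have "(h z - h a) * (r/2) \<le> (h z - h a) * (r - d)" using d that by (intro mult_left_mono) auto
    also have "\<dots> \<le> 2 * d * h a" using H(1) by (simp add: algebra_simps)
    finally show ?thesis .
  qed
  moreover have "(h a - h z) * (r/2) \<le> 2 * d * h a" if "h a \<ge> h z"
  proof -
    have "(h a - h z) * (r/2) \<le> (h a - h z) * (r + d)" using d that r by (intro mult_left_mono) auto
    also have "\<dots> \<le> 2 * d * h a" using H(2) by (simp add: algebra_simps)
    finally show ?thesis .
  qed
  ultimately have "\<bar>h z - h a\<bar> * (r/2) \<le> 2 * d * h a" by (cases "h z \<ge> h a") auto
  then show ?thesis using r by (simp add: d_def[symmetric] field_simps)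
qed

text \<open>
  Continuity and the mean value property pass to uniform limits. The formulation by approximants serves both monotone
  sequences and cluster points.
\<close>

lemma harmonic_on_approx:
  assumes S: "open S"
    and A: "\<And>p. p \<in> S \<Longrightarrow> \<exists>d>0. cball p d \<subseteq> S \<and>
        (\<forall>e>0. \<exists>h. harmonic_on h (ball p d) \<and> (\<forall>z\<in>ball p d. \<bar>h z - g z\<bar> \<le> e))"
  shows "harmonic_on g S"
proof -
  have loc: "\<exists>d>0. cball p d \<subseteq> S \<and> continuous_on (ball p d) g \<and>
     (\<forall>r. 0 < r \<and> r < d \<longrightarrow> g p = circ_mean g p r)" if p: "p \<in> S" for p
  proof -
    obtain d where d: "d > 0" "cball p d \<subseteq> S"
      and H: "\<And>e. e > 0 \<Longrightarrow> \<exists>h. harmonic_on h (ball p d) \<and> (\<forall>z\<in>ball p d. \<bar>h z - g z\<bar> \<le> e)"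
      using A[OF p] by blast
    obtain h where h: "\<And>n. harmonic_on (h n) (ball p d)" "\<And>n z. z \<in> ball p d \<Longrightarrow> \<bar>h n z - g z\<bar> \<le> 1 / Suc n"
      using H[of "1 / Suc n" for n] by (metis divide_pos_pos of_nat_0_less_iff zero_less_Suc zero_less_one)
    have ul: "uniform_limit (ball p d) h g sequentially"
      unfolding uniform_limit_iff dist_real_def
    proof (intro allI impI)
      fix e :: real assume "e > 0"
      then have "eventually (\<lambda>n. 1 / real (Suc n) < e) sequentially"
        using order_tendstoD(2)[OF lim_inverse_n'[THEN LIMSEQ_Suc]] by simp
      then show "\<forall>\<^sub>F n in sequentially. \<forall>x\<in>ball p d. \<bar>h n x - g x\<bar> < e"
        proof eventually_elim
        case (elim n)
        then show ?case using h(2)[where n = n] by (meson le_less_trans)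
      qed
    qed
    have cg: "continuous_on (ball p d) g"
      by (rule uniform_limit_theorem[OF _ ul])
        (use h(1) harmonic_on_imp_continuous_on in \<open>auto intro!: always_eventually\<close>)
    have "g p = circ_mean g p r" if r: "0 < r" "r < d" for r
    proof -
      have sub: "sphere p r \<subseteq> ball p d" "cball p r \<subseteq> ball p d" "ball p r \<subseteq> ball p d" using r by auto
      have cgs: "continuous_on (sphere p r) g" using cg sub(1) continuous_on_subset by blast
      have "\<bar>g p - circ_mean g p r\<bar> \<le> e" if e: "e > 0" for e
      proof -
        obtain k where k: "harmonic_on k (ball p d)" "\<And>z. z\<in>ball p d \<Longrightarrow> \<bar>k z - g z\<bar> \<le> e/2"
          using H[of "e/2"] e by auto
        have ck: "continuous_on (ball p d) k" using k(1) by (rule harmonic_on_imp_continuous_on)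
        have cks: "continuous_on (sphere p r) k" using ck sub(1) continuous_on_subset by blast
        have "k p = circ_mean k p r"
          using harmonic_on_mean[OF harmonic_on_subset[OF k(1) sub(3)] continuous_on_subset[OF ck sub(2)] r(1)] .
        moreover have "\<bar>circ_mean k p r - circ_mean g p r\<bar> \<le> e/2"
        proof -
          have "\<bar>circ_mean (\<lambda>z. k z - g z) p r\<bar> \<le> circ_mean (\<lambda>z. \<bar>k z - g z\<bar>) p r"
            using r cks cgs by (intro circ_mean_abs_le continuous_intros) auto
          also have "\<dots> \<le> circ_mean (\<lambda>_. e/2) p r"
            using r cks cgs k(2) sub(1) by (intro circ_mean_mono continuous_intros) auto
          finally show ?thesis using circ_mean_diff[OF cks cgs] r by simp
        qed
        moreover have "\<bar>k p - g p\<bar> \<le> e/2" using k(2) d by simp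
        ultimately show ?thesis by linarith
      qed
      then show ?thesis by (metis abs_le_zero_iff eq_iff_diff_eq_0 field_le_epsilon add_0)
    qed
    then show ?thesis using d cg by blast
  qed
  have "continuous_on S g"
  proof (rule continuous_at_imp_continuous_on, rule ballI)
    fix p assume "p \<in> S"
    then obtain d where "d > 0" "continuous_on (ball p d) g" using loc by blast
    then show "isCont g p" by (simp add: continuous_on_eq_continuous_at)
  qed
  moreover have "\<exists>d>0. \<forall>r. 0 < r \<and> r < d \<longrightarrow> cball p r \<subseteq> S \<and> g p = circ_mean g p r" if "p \<in> S" for p
  proof -
    obtain d where d: "d>0" "cball p d \<subseteq> S" "\<And>r. 0 < r \<Longrightarrow> r < d \<Longrightarrow> g p = circ_mean g p r"
      using loc[OF \<open>p \<in> S\<close>] by blast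
    have "cball p r \<subseteq> S" if "r < d" for r using d(2) subset_cball[of r d p] that by auto
    then show ?thesis using d by blast
  qed
  ultimately have "submean_on g S" "submean_on (\<lambda>z. - g z) S"
    unfolding submean_on_def circ_mean_uminus by (fastforce intro: continuous_intros)+
  then show ?thesis by (rule harmonic_on_of_mean_value)
qed

section \<open>Least harmonic majorants\<close>

text \<open>
  The sub-mean-value inequality is inherited: at a centre inside the disc the new function is harmonic nearby, and at
  any other centre its value is the old one while the means have not decreased.
\<close>

lemma poisson_ext_modification:
  assumes v: "submean_on v S" and S: "cball a r \<subseteq> S" and r: "r > 0"
  shows "\<And>z. z \<in> S \<Longrightarrow> v z \<le> poisson_ext v a r z"
    and "submean_on (poisson_ext v a r) S"
    and "harmonic_on (poisson_ext v a r) (ball a r)"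
    and "\<And>h. submean_on (\<lambda>z. - h z) S \<Longrightarrow> (\<And>z. z \<in> S \<Longrightarrow> v z \<le> h z) \<Longrightarrow> z \<in> S \<Longrightarrow> poisson_ext v a r z \<le> h z"
proof -
  have cv: "continuous_on S v" using v by (simp add: submean_on_def)
  have cb: "continuous_on (cball a r) v" using cv S continuous_on_subset by blast
  have cs: "continuous_on (sphere a r) v" using cb continuous_on_subset sphere_cball by blast
  have cp: "continuous_on S (poisson_ext v a r)"
    by (rule continuous_on_poisson_ext[OF _ S r]) (rule continuous_on_subset[OF cv], auto)
  have cpb: "continuous_on (cball a r) (poisson_ext v a r)" using cp S continuous_on_subset by blast
  show h: "harmonic_on (poisson_ext v a r) (ball a r)" by (rule harmonic_on_poisson_ext[OF cs])
  have oS: "open S" by (rule submean_on_imp_open[OF v])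
  have bS: "ball a r \<subseteq> S" using S by auto
  show le: "v z \<le> poisson_ext v a r z" if "z \<in> S" for z
  proof (cases "z \<in> ball a r")
    case True
    show ?thesis
      by (rule maximum_principle_ball[OF submean_on_subset[OF v open_ball bS]
            harmonic_imp_submean_on[OF harmonic_on_uminus[OF h] open_ball] cb cpb _ True])
         (simp add: poisson_ext_def)
  qed (simp add: poisson_ext_def)
  show "submean_on (poisson_ext v a r) S"
    unfolding submean_on_def
  proof (intro conjI ballI cp)
    fix b assume b: "b \<in> S"
    show "\<exists>d>0. \<forall>\<rho>. 0 < \<rho> \<and> \<rho> < d \<longrightarrow> cball b \<rho> \<subseteq> S \<and> poisson_ext v a r b \<le> circ_mean (poisson_ext v a r) b \<rho>"
    proof (cases "b \<in> ball a r")
      case True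
      then show ?thesis
        using harmonic_imp_submean_on[OF h open_ball] bS unfolding submean_on_def by (meson order_trans)
    next
      case False
      obtain d where d: "d > 0" "\<And>\<rho>. 0 < \<rho> \<Longrightarrow> \<rho> < d \<Longrightarrow> cball b \<rho> \<subseteq> S \<and> v b \<le> circ_mean v b \<rho>"
        using v b unfolding submean_on_def by metis
      have "poisson_ext v a r b \<le> circ_mean (poisson_ext v a r) b \<rho>" if \<rho>: "0 < \<rho>" "\<rho> < d" for \<rho>
      proof -
        have sub: "sphere b \<rho> \<subseteq> S" using d(2)[OF \<rho>] by auto
        have "poisson_ext v a r b = v b" using False by (simp add: poisson_ext_def)
        also have "\<dots> \<le> circ_mean v b \<rho>" using d(2)[OF \<rho>] by simp
        also have "\<dots> \<le> circ_mean (poisson_ext v a r) b \<rho>"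
          using \<rho> sub le by (intro circ_mean_mono continuous_on_subset[OF cv] continuous_on_subset[OF cp]) auto
        finally show ?thesis .
      qed
      then show ?thesis using d by blast
    qed
  qed
  show "poisson_ext v a r z \<le> h z" if sh: "submean_on (\<lambda>z. - h z) S" and vh: "\<And>z. z \<in> S \<Longrightarrow> v z \<le> h z" and z: "z \<in> S" for h
  proof (cases "z \<in> ball a r")
    case True
    have "continuous_on S (\<lambda>z. - h z)" using sh by (simp add: submean_on_def)
    then have "continuous_on S (\<lambda>z. - (- h z))" by (rule continuous_on_minus)
    then have ch: "continuous_on (cball a r) h" using continuous_on_subset[OF _ S, of h] by simp
    show ?thesis
      by (rule maximum_principle_ball[OF harmonic_imp_submean_on[OF h open_ball] submean_on_subset[OF sh open_ball bS] cpb ch _ True])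
        (use vh S in \<open>auto simp: poisson_ext_def\<close>)
  qed (simp add: poisson_ext_def vh z)
qed

text \<open>
  Poisson modifications are performed along a sequence of discs whose concentric halves cover \<open>S\<close>, each
  disc being used infinitely often. On every disc a subsequence of the increasing sequence consists of harmonic
  functions; Harnack's inequality, applied to differences, makes the convergence uniform on the half disc.
\<close>

theorem least_harmonic_majorant:
  assumes v0: "submean_on v0 S" and h0: "submean_on (\<lambda>z. - h0 z) S"
    and le0: "\<And>z. z \<in> S \<Longrightarrow> v0 z \<le> h0 z"
  obtains v where "harmonic_on v S" "\<And>z. z \<in> S \<Longrightarrow> v0 z \<le> v z"
    "\<And>h z. submean_on (\<lambda>z. - h z) S \<Longrightarrow> (\<And>z. z \<in> S \<Longrightarrow> v0 z \<le> h z) \<Longrightarrow> z \<in> S \<Longrightarrow> v z \<le> h z"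
proof (cases "S = {}")
  case True
  then show ?thesis using that[of "\<lambda>_. 0"] harmonic_on_const by simp
next
  case False
  have oS: "open S" by (rule submean_on_imp_open[OF v0])
  obtain \<rho> where \<rho>: "\<And>z. z \<in> S \<Longrightarrow> \<rho> z > 0 \<and> cball z (\<rho> z) \<subseteq> S"
    using oS unfolding open_contains_cball by metis
  obtain F where F: "F \<subseteq> (\<lambda>z. ball z (\<rho> z / 2)) ` S" "countable F" "\<Union>F = \<Union>((\<lambda>z. ball z (\<rho> z / 2)) ` S)"
    by (rule Lindelof[of "(\<lambda>z. ball z (\<rho> z / 2)) ` S"]) auto
  obtain S' where S': "S' \<subseteq> S" "countable S'" "F = (\<lambda>z. ball z (\<rho> z / 2)) ` S'"
    using F(1,2) countable_subset_image[of F "\<lambda>z. ball z (\<rho> z / 2)" S] by blast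
  have cover: "\<exists>c\<in>S'. z \<in> ball c (\<rho> c / 2)" if "z \<in> S" for z
  proof -
    have "z \<in> \<Union>F" unfolding F(3) using that \<rho>[OF that] by (auto intro!: bexI[of _ z])
    then show ?thesis unfolding S'(3) by auto
  qed
  then have "S' \<noteq> {}" using False by blast
  \<comment> \<open>the first component of the inverse pairing function takes every value infinitely often\<close>
  define c where "c n = from_nat_into S' (fst (prod_decode n))" for n
  have cS: "c n \<in> S" for n unfolding c_def using from_nat_into[OF \<open>S' \<noteq> {}\<close>] S'(1) by blast
  define w where "w = rec_nat v0 (\<lambda>n u. poisson_ext u (c n) (\<rho> (c n)))"
  have w0: "w 0 = v0" and wS: "w (Suc n) = poisson_ext (w n) (c n) (\<rho> (c n))" for n
    by (simp_all add: w_def)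
  have sub: "submean_on (w n) S" for n
    by (induction n) (simp_all add: w0 wS v0 poisson_ext_modification(2) \<rho> cS)
  have inc: "w n z \<le> w (Suc n) z" if "z \<in> S" for n z
    unfolding wS by (rule poisson_ext_modification(1)[OF sub]) (use \<rho> cS that in auto)
  have mono: "w m z \<le> w n z" if "z \<in> S" "m \<le> n" for m n z
    using inc[OF that(1)] that(2) by (rule lift_Suc_mono_le[of "\<lambda>n. w n z"])
  have bound: "w n z \<le> h z" if h: "submean_on (\<lambda>z. - h z) S" "\<And>z. z \<in> S \<Longrightarrow> v0 z \<le> h z" and z: "z \<in> S" for h n z
    using z
  proof (induction n arbitrary: z)
    case 0
    then show ?case using h by (simp add: w0)
  next
    case (Suc n)
    show ?case unfolding wS
      by (rule poisson_ext_modification(4)[OF sub _ _ h(1)]) (use \<rho> cS Suc in auto)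
  qed
  define v where "v z = (SUP n. w n z)" for z
  have lim: "(\<lambda>n. w n z) \<longlonglongrightarrow> v z" if z: "z \<in> S" for z
    unfolding v_def
  proof (rule LIMSEQ_incseq_SUP)
    show "bdd_above (range (\<lambda>n. w n z))" using bound[OF h0 le0 z] by (auto intro!: bdd_aboveI)
    show "incseq (\<lambda>n. w n z)" using mono[OF z] by (auto simp: incseq_def)
  qed
  have wv: "w n z \<le> v z" if "z \<in> S" for n z
    using incseq_le[OF _ lim[OF that]] mono[OF that] by (auto simp: incseq_def)
  have "harmonic_on v S"
  proof (rule harmonic_on_approx[OF oS])
    fix p assume p: "p \<in> S"
    obtain q where q: "q \<in> S'" "p \<in> ball q (\<rho> q / 2)" using cover[OF p] by blast
    have qS: "q \<in> S" using q S' by blast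
    have rq: "\<rho> q > 0" "cball q (\<rho> q) \<subseteq> S" using \<rho>[OF qS] by auto
    obtain i where i: "q = from_nat_into S' i" using q(1) S'(2) by (metis from_nat_into_surj)
    define N where "N m = Suc (prod_encode (i, m))" for m
    have harmN: "harmonic_on (w (N m)) (ball q (\<rho> q))" for m
    proof -
      have "c (prod_encode (i,m)) = q" by (simp add: c_def i)
      then show ?thesis unfolding N_def wS
        using poisson_ext_modification(3)[OF sub rq(2,1)] by simp
    qed
    have Nlim: "filterlim N at_top sequentially"
      by (rule filterlim_at_top_mono[OF filterlim_ident]) (auto simp: N_def intro!: always_eventually le_SucI le_prod_encode_2)
    have limN: "(\<lambda>m. w (N m) z) \<longlonglongrightarrow> v z" if "z \<in> S" for z
      using filterlim_compose[OF lim[OF that] Nlim] .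
    have key: "v z - w (N m) z \<le> 3 * (v q - w (N m) q)" if z: "z \<in> ball q (\<rho> q / 2)" for z m
    proof (rule tendsto_le[OF sequentially_bot])
      have zS: "z \<in> S" using z rq by (auto dest!: subsetD[of _ _ z])
      show "(\<lambda>k. w (N k) z - w (N m) z) \<longlonglongrightarrow> v z - w (N m) z"
        by (intro tendsto_intros limN zS)
      show "(\<lambda>k. 3 * (w (N k) q - w (N m) q)) \<longlonglongrightarrow> 3 * (v q - w (N m) q)"
        by (intro tendsto_intros limN qS)
      have "eventually (\<lambda>k. N m \<le> N k) sequentially" using Nlim filterlim_at_top by blast
      then show "eventually (\<lambda>k. w (N k) z - w (N m) z \<le> 3 * (w (N k) q - w (N m) q)) sequentially"
      proof eventually_elim
        case (elim k)
        show ?case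
        proof (rule harnack_half(1)[where r = "\<rho> q"])
          show "harmonic_on (\<lambda>z. w (N k) z - w (N m) z) (ball q (\<rho> q))"
            by (intro harmonic_on_diff harmN)
          show "0 \<le> w (N k) z - w (N m) z" if "z \<in> ball q (\<rho> q)" for z
            using mono[OF _ elim, of z] that rq(2) by (auto dest!: subsetD[of _ _ z])
          show "norm (z - q) \<le> \<rho> q / 2" using z by (simp add: dist_norm norm_minus_commute)
        qed (rule rq(1))
      qed
    qed
    obtain d where d: "d > 0" "cball p d \<subseteq> ball q (\<rho> q / 2)" using q(2) open_ball unfolding open_contains_cball by blast
    have sub1: "ball q (\<rho> q / 2) \<subseteq> ball q (\<rho> q)" "ball q (\<rho> q) \<subseteq> S" "ball p d \<subseteq> ball q (\<rho> q / 2)"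
      using rq d ball_subset_cball by (auto intro!: subset_ball)
    have "\<exists>h. harmonic_on h (ball p d) \<and> (\<forall>z\<in>ball p d. \<bar>h z - v z\<bar> \<le> e)" if e: "e > 0" for e
    proof -
      have "eventually (\<lambda>m. w (N m) q > v q - e/3) sequentially"
        using order_tendstoD(1)[OF limN[OF qS]] e by simp
      then obtain m where m: "w (N m) q > v q - e/3" by (auto simp: eventually_sequentially)
      have "\<bar>w (N m) z - v z\<bar> \<le> e" if "z \<in> ball p d" for z
      proof -
        have zq: "z \<in> ball q (\<rho> q / 2)" using that sub1(3) by (rule subsetD[rotated])
        then have zS: "z \<in> S" using sub1(1,2) by (meson subsetD)
        have "v q - w (N m) q < e / 3" using m by simp
        then have "v z - w (N m) z \<le> e" using key[OF zq, of m] by simp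
        then show ?thesis using wv[OF zS, of "N m"] by simp
      qed
      moreover have "harmonic_on (w (N m)) (ball p d)"
        using harmonic_on_subset[OF harmN] sub1 by blast
      ultimately show ?thesis by blast
    qed
    moreover have "cball p d \<subseteq> S" using d(2) sub1 by blast
    ultimately show "\<exists>d>0. cball p d \<subseteq> S \<and>
        (\<forall>e>0. \<exists>h. harmonic_on h (ball p d) \<and> (\<forall>z\<in>ball p d. \<bar>h z - v z\<bar> \<le> e))"
      using d(1) by blast
  qed
  moreover have "v0 z \<le> v z" if "z \<in> S" for z using wv[OF that, of 0] by (simp add: w0)
  moreover have "v z \<le> h z" if "submean_on (\<lambda>z. - h z) S" "\<And>z. z \<in> S \<Longrightarrow> v0 z \<le> h z" "z \<in> S" for h z
    using LIMSEQ_le_const2[OF lim[OF that(3)]] bound[OF that] by blast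
  ultimately show ?thesis using that by blast
qed

section \<open>Harnack's inequality on connected sets\<close>

text \<open>
  Being comparable up to a constant for all nonnegative harmonic functions is an equivalence relation whose classes
  are open.
\<close>

lemma harnack_connected_pair:
  assumes S: "open S" "connected S" and ab: "a \<in> S" "b \<in> S"
  shows "\<exists>C>0. \<forall>h. harmonic_on h S \<longrightarrow> (\<forall>z\<in>S. h z \<ge> 0) \<longrightarrow> h a \<le> C * h b"
proof -
  define R where "R x y \<longleftrightarrow> (\<exists>C>0. \<forall>h. harmonic_on h S \<longrightarrow> (\<forall>z\<in>S. h z \<ge> 0) \<longrightarrow> h x \<le> C * h y \<and> h y \<le> C * h x)" for x y
  have "R a b"
  proof (rule connected_equivalence_relation[OF S(2) ab])
    show "R y x" if "R x y" for x y using that unfolding R_def by blast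
    show "R x z" if xy: "R x y" and yz: "R y z" and S: "x \<in> S" "y \<in> S" "z \<in> S" for x y z
    proof -
      obtain C D where C: "C > 0" "\<And>h. harmonic_on h S \<Longrightarrow> (\<forall>z\<in>S. h z \<ge> 0) \<Longrightarrow> h x \<le> C * h y \<and> h y \<le> C * h x"
        and D: "D > 0" "\<And>h. harmonic_on h S \<Longrightarrow> (\<forall>z\<in>S. h z \<ge> 0) \<Longrightarrow> h y \<le> D * h z \<and> h z \<le> D * h y"
        using xy yz unfolding R_def by metis
      have "h x \<le> (C * D) * h z \<and> h z \<le> (C * D) * h x" if "harmonic_on h S" "\<forall>z\<in>S. h z \<ge> 0" for h
        using C(2)[OF that] D(2)[OF that] C(1) D(1)
        by (smt (verit, best) mult.assoc mult.commute mult_left_mono)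
      then show ?thesis unfolding R_def using C(1) D(1) by (metis mult_pos_pos)
    qed
    show "\<exists>T. openin (top_of_set S) T \<and> x \<in> T \<and> (\<forall>y\<in>T. R x y)" if x: "x \<in> S" for x
    proof -
      obtain r where r: "r > 0" "ball x r \<subseteq> S" using S(1) x unfolding open_contains_ball by blast
      have "R x y" if "y \<in> ball x (r/2)" for y
        unfolding R_def
      proof (intro exI[of _ 3] conjI allI impI)
        fix h assume h: "harmonic_on h S" "\<forall>z\<in>S. h z \<ge> 0"
        have n: "norm (y - x) \<le> r / 2" using that by (simp add: dist_norm norm_minus_commute)
        show "h x \<le> 3 * h y" "h y \<le> 3 * h x"
          using harnack_half[OF harmonic_on_subset[OF h(1) r(2)] _ n r(1)] h(2) r(2) by blast+
      qed simp
      moreover have "ball x (r/2) \<subseteq> S" using r subset_ball[of "r/2" r x] by auto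
      ultimately show ?thesis using r by (intro exI[of _ "ball x (r/2)"]) (auto intro: open_subset)
    qed
  qed
  then show ?thesis unfolding R_def by blast
qed

lemma harnack_compact:
  assumes S: "open S" "connected S" and a: "a \<in> S" and K: "compact K" "K \<subseteq> S"
  shows "\<exists>C>0. \<forall>h. harmonic_on h S \<longrightarrow> (\<forall>z\<in>S. h z \<ge> 0) \<longrightarrow> (\<forall>z\<in>K. h z \<le> C * h a \<and> h a \<le> C * h z)"
proof -
  obtain r where r: "\<And>x. x \<in> K \<Longrightarrow> r x > 0 \<and> ball x (r x) \<subseteq> S"
    using S(1) K(2) open_contains_ball by (metis subsetD)
  obtain T where T: "T \<subseteq> K" "finite T" "K \<subseteq> (\<Union>x\<in>T. ball x (r x / 2))"
  proof (rule compactE_image[OF K(1)])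
    show "K \<subseteq> (\<Union>x\<in>K. ball x (r x / 2))" using r by force
  qed auto
  have "\<exists>C>0. \<forall>h. harmonic_on h S \<longrightarrow> (\<forall>z\<in>S. h z \<ge> 0) \<longrightarrow> h x \<le> C * h a \<and> h a \<le> C * h x" if "x \<in> T" for x
  proof -
    have x: "x \<in> S" using that T(1) K(2) by blast
    obtain C D where C: "C > 0" "\<And>h. harmonic_on h S \<Longrightarrow> (\<forall>z\<in>S. h z \<ge> 0) \<Longrightarrow> h x \<le> C * h a"
        and D: "D > 0" "\<And>h. harmonic_on h S \<Longrightarrow> (\<forall>z\<in>S. h z \<ge> 0) \<Longrightarrow> h a \<le> D * h x"
      using harnack_connected_pair[OF S x a] harnack_connected_pair[OF S a x] by blast
    have "h x \<le> max C D * h a \<and> h a \<le> max C D * h x" if h: "harmonic_on h S" "\<forall>z\<in>S. h z \<ge> 0" for h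
    proof -
      have "h x \<ge> 0" "h a \<ge> 0" using h x a by auto
      then have "C * h a \<le> max C D * h a" "D * h x \<le> max C D * h x" by (auto intro: mult_right_mono)
      then show ?thesis using C(2)[OF h] D(2)[OF h] by linarith
    qed
    then show ?thesis using C(1) by (intro exI[of _ "max C D"]) auto
  qed
  then obtain C where C: "\<And>x. x \<in> T \<Longrightarrow> C x > 0"
    "\<And>x h. x \<in> T \<Longrightarrow> harmonic_on h S \<Longrightarrow> (\<forall>z\<in>S. h z \<ge> 0) \<Longrightarrow> h x \<le> C x * h a \<and> h a \<le> C x * h x"
    by metis
  define D where "D = 3 * (1 + sum C T)"
  have le: "C x \<le> 1 + sum C T" if "x \<in> T" for x
    using member_le_sum[of x T C] that T(2) C(1) by (smt (verit) DiffD1)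
  have D: "D > 0" unfolding D_def using C(1) by (smt (verit) sum_nonneg)
  show ?thesis
  proof (intro exI[of _ D] conjI allI impI ballI D)
    fix h z assume h: "harmonic_on h S" "\<forall>z\<in>S. h z \<ge> 0" and z: "z \<in> K"
    obtain x where x: "x \<in> T" "z \<in> ball x (r x / 2)" using T(3) z by blast
    have rx: "r x > 0" "ball x (r x) \<subseteq> S" using r x(1) T(1) by auto
    have n: "norm (z - x) \<le> r x / 2" using x(2) by (simp add: dist_norm norm_minus_commute)
    have zx: "h z \<le> 3 * h x" "h x \<le> 3 * h z"
      using harnack_half[OF harmonic_on_subset[OF h(1) rx(2)] _ n rx(1)] h(2) rx(2) by blast+
    have nn: "h a \<ge> 0" "h z \<ge> 0" using h(2) a z K(2) by auto
    have xa: "h x \<le> (1 + sum C T) * h a" "h a \<le> (1 + sum C T) * h x"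
      using C(2)[OF x(1) h] mult_right_mono[OF le[OF x(1)], of "h a"] mult_right_mono[OF le[OF x(1)], of "h x"] nn zx
      by linarith+
    have pos: "1 + sum C T > 0" using D by (simp add: D_def)
    have "h z \<le> 3 * ((1 + sum C T) * h a)"
      by (rule order_trans[OF zx(1) mult_left_mono[OF xa(1)]]) simp
    then show "h z \<le> D * h a" unfolding D_def by (simp only: mult.assoc)
    have "(1 + sum C T) * h x \<le> (1 + sum C T) * (3 * h z)" using zx(2) pos by (intro mult_left_mono) auto
    with xa(2) have "h a \<le> (1 + sum C T) * (3 * h z)" by (rule order_trans)
    then show "h a \<le> D * h z" unfolding D_def by (simp only: mult_ac)
  qed
qed

lemma harmonic_nonneg_zero:
  assumes S: "open S" "connected S" and h: "harmonic_on h S" "\<And>z. z \<in> S \<Longrightarrow> h z \<ge> 0"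
    and a: "a \<in> S" "h a = 0" and z: "z \<in> S"
  shows "h z = 0"
  using harnack_connected_pair[OF S z a(1)] h a(2) z by fastforce

section \<open>Boundary Harnack inequality in half discs\<close>

abbreviation upper :: "complex set" where "upper \<equiv> {z. 0 < Im z}"

lemma open_upper: "open upper"
  by (rule open_halfspace_Im_gt)

lemma closure_upper: "w \<in> closure upper \<Longrightarrow> 0 \<le> Im w"
proof -
  assume w: "w \<in> closure upper"
  have "closure upper \<subseteq> {z. 0 \<le> Im z}"
    using closed_halfspace_Im_ge[of 0] by (intro closure_minimal) auto
  then show ?thesis using w by blast
qed

lemma at_within_upper_bot: "Im p < 0 \<Longrightarrow> at p within upper = bot"
  by (rule not_in_closure_trivial_limitI) (use closure_upper in force)

lemma circ_mean_cnj:
  assumes f: "continuous_on (sphere (cnj a) r) f" and r: "r \<ge> 0"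
  shows "circ_mean (\<lambda>z. f (cnj z)) a r = circ_mean f (cnj a) r"
proof -
  define g where "g t = f (cnj a + of_real r * cis t)" for t
  have cg: "continuous_on {x..y} g" for x y
    unfolding g_def
    by (rule continuous_on_compose2[OF f, where f = "\<lambda>t. cnj a + of_real r * cis t"])
      (use r in \<open>auto intro!: continuous_intros circ_in_sphere\<close>)
  have "integral {0..2*pi} (\<lambda>t. f (cnj (a + of_real r * cis t))) = integral {- 0 - 0..- (- (2*pi))} (\<lambda>t. g (- t))"
    by (simp add: g_def cis_cnj)
  also have "\<dots> = integral {- (2*pi)..0} g"
    using Henstock_Kurzweil_Integration.integral_reflect_real[of 0 "- (2*pi)" g] by simp
  also have "\<dots> = integral {- (2*pi)..0} (\<lambda>t. g (t + 2*pi))"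
  proof -
    have "g (t + 2*pi) = g t" for t by (simp add: g_def flip: cis_mult)
    then show ?thesis by simp
  qed
  also have "\<dots> = integral {0..2*pi} g"
    using integral_shift[of "-(2*pi)" "2*pi" 0 g] cg by (simp add: o_def)
  finally show ?thesis unfolding circ_mean_def g_def[abs_def] by simp
qed

text \<open>
  At a real point the mean of the odd extension over a small circle is zero, so the extension has the mean value
  property everywhere.
\<close>

lemma harmonic_reflection:
  assumes u: "harmonic_on u (ball p r \<inter> upper)" and p: "Im p = 0"
    and lim: "\<And>x. x \<in> ball p r \<Longrightarrow> Im x = 0 \<Longrightarrow> (u \<longlongrightarrow> 0) (at x within upper)"
  defines "U \<equiv> \<lambda>z. if Im z > 0 then u z else if Im z = 0 then 0 else - u (cnj z)"
  shows "harmonic_on U (ball p r)"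
proof -
  have odd: "U (cnj z) = - U z" for z by (simp add: U_def)
  have cp: "cnj p = p" using p by (simp add: complex_eq_iff)
  have o1: "open (ball p r \<inter> upper)" by (intro open_Int open_ball open_upper)
  have oc: "open (cnj ` (ball p r \<inter> upper))"
  proof -
    have "cnj ` (ball p r \<inter> upper) = ball p r \<inter> {z. Im z < 0}"
    proof (intro set_eqI iffI)
      fix w assume "w \<in> ball p r \<inter> {z. Im z < 0}"
      then show "w \<in> cnj ` (ball p r \<inter> upper)"
        by (intro image_eqI[of _ _ "cnj w"]) (simp_all add: dist_cnj cp)
    qed (auto simp: dist_cnj cp)
    then show ?thesis using open_halfspace_Im_lt[of 0] by auto
  qed
  have h1: "harmonic_on U (ball p r \<inter> upper)"
    by (rule harmonic_on_cong[OF u o1]) (simp add: U_def)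
  have h2: "harmonic_on U (cnj ` (ball p r \<inter> upper))"
    by (rule harmonic_on_cong[OF harmonic_on_uminus[OF harmonic_on_cnj[OF u o1]] oc]) (auto simp: U_def)
  have cases: "z \<in> ball p r \<inter> upper \<or> z \<in> cnj ` (ball p r \<inter> upper) \<or> Im z = 0" if "z \<in> ball p r" for z
  proof -
    have "z \<in> cnj ` (ball p r \<inter> upper)" if "Im z < 0"
      using \<open>z \<in> ball p r\<close> that by (intro image_eqI[of _ _ "cnj z"]) (simp_all add: dist_cnj cp)
    then show ?thesis using that by (cases "Im z > 0"; cases "Im z = 0") auto
  qed
  have cont0: "isCont U x" if x: "x \<in> ball p r" "Im x = 0" for x
    unfolding isCont_def
  proof (rule tendstoI)
    fix e :: real assume e: "e > 0"
    have cx: "cnj x = x" using x by (simp add: complex_eq_iff)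
    have "eventually (\<lambda>w. dist (u w) 0 < e) (at x within upper)" by (rule tendstoD[OF lim[OF x] e])
    then obtain d where d: "d > 0" "\<And>w. Im w > 0 \<Longrightarrow> w \<noteq> x \<Longrightarrow> dist w x < d \<Longrightarrow> \<bar>u w\<bar> < e"
      unfolding eventually_at by (auto simp: dist_real_def)
    have "\<bar>U w\<bar> < e" if w: "w \<noteq> x" "dist w x < d" for w
    proof -
      consider "Im w > 0" | "Im w = 0" | "Im w < 0" by linarith
      then show ?thesis
      proof cases
        case 3
        have "cnj w \<noteq> x" using w cx by (metis complex_cnj_cnj)
        moreover have "dist (cnj w) x < d" using w(2) dist_cnj[of x w] by (simp add: dist_commute cx)
        ultimately have "\<bar>u (cnj w)\<bar> < e" using 3 by (intro d(2)) auto
        then show ?thesis using 3 by (simp add: U_def)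
      qed (use d(2) w e in \<open>auto simp: U_def\<close>)
    qed
    then show "eventually (\<lambda>w. dist (U w) (U x) < e) (at x)"
      unfolding eventually_at using d(1) x by (intro exI[of _ d]) (simp add: U_def dist_real_def)
  qed
  have cU: "continuous_on (ball p r) U"
  proof (rule continuous_at_imp_continuous_on, rule ballI)
    fix z assume "z \<in> ball p r"
    then show "isCont U z"
      using cases[of z] cont0 harmonic_on_imp_continuous_on[OF h1] harmonic_on_imp_continuous_on[OF h2] o1 oc
      by (metis continuous_on_eq_continuous_at)
  qed
  have sm: "submean_on (\<lambda>z. c * U z) (ball p r)" if "c = 1 \<or> c = -1" for c
  proof -
    have cc: "continuous_on (ball p r) (\<lambda>z. c * U z)" using cU by (intro continuous_intros)
    have "\<exists>d>0. \<forall>\<rho>. 0 < \<rho> \<and> \<rho> < d \<longrightarrow> cball a \<rho> \<subseteq> ball p r \<and> c * U a \<le> circ_mean (\<lambda>z. c * U z) a \<rho>"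
      if a: "a \<in> ball p r" for a
    proof (cases "Im a = 0")
      case False
      then obtain T where T: "a \<in> T" "T \<subseteq> ball p r" "open T" "harmonic_on U T"
      proof (cases "Im a > 0")
        case True
        then show ?thesis using that[OF _ _ o1 h1] a by auto
      next
        case F: False
        have "cnj ` (ball p r \<inter> upper) \<subseteq> ball p r" by (auto simp: dist_cnj cp)
        then show ?thesis using that[OF _ _ oc h2] cases[OF a] False F by auto
      qed
      have "submean_on (\<lambda>z. c * U z) T" by (intro harmonic_imp_submean_on harmonic_on_cmult T)
      then show ?thesis using T(1,2) unfolding submean_on_def by (meson order_trans)
    next
      case True
      have ca: "cnj a = a" using True by (simp add: complex_eq_iff)
      obtain d where d: "d > 0" "ball a d \<subseteq> ball p r" using a open_ball open_contains_ball_eq by blast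
      have "cball a \<rho> \<subseteq> ball p r \<and> c * U a \<le> circ_mean (\<lambda>z. c * U z) a \<rho>" if \<rho>: "0 < \<rho>" "\<rho> < d" for \<rho>
      proof -
        have "cball a \<rho> \<subseteq> ball a d" using \<rho> by auto
        then have sub: "cball a \<rho> \<subseteq> ball p r" using d(2) by blast
        then have "sphere a \<rho> \<subseteq> ball p r" by auto
        then have cs: "continuous_on (sphere a \<rho>) U" using cU continuous_on_subset by blast
        have "circ_mean (\<lambda>z. U (cnj z)) a \<rho> = circ_mean U a \<rho>"
          using circ_mean_cnj[of a \<rho> U] cs ca \<rho> by simp
        then have "circ_mean U a \<rho> = 0" by (simp add: odd circ_mean_uminus)
        then show ?thesis using sub True by (simp add: circ_mean_cmult U_def)
      qed
      then show ?thesis using d(1) by blast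
    qed
    then show ?thesis using cc by (simp add: submean_on_def)
  qed
  show ?thesis
    by (rule harmonic_on_of_mean_value) (use sm[of 1] sm[of "-1"] in simp_all)
qed

text \<open>
  For the odd extension \<open>U\<close> the kernel may be replaced by half the difference of the kernels at
  \<open>z\<close> and \<open>cnj z\<close>; this difference equals \<open>Im z * Im \<zeta>\<close> times a factor
  between \<open>16 / (27 * \<rho> ^ 2)\<close> and \<open>64 / \<rho> ^ 2\<close>. Hence \<open>u z / Im z\<close> is
  comparable with one and the same integral of \<open>Im \<zeta> * U \<zeta> \<ge> 0\<close>, and \<open>108\<close>
  is the quotient of the two bounds.
\<close>

lemma half_disc_comparison:
  assumes u: "harmonic_on u (ball p r \<inter> upper)" and p: "Im p = 0" and r: "r > 0"
    and lim: "\<And>x. x \<in> ball p r \<Longrightarrow> Im x = 0 \<Longrightarrow> (u \<longlongrightarrow> 0) (at x within upper)"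
    and nn: "\<And>z. z \<in> ball p r \<Longrightarrow> Im z > 0 \<Longrightarrow> u z \<ge> 0"
    and z: "norm (z - p) \<le> r/4" "Im z > 0" and z': "norm (z' - p) \<le> r/4" "Im z' > 0"
  shows "u z * Im z' \<le> 108 * (u z' * Im z)"
proof -
  define U where "U = (\<lambda>z. if Im z > 0 then u z else if Im z = 0 then 0 else - u (cnj z))"
  have hU: "harmonic_on U (ball p r)" unfolding U_def by (rule harmonic_reflection[OF u p lim])
  have odd: "U (cnj z) = - U z" for z by (simp add: U_def)
  have cp: "cnj p = p" using p by (simp add: complex_eq_iff)
  define \<rho> where "\<rho> = r/2"
  have \<rho>: "\<rho> > 0" using r by (simp add: \<rho>_def)
  have sub: "cball p \<rho> \<subseteq> ball p r" using r by (auto simp: \<rho>_def)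
  have h: "harmonic_on U (ball p \<rho>)" by (rule harmonic_on_subset[OF hU]) (use sub in auto)
  have c: "continuous_on (cball p \<rho>) U" using harmonic_on_imp_continuous_on[OF hU] sub continuous_on_subset by blast
  have cs: "continuous_on (sphere p \<rho>) U" using c continuous_on_subset sphere_cball by blast
  define M where "M = circ_mean (\<lambda>\<zeta>. Im \<zeta> * U \<zeta>) p \<rho>"
  have pos: "Im \<zeta> * U \<zeta> \<ge> 0" if "\<zeta> \<in> sphere p \<rho>" for \<zeta>
  proof -
    have b: "\<zeta> \<in> ball p r" using that sub by auto
    consider "Im \<zeta> > 0" | "Im \<zeta> = 0" | "Im \<zeta> < 0" by linarith
    then show ?thesis
    proof cases
      case 3
      have "u (cnj \<zeta>) \<ge> 0" using b 3 by (intro nn) (auto simp: dist_cnj cp)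
      then show ?thesis using 3 by (simp add: U_def mult_nonpos_nonneg)
    qed (use nn b in \<open>auto simp: U_def\<close>)
  qed
  have M0: "M \<ge> 0"
  proof -
    have "circ_mean (\<lambda>_. 0) p \<rho> \<le> M"
      unfolding M_def by (rule circ_mean_mono) (use pos cs \<rho> in \<open>auto intro!: continuous_intros\<close>)
    then show ?thesis by simp
  qed
  have key: "Im w * (16/27 / \<rho>\<^sup>2) * M \<le> 2 * u w \<and> 2 * u w \<le> Im w * (64 / \<rho>\<^sup>2) * M"
    if w: "norm (w - p) \<le> \<rho>/2" "Im w > 0" for w
  proof -
    define d where "d = norm (w - p)"
    have d: "0 \<le> d" "d \<le> \<rho>/2" using w by (auto simp: d_def)
    have dc: "norm (cnj w - p) = d" unfolding d_def by (metis complex_cnj_diff complex_mod_cnj cp)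
    have wb: "w \<in> ball p \<rho>" "cnj w \<in> ball p \<rho>"
      using d \<rho> dc by (auto simp: dist_norm norm_minus_commute d_def)
    define Q where "Q \<zeta> = 4 * (\<rho>\<^sup>2 - d\<^sup>2) / ((norm (\<zeta> - w))\<^sup>2 * (norm (\<zeta> - cnj w))\<^sup>2)" for \<zeta>
    have far: "\<rho>/2 \<le> norm (\<zeta> - w)" "norm (\<zeta> - w) \<le> 3*\<rho>/2" 
       "\<rho>/2 \<le> norm (\<zeta> - cnj w)" "norm (\<zeta> - cnj w) \<le> 3*\<rho>/2" if "\<zeta> \<in> sphere p \<rho>" for \<zeta>
    proof -
      have n: "norm (\<zeta> - p) = \<rho>" using that by (simp add: dist_norm norm_minus_commute)
      show "\<rho>/2 \<le> norm (\<zeta> - w)" "norm (\<zeta> - w) \<le> 3*\<rho>/2" 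
       "\<rho>/2 \<le> norm (\<zeta> - cnj w)" "norm (\<zeta> - cnj w) \<le> 3*\<rho>/2"
        using norm_triangle_ineq4[of "\<zeta> - p" "w - p"] norm_triangle_ineq2[of "\<zeta> - p" "w - p"]
          norm_triangle_ineq4[of "\<zeta> - p" "cnj w - p"] norm_triangle_ineq2[of "\<zeta> - p" "cnj w - p"] n d
        by (simp_all add: d_def[symmetric] dc)
    qed
    have diff: "poisson_kernel p \<rho> w \<zeta> - poisson_kernel p \<rho> (cnj w) \<zeta> = Im w * (Q \<zeta> * Im \<zeta>)"
      if \<zeta>: "\<zeta> \<in> sphere p \<rho>" for \<zeta>
    proof -
      have n0: "(norm (\<zeta> - w))\<^sup>2 \<noteq> 0" "(norm (\<zeta> - cnj w))\<^sup>2 \<noteq> 0" using far[OF \<zeta>] \<rho> by auto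
      have e: "(norm (\<zeta> - cnj w))\<^sup>2 - (norm (\<zeta> - w))\<^sup>2 = 4 * Im w * Im \<zeta>"
        unfolding cmod_power2 by (simp add: power2_eq_square algebra_simps)
      have "poisson_kernel p \<rho> w \<zeta> - poisson_kernel p \<rho> (cnj w) \<zeta>
          = (\<rho>\<^sup>2 - d\<^sup>2) / (norm (\<zeta> - w))\<^sup>2 - (\<rho>\<^sup>2 - d\<^sup>2) / (norm (\<zeta> - cnj w))\<^sup>2"
        by (simp add: poisson_kernel_def dc d_def)
      also have "\<dots> = (\<rho>\<^sup>2 - d\<^sup>2) * ((norm (\<zeta> - cnj w))\<^sup>2 - (norm (\<zeta> - w))\<^sup>2) / ((norm (\<zeta> - w))\<^sup>2 * (norm (\<zeta> - cnj w))\<^sup>2)"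
        using n0 by (simp add: field_simps)
      also have "\<dots> = Im w * (Q \<zeta> * Im \<zeta>)"
        unfolding e Q_def by simp
      finally show ?thesis .
    qed
    have cQ: "continuous_on (sphere p \<rho>) Q"
      unfolding Q_def using wb by (intro continuous_intros) auto
    have cP: "continuous_on (sphere p \<rho>) (poisson_kernel p \<rho> w)" "continuous_on (sphere p \<rho>) (poisson_kernel p \<rho> (cnj w))"
      using wb by (auto intro: continuous_on_poisson_kernel)
    have "2 * u w = U w - U (cnj w)" using w(2) by (simp add: U_def)
    also have "\<dots> = circ_mean (\<lambda>\<zeta>. poisson_kernel p \<rho> w \<zeta> * U \<zeta> - poisson_kernel p \<rho> (cnj w) \<zeta> * U \<zeta>) p \<rho>"
      unfolding harmonic_eq_poisson_integral[OF h c wb(1)] harmonic_eq_poisson_integral[OF h c wb(2)] poisson_integral_def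
      by (rule circ_mean_diff[symmetric]) (use cs cP \<rho> in \<open>auto intro!: continuous_on_mult\<close>)
    also have "\<dots> = circ_mean (\<lambda>\<zeta>. Im w * (Q \<zeta> * (Im \<zeta> * U \<zeta>))) p \<rho>"
      by (rule circ_mean_cong) (use diff \<rho> in \<open>simp_all add: algebra_simps\<close>)
    also have "\<dots> = Im w * circ_mean (\<lambda>\<zeta>. Q \<zeta> * (Im \<zeta> * U \<zeta>)) p \<rho>"
      by (rule circ_mean_cmult)
    finally have eq: "2 * u w = Im w * circ_mean (\<lambda>\<zeta>. Q \<zeta> * (Im \<zeta> * U \<zeta>)) p \<rho>" .
    have Qb: "16/27 / \<rho>\<^sup>2 \<le> Q \<zeta>" "Q \<zeta> \<le> 64 / \<rho>\<^sup>2" if \<zeta>: "\<zeta> \<in> sphere p \<rho>" for \<zeta>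
    proof -
      have dd: "0 \<le> d\<^sup>2" "d\<^sup>2 \<le> (\<rho>/2)\<^sup>2" "d\<^sup>2 \<le> \<rho>\<^sup>2"
        using d \<rho> by (simp_all add: power_mono)
      let ?N = "(norm (\<zeta> - w))\<^sup>2 * (norm (\<zeta> - cnj w))\<^sup>2"
      have N: "(\<rho>/2)\<^sup>2 * (\<rho>/2)\<^sup>2 \<le> ?N" "?N \<le> (3*\<rho>/2)\<^sup>2 * (3*\<rho>/2)\<^sup>2"
        using far[OF \<zeta>] \<rho> by (intro mult_mono power_mono; simp)+
      have N0: "?N > 0" using N(1) \<rho> by (smt (verit) zero_less_power half_gt_zero mult_pos_pos)
      have "16/27 / \<rho>\<^sup>2 = 4 * (\<rho>\<^sup>2 - (\<rho>/2)\<^sup>2) / ((3*\<rho>/2)\<^sup>2 * (3*\<rho>/2)\<^sup>2)"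
        using \<rho> by (simp add: field_simps power2_eq_square)
      also have "\<dots> \<le> Q \<zeta>"
        unfolding Q_def using dd N N0 \<rho> by (intro frac_le) (auto simp: power_divide)
      finally show "16/27 / \<rho>\<^sup>2 \<le> Q \<zeta>" .
      have "Q \<zeta> \<le> 4 * \<rho>\<^sup>2 / ((\<rho>/2)\<^sup>2 * (\<rho>/2)\<^sup>2)"
        unfolding Q_def using dd N N0 \<rho> by (intro frac_le) auto
      also have "\<dots> = 64 / \<rho>\<^sup>2" using \<rho> by (simp add: field_simps power2_eq_square)
      finally show "Q \<zeta> \<le> 64 / \<rho>\<^sup>2" .
    qed
    have cIU: "continuous_on (sphere p \<rho>) (\<lambda>\<zeta>. Im \<zeta> * U \<zeta>)" using cs by (intro continuous_intros)
    have "16/27 / \<rho>\<^sup>2 * M \<le> circ_mean (\<lambda>\<zeta>. Q \<zeta> * (Im \<zeta> * U \<zeta>)) p \<rho>"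
      unfolding M_def circ_mean_cmult[symmetric]
      by (rule circ_mean_mono, rule continuous_on_mult[OF continuous_on_const cIU], rule continuous_on_mult[OF cQ cIU],
          use \<rho> in simp, rule mult_right_mono[OF Qb(1) pos], assumption+)
    moreover have "circ_mean (\<lambda>\<zeta>. Q \<zeta> * (Im \<zeta> * U \<zeta>)) p \<rho> \<le> 64 / \<rho>\<^sup>2 * M"
      unfolding M_def circ_mean_cmult[symmetric]
      by (rule circ_mean_mono, rule continuous_on_mult[OF cQ cIU], rule continuous_on_mult[OF continuous_on_const cIU], 
          use \<rho> in simp, rule mult_right_mono[OF Qb(2) pos], assumption+)
    ultimately have "Im w * (16/27 / \<rho>\<^sup>2 * M) \<le> 2 * u w" "2 * u w \<le> Im w * (64 / \<rho>\<^sup>2 * M)"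
      unfolding eq using w(2) by (auto intro!: mult_left_mono simp del: times_divide_eq_left times_divide_eq_right)
    then show ?thesis by (simp only: mult.assoc) 
  qed
  have k1: "2 * u z \<le> Im z * (64 / \<rho>\<^sup>2) * M" using key[of z] z by (simp add: \<rho>_def)
  have k2: "Im z' * (16/27 / \<rho>\<^sup>2) * M \<le> 2 * u z'" using key[of z'] z' by (simp add: \<rho>_def)
  have "2 * u z * Im z' \<le> Im z * (64 / \<rho>\<^sup>2) * M * Im z'"
    using k1 z'(2) by (intro mult_right_mono) auto
  also have "\<dots> = 108 * (Im z' * (16/27 / \<rho>\<^sup>2) * M) * Im z" by (simp add: field_simps)
  also have "\<dots> \<le> 108 * (2 * u z') * Im z" using k2 z(2) by (intro mult_right_mono mult_left_mono) auto
  finally show ?thesis by (simp add: mult.commute)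
qed

text \<open>
  Near the points \<open>1\<close> and \<open>-1\<close> the function is compared, by the half disc estimate, with its
  value at a point at height \<open>1 / 16\<close>; the remaining part of the half circle and these two points lie in
  a compact subset of the half disc, where the interior Harnack inequality applies.
\<close>

lemma boundary_harnack_unit:
  "\<exists>K>0. \<forall>u. harmonic_on u ({z. norm z < 2} \<inter> upper) \<longrightarrow> (\<forall>z. norm z < 2 \<longrightarrow> Im z > 0 \<longrightarrow> u z \<ge> 0) \<longrightarrow>
     (\<forall>x. Im x = 0 \<longrightarrow> 3/4 < norm x \<longrightarrow> norm x < 5/4 \<longrightarrow> (u \<longlongrightarrow> 0) (at x within upper)) \<longrightarrow>
     (\<forall>z. norm z = 1 \<longrightarrow> Im z > 0 \<longrightarrow> u z \<le> K * (Im z * u \<i>) \<and> Im z * u \<i> \<le> K * u z)"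
proof -
  define D where "D = {z::complex. norm z < 2} \<inter> upper"
  have Db: "D = ball 0 2 \<inter> upper" by (auto simp: D_def)
  have oD: "open D" unfolding Db by (intro open_Int open_ball open_upper)
  have cD: "connected D" unfolding Db
    by (intro convex_connected convex_Int convex_ball convex_halfspace_Im_gt)
  define K0 where "K0 = cball (0::complex) (5/4) \<inter> {z. Im z \<ge> 1/32}"
  have K0: "compact K0" "K0 \<subseteq> D" 
    unfolding K0_def D_def using closed_halfspace_Im_ge[of "1/32"] by (intro compact_Int_closed) auto
  have iD: "\<i> \<in> D" by (simp add: D_def)
  obtain C where C: "C > 0" "\<And>h z. harmonic_on h D \<Longrightarrow> (\<forall>z\<in>D. h z \<ge> 0) \<Longrightarrow> z \<in> K0 \<Longrightarrow> h z \<le> C * h \<i> \<and> h \<i> \<le> C * h z"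
    using harnack_compact[OF oD cD iD K0] by blast
  show ?thesis
  \<comment> \<open>\<open>1728 = 16 * 108\<close>, from the height \<open>1 / 16\<close> and the half disc comparison\<close>
  proof (rule exI[of _ "1728 * C"], intro conjI allI impI)
    show "0 < 1728 * C" using C(1) by simp
    fix u z
    assume u: "harmonic_on u ({z. norm z < 2} \<inter> upper)" and nn: "\<forall>z. norm z < 2 \<longrightarrow> Im z > 0 \<longrightarrow> u z \<ge> 0"
      and lim: "\<forall>x. Im x = 0 \<longrightarrow> 3/4 < norm x \<longrightarrow> norm x < 5/4 \<longrightarrow> (u \<longlongrightarrow> 0) (at x within upper)"
      and z: "norm z = 1" "Im z > 0"
    have uD: "harmonic_on u D" "\<forall>z\<in>D. u z \<ge> 0" using u nn by (auto simp: D_def)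
    have un: "u z \<ge> 0" "u \<i> \<ge> 0" using nn z by auto
    have near: "u z \<le> 1728 * C * (Im z * u \<i>) \<and> Im z * u \<i> \<le> 1728 * C * u z"
      if p: "p = 1 \<or> p = -1" "norm (z - p) \<le> 1/16" for p
    proof -
      define z' where "z' = p + \<i> / 16"
      have np: "norm p = 1" "Im p = 0" using p by auto
      have sub: "norm w < 5/4" "norm w > 3/4" if "w \<in> ball p (1/4)" for w
        using that norm_triangle_ineq2[of w p] norm_triangle_ineq2[of p w] np
        by (auto simp: dist_norm norm_minus_commute)
      have z'K: "z' \<in> K0" "Im z' = 1/16"
        using norm_triangle_ineq[of p "\<i>/16"] np by (auto simp: K0_def z'_def norm_divide)
      have nz': "norm (z' - p) \<le> 1/4/4" by (simp add: z'_def norm_divide)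
      have nz: "norm (z - p) \<le> 1/4/4" using p by simp
      have hu: "harmonic_on u (ball p (1/4) \<inter> upper)"
        by (rule harmonic_on_subset[OF u]) (use sub in force)
      have 1: "u a * Im b \<le> 108 * (u b * Im a)" 
        if "norm (a - p) \<le> 1/4/4" "Im a > 0" "norm (b - p) \<le> 1/4/4" "Im b > 0" for a b
        by (rule half_disc_comparison[OF hu np(2) _ _ _ that]) (use sub lim nn in force)+
      have "Im z' > 0" using z'K by simp
      note A = 1[OF nz z(2) nz' this] 1[OF nz' this nz z(2)]
      have B: "u z' \<le> C * u \<i>" "u \<i> \<le> C * u z'" using C(2)[OF uD z'K(1)] by auto
      have "u z \<le> 1728 * (u z' * Im z)" using A(1) z'K(2) by simp
      also have "\<dots> \<le> 1728 * (C * u \<i> * Im z)" using B(1) z(2) by (intro mult_left_mono mult_right_mono) auto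
      finally have F: "u z \<le> 1728 * C * (Im z * u \<i>)" by (simp only: mult_ac)
      have "Im z * u \<i> \<le> Im z * (C * u z')" using B(2) z(2) by (intro mult_left_mono) auto
      also have "\<dots> = C * (u z' * Im z)" by (simp only: mult_ac)
      also have "\<dots> \<le> C * (108 * (u z * (1/16)))" using A(2) z'K(2) C(1) by (intro mult_left_mono) auto
      also have "\<dots> \<le> 1728 * C * u z" using C(1) un by simp
      finally show ?thesis using F by simp
    qed
    have "u z \<le> 1728 * C * (Im z * u \<i>) \<and> Im z * u \<i> \<le> 1728 * C * u z"
    proof (cases "norm (z - 1) \<le> 1/16 \<or> norm (z - (-1)) \<le> 1/16")
      case True
      then show ?thesis using near[of 1] near[of "-1"] by blast
    next
      case False
      have s: "(Re z)\<^sup>2 + (Im z)\<^sup>2 = 1" using z(1) by (metis cmod_power2 power_one)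
      have "(1/16)\<^sup>2 < (norm (z - 1))\<^sup>2" "(1/16)\<^sup>2 < (norm (z - (-1)))\<^sup>2"
        using False by (auto intro!: power_strict_mono)
      then have R: "1/256 < 2 - 2 * Re z" "1/256 < 2 + 2 * Re z"
        using s unfolding cmod_power2 by (simp_all add: power2_eq_square algebra_simps)
      have "(Re z)\<^sup>2 \<le> (1 - 1/512)\<^sup>2" using R by (intro abs_le_square_iff[THEN iffD1]) auto
      then have "(1/32)\<^sup>2 \<le> (Im z)\<^sup>2" using s by (simp add: power2_eq_square)
      then have I: "1/32 \<le> Im z" using z(2) by (metis abs_le_square_iff abs_of_nonneg less_imp_le divide_nonneg_nonneg zero_le_one zero_le_numeral)
      then have "z \<in> K0" using z(1) by (simp add: K0_def)
      then have B: "u z \<le> C * u \<i>" "u \<i> \<le> C * u z" using C(2)[OF uD] by auto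
      have I1: "Im z \<le> 1" using abs_Im_le_cmod[of z] z by simp
      have "C * u \<i> * 1 \<le> C * u \<i> * (1728 * Im z)" using I C(1) un by (intro mult_left_mono) auto
      with B(1) have F: "u z \<le> 1728 * C * (Im z * u \<i>)" by (simp add: mult_ac)
      have "Im z * u \<i> \<le> 1 * u \<i>" using I1 un by (intro mult_right_mono) auto
      also have "\<dots> \<le> C * u z" using B by simp
      also have "\<dots> \<le> 1728 * C * u z" using C(1) un by simp
      finally show ?thesis using F by simp
    qed
    then show "u z \<le> 1728 * C * (Im z * u \<i>)" "Im z * u \<i> \<le> 1728 * C * u z" by auto
  qed
qed

text \<open>
  A constant for the unit circle. It serves circles of every radius because the estimate is invariant under scaling.
\<close>

definition bhp_const :: real where
  "bhp_const = (SOME K. K > 0 \<and> (\<forall>u. harmonic_on u ({z. norm z < 2} \<inter> upper) \<longrightarrow> (\<forall>z. norm z < 2 \<longrightarrow> Im z > 0 \<longrightarrow> u z \<ge> 0) \<longrightarrow>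
     (\<forall>x. Im x = 0 \<longrightarrow> 3/4 < norm x \<longrightarrow> norm x < 5/4 \<longrightarrow> (u \<longlongrightarrow> 0) (at x within upper)) \<longrightarrow>
     (\<forall>z. norm z = 1 \<longrightarrow> Im z > 0 \<longrightarrow> u z \<le> K * (Im z * u \<i>) \<and> Im z * u \<i> \<le> K * u z)))"

lemma boundary_harnack:
  assumes u: "harmonic_on u ({z. norm z < 2 * R} \<inter> upper)" and nn: "\<And>z. norm z < 2 * R \<Longrightarrow> Im z > 0 \<Longrightarrow> u z \<ge> 0"
    and lim: "\<And>x. Im x = 0 \<Longrightarrow> 3/4 * R < norm x \<Longrightarrow> norm x < 5/4 * R \<Longrightarrow> (u \<longlongrightarrow> 0) (at x within upper)"
    and R: "R > 0" and z: "norm z = R" "Im z > 0"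
  shows "u z \<le> bhp_const * (Im z / R * u (\<i> * of_real R))"
    "Im z / R * u (\<i> * of_real R) \<le> bhp_const * u z"
proof -
  note B = someI_ex[OF boundary_harnack_unit, folded bhp_const_def, THEN conjunct2, rule_format]
  define v where "v w = u (of_real R * w)" for w
  have o: "open ({z::complex. norm z < 2 * R} \<inter> upper)" "open ({z::complex. norm z < 2} \<inter> upper)"
    by (intro open_Int open_upper open_Collect_less continuous_intros)+
  have hv: "harmonic_on v ({z. norm z < 2} \<inter> upper)"
    unfolding v_def
    by (rule harmonic_on_compose_holomorphic[OF u o(1) _ o(2)]) (use R in \<open>auto intro!: holomorphic_intros simp: norm_mult\<close>)
  have nv: "v w \<ge> 0" if "norm w < 2" "Im w > 0" for w
    unfolding v_def using that R by (intro nn) (auto simp: norm_mult)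
  have lv: "(v \<longlongrightarrow> 0) (at x within upper)" if x: "Im x = 0" "3/4 < norm x" "norm x < 5/4" for x
  proof -
    have "(u \<longlongrightarrow> 0) (at (of_real R * x) within upper)"
      using x R by (intro lim) (auto simp: norm_mult)
    moreover have "filterlim (\<lambda>w. of_real R * w) (at (of_real R * x) within upper) (at x within upper)"
      unfolding filterlim_at using R
      by (auto intro!: tendsto_intros simp: eventually_at_filter)
    ultimately show ?thesis unfolding v_def by (rule filterlim_compose)
  qed
  define w where "w = z / of_real R"
  have w: "norm w = 1" "Im w = Im z / R" "Im w > 0" using z R by (auto simp: w_def norm_divide)
  have vw: "v w = u z" using R by (simp add: v_def w_def)
  have vi: "v \<i> = u (\<i> * of_real R)" by (simp add: v_def mult.commute)
  show "u z \<le> bhp_const * (Im z / R * u (\<i> * of_real R))"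
    "Im z / R * u (\<i> * of_real R) \<le> bhp_const * u z"
    using B[OF hv nv lv w(1,3)] unfolding vw vi w(2) by auto
qed

lemma bhp_const_pos: "bhp_const > 0"
  using someI_ex[OF boundary_harnack_unit, folded bhp_const_def] by blast

section \<open>Harmonic measure in the half plane\<close>

text \<open>
  The angle under which the interval from \<open>a\<close> to \<open>b\<close> is seen from \<open>w\<close>; divided
  by \<open>pi\<close> it is the harmonic measure of the interval in the upper half plane.
\<close>

definition ang :: "real \<Rightarrow> real \<Rightarrow> complex \<Rightarrow> real" where
  "ang a b w = arctan ((b - Re w) / Im w) - arctan ((a - Re w) / Im w)"

lemma harmonic_on_ang: "harmonic_on (ang a b) upper"
proof -
  have h: "harmonic_on (\<lambda>w. arctan ((c - Re w) / Im w)) upper" for c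
  proof -
    have nr: "- \<i> * (w - of_real c) \<notin> \<real>\<^sub>\<le>\<^sub>0" if "Im w > 0" for w
      using that by (auto simp: complex_nonpos_Reals_iff)
    have "harmonic_on (\<lambda>w. Re (- \<i> * Ln (- \<i> * (w - of_real c)))) upper"
      by (rule harmonic_on_Re[OF _ open_upper]) (use nr in \<open>auto intro!: holomorphic_intros\<close>)
    then show ?thesis
    proof (rule harmonic_on_cong[OF _ open_upper])
      fix w assume w: "w \<in> upper"
      let ?v = "- \<i> * (w - of_real c)"
      have R: "Re ?v = Im w" "Im ?v = c - Re w" by simp_all
      have "?v \<noteq> 0" using w by (auto simp: complex_eq_iff)
      then have "Im (Ln ?v) = Arg ?v" by (simp add: Arg_eq_Im_Ln)
      also have "\<dots> = arctan (Im ?v / Re ?v)" using w R by (intro arg_conv_arctan) auto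
      finally show "Re (- \<i> * Ln ?v) = arctan ((c - Re w) / Im w)" unfolding R by simp
    qed
  qed
  show ?thesis unfolding ang_def[abs_def] by (intro harmonic_on_diff h)
qed

lemma ang_mvt:
  assumes "a < b" "Im w > 0"
  obtains s where "a < s" "s < b" "ang a b w = (b - a) * Im w / ((Im w)\<^sup>2 + (s - Re w)\<^sup>2)"
proof -
  obtain s where s: "a < s" "s < b"
    "arctan ((b - Re w) / Im w) - arctan ((a - Re w) / Im w) = (b - a) * (inverse (1 + ((s - Re w) / Im w)\<^sup>2) * (1 / Im w))"
    using MVT2[of a b "\<lambda>s. arctan ((s - Re w) / Im w)" "\<lambda>s. inverse (1 + ((s - Re w) / Im w)\<^sup>2) * (1 / Im w)"] assms
    by (force intro!: derivative_eq_intros)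
  have "inverse (1 + ((s - Re w) / Im w)\<^sup>2) * (1 / Im w) = Im w / ((Im w)\<^sup>2 + (s - Re w)\<^sup>2)"
    using assms(2) by (simp add: power_divide field_simps add_pos_nonneg power2_eq_square)
  then show ?thesis using that[OF s(1,2)] s(3) by (simp add: ang_def)
qed

lemma ang_nonneg: "a < b \<Longrightarrow> Im w > 0 \<Longrightarrow> ang a b w \<ge> 0"
  by (erule (1) ang_mvt) simp

lemma ang_le_pi: "ang a b w \<le> pi"
  using arctan_bounded[of "(b - Re w) / Im w"] arctan_bounded[of "(a - Re w) / Im w"] by (simp add: ang_def)

lemma ang_ge:
  assumes "a < b" "Im w > 0" "\<bar>a - Re w\<bar> \<le> M" "\<bar>b - Re w\<bar> \<le> M"
  shows "(b - a) * Im w / ((Im w)\<^sup>2 + M\<^sup>2) \<le> ang a b w"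
proof -
  obtain s where s: "a < s" "s < b" "ang a b w = (b - a) * Im w / ((Im w)\<^sup>2 + (s - Re w)\<^sup>2)"
    using ang_mvt[OF assms(1,2)] by blast
  have "\<bar>s - Re w\<bar> \<le> M" using s assms by auto
  from power_mono[OF this abs_ge_zero, of 2] have "(s - Re w)\<^sup>2 \<le> M\<^sup>2" by simp
  then show ?thesis unfolding s(3) using assms
    by (intro divide_left_mono mult_pos_pos add_left_mono add_pos_nonneg) auto
qed

lemma ang_le:
  assumes "a < b" "Im w > 0" "\<And>s. a < s \<Longrightarrow> s < b \<Longrightarrow> M \<le> \<bar>s - Re w\<bar>" "M \<ge> 0"
  shows "ang a b w \<le> (b - a) * Im w / ((Im w)\<^sup>2 + M\<^sup>2)"
proof -
  obtain s where s: "a < s" "s < b" "ang a b w = (b - a) * Im w / ((Im w)\<^sup>2 + (s - Re w)\<^sup>2)"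
    using ang_mvt[OF assms(1,2)] by blast
  have "M\<^sup>2 \<le> (s - Re w)\<^sup>2" using assms(3)[OF s(1,2)] assms(4) power_mono[of M "\<bar>s - Re w\<bar>" 2] by simp
  then show ?thesis unfolding s(3) using assms
    by (intro divide_left_mono mult_pos_pos add_left_mono add_pos_nonneg) auto
qed

lemma ang_tendsto_boundary:
  assumes ab: "a < b" and x: "x < a \<or> b < x"
  shows "(ang a b \<longlongrightarrow> 0) (at (of_real x) within upper)"
proof (rule tendsto_sandwich[of "\<lambda>_. 0"])
  define d where "d = (if x < a then a - x else x - b) / 2"
  have d: "d > 0" using x ab by (auto simp: d_def)
  have ev: "eventually (\<lambda>w. Im w > 0 \<and> dist w (of_real x) < d) (at (of_real x) within upper)"
    using d by (auto simp: eventually_at intro!: exI[of _ d])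
  show "eventually (\<lambda>w. 0 \<le> ang a b w) (at (of_real x) within upper)"
    using ev by eventually_elim (simp add: ang_nonneg ab)
  show "eventually (\<lambda>w. ang a b w \<le> (b - a) * Im w / ((Im w)\<^sup>2 + d\<^sup>2)) (at (of_real x) within upper)"
    using ev
  proof eventually_elim
    case (elim w)
    have "\<bar>Re w - x\<bar> < d" using elim abs_Re_le_cmod[of "w - of_real x"] by (simp add: dist_norm)
    then show ?case
      using elim d ab x by (intro ang_le) (auto simp: d_def abs_if split: if_splits)
  qed
  have "((\<lambda>w. (b - a) * Im w / ((Im w)\<^sup>2 + d\<^sup>2)) \<longlongrightarrow> (b - a) * Im (of_real x) / ((Im (of_real x))\<^sup>2 + d\<^sup>2)) (at (of_real x) within upper)"
    using d by (intro tendsto_intros) auto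
  then show "((\<lambda>w. (b - a) * Im w / ((Im w)\<^sup>2 + d\<^sup>2)) \<longlongrightarrow> 0) (at (of_real x) within upper)" by simp
qed simp

lemma ang_tendsto_infinity:
  assumes ab: "a < b"
  shows "(ang a b \<longlongrightarrow> 0) (inf at_infinity (principal upper))"
proof (rule tendstoI)
  fix e :: real assume e: "e > 0"
  define L where "L = (b - a) / e + 1"
  have L: "L > 0" "(b - a) / L < e" using ab e by (auto simp: L_def field_simps add_pos_pos)
  define B where "B = 2 * L + \<bar>a\<bar> + \<bar>b\<bar>"
  have "ang a b w < e" if w: "B \<le> norm w" "Im w > 0" for w
  proof (cases "Im w \<ge> L")
    case True
    have "ang a b w \<le> (b - a) * Im w / ((Im w)\<^sup>2 + 0\<^sup>2)" using ab w by (intro ang_le) auto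
    also have "\<dots> = (b - a) / Im w" using w by (simp add: power2_eq_square)
    also have "\<dots> \<le> (b - a) / L" using True L ab w by (intro divide_left_mono) auto
    finally show ?thesis using L by simp
  next
    case False
    have "norm w \<le> \<bar>Re w\<bar> + \<bar>Im w\<bar>" by (rule cmod_le)
    then have R: "\<bar>Re w\<bar> \<ge> L + \<bar>a\<bar> + \<bar>b\<bar>" using w False by (simp add: B_def)
    have "ang a b w \<le> (b - a) * Im w / ((Im w)\<^sup>2 + L\<^sup>2)"
      using ab w R L by (intro ang_le) auto
    also have "\<dots> \<le> (b - a) * L / L\<^sup>2"
      using False w L ab by (intro frac_le mult_left_mono) auto
    also have "\<dots> = (b - a) / L" using L by (simp add: power2_eq_square)
    finally show ?thesis using L by simp
  qed
  then have "eventually (\<lambda>w. w \<in> upper \<longrightarrow> dist (ang a b w) 0 < e) at_infinity"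
    unfolding eventually_at_infinity using ang_nonneg[OF ab] by (intro exI[of _ B]) (auto simp: dist_real_def)
  then show "eventually (\<lambda>w. dist (ang a b w) 0 < e) (inf at_infinity (principal upper))"
    by (simp add: eventually_inf_principal)
qed

text \<open>
  The sum is the Poisson integral of a step function, whose boundary values are at most those of \<open>h\<close>. The
  intervals are closed and disjoint, so that near an end point of one interval the angles of the others are small.
\<close>

lemma half_plane_minorant:
  assumes J: "finite J" and ab: "\<And>j. j \<in> J \<Longrightarrow> a j < b j" and m: "\<And>j. j \<in> J \<Longrightarrow> m j \<ge> 0"
    and disj: "\<And>i j x. i \<in> J \<Longrightarrow> j \<in> J \<Longrightarrow> x \<in> {a i..b i} \<Longrightarrow> x \<in> {a j..b j} \<Longrightarrow> i = j"
    and h: "harmonic_on h upper" and nn: "\<And>w. w \<in> upper \<Longrightarrow> h w \<ge> 0"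
    and bd: "\<And>j x e. j \<in> J \<Longrightarrow> x \<in> {a j..b j} \<Longrightarrow> e > 0 \<Longrightarrow> eventually (\<lambda>w. m j - e < h w) (at (of_real x) within upper)"
    and w: "w \<in> upper"
  shows "(\<Sum>j\<in>J. m j * ang (a j) (b j) w / pi) \<le> h w"
proof -
  define T where "T j w = m j * ang (a j) (b j) w / pi" for j w
  have hT: "harmonic_on (\<lambda>w. \<Sum>j\<in>I. T j w) upper" if "finite I" for I
    using that
  proof (induction I)
    case empty
    then show ?case by simp
  next
    case (insert i I)
    have "harmonic_on (\<lambda>w. (m i / pi) * ang (a i) (b i) w) upper" by (intro harmonic_on_cmult harmonic_on_ang)
    then have "harmonic_on (T i) upper" by (simp add: T_def[abs_def])
    then show ?case using insert by (simp add: harmonic_on_add)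
  qed
  have lim0: "((\<lambda>w. \<Sum>j\<in>I. T j w) \<longlongrightarrow> 0) F" if "\<And>j. j \<in> I \<Longrightarrow> (ang (a j) (b j) \<longlongrightarrow> 0) F" for I F
  proof -
    have "((\<lambda>w. \<Sum>j\<in>I. T j w) \<longlongrightarrow> (\<Sum>j\<in>I. m j * 0 / pi)) F"
      unfolding T_def by (intro tendsto_intros that) auto
    then show ?thesis by simp
  qed
  have "(\<Sum>j\<in>J. T j w) \<le> h w"
  proof (rule maximum_principle_compare[OF harmonic_imp_submean_on[OF hT[OF J] open_upper] 
        harmonic_imp_submean_on[OF harmonic_on_uminus[OF h] open_upper] _ _ w])
    fix e :: real assume e: "e > 0"
    have "((\<lambda>w. \<Sum>j\<in>J. T j w) \<longlongrightarrow> 0) (inf at_infinity (principal upper))"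
      by (intro lim0 ang_tendsto_infinity ab)
    then have "eventually (\<lambda>w. (\<Sum>j\<in>J. T j w) < e) (inf at_infinity (principal upper))"
      using e by (rule order_tendstoD)
    then show "eventually (\<lambda>w. w \<in> upper \<longrightarrow> (\<Sum>j\<in>J. T j w) < h w + e) at_infinity"
      unfolding eventually_inf_principal by eventually_elim (use nn in force)
    fix p :: complex assume "p \<notin> upper"
    then consider "Im p < 0" | "Im p = 0" by fastforce
    then show "eventually (\<lambda>w. (\<Sum>j\<in>J. T j w) < h w + e) (at p within upper)"
    proof cases
      case 1
      then show ?thesis by (simp add: at_within_upper_bot)
    next
      case 2
      define x where "x = Re p"
      have p: "p = of_real x" using 2 by (simp add: x_def complex_eq_iff)
      have up: "eventually (\<lambda>w. w \<in> upper) (at p within upper)" by (simp add: eventually_at_filter)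
      show ?thesis
      proof (cases "\<exists>i\<in>J. x \<in> {a i..b i}")
        case True
        then obtain i where i: "i \<in> J" "x \<in> {a i..b i}" by blast
        have "((\<lambda>w. \<Sum>j\<in>J-{i}. T j w) \<longlongrightarrow> 0) (at p within upper)"
        proof (rule lim0)
          fix j assume j: "j \<in> J - {i}"
          then have "x \<notin> {a j..b j}" using disj[OF i(1) _ i(2), of j] by blast
          then show "(ang (a j) (b j) \<longlongrightarrow> 0) (at p within upper)"
            unfolding p using j ab by (intro ang_tendsto_boundary) auto
        qed
        then have "eventually (\<lambda>w. (\<Sum>j\<in>J-{i}. T j w) < e/2) (at p within upper)"
          using e by (intro order_tendstoD(2)) auto
        moreover have "eventually (\<lambda>w. m i - e/2 < h w) (at p within upper)"
          unfolding p using bd[OF i] e by simp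
        ultimately show ?thesis
        proof eventually_elim
          case (elim w)
          have "T i w \<le> m i * pi / pi" unfolding T_def
            by (intro divide_right_mono mult_left_mono ang_le_pi m i) auto
          then show ?case using elim J i(1) by (simp add: sum.remove)
        qed
      next
        case False
        have "((\<lambda>w. \<Sum>j\<in>J. T j w) \<longlongrightarrow> 0) (at p within upper)"
          by (rule lim0) (unfold p, intro ang_tendsto_boundary, use False ab in auto)
        then have "eventually (\<lambda>w. (\<Sum>j\<in>J. T j w) < e) (at p within upper)"
          using e by (rule order_tendstoD)
        then show ?thesis using up by eventually_elim (use nn in force)
      qed
    qed
  qed
  then show ?thesis by (simp add: T_def)
qed

text \<open>
  On the circle the positive part of \<open>Im w\<close> is at least
  \<open>Im w / 2 + Im w ^ 2 / (2 * \<rho>)\<close>, which differs from a harmonic function by a constant and has mean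
  \<open>\<rho> / 4\<close>.
\<close>

lemma half_disc_lower_bound:
  assumes h: "harmonic_on h (ball x r)" and \<rho>: "0 < \<rho>" "\<rho> < r" and x: "Im x = 0" and m: "m \<ge> 0"
    and nn: "\<And>w. w \<in> sphere x \<rho> \<Longrightarrow> h w \<ge> 0"
    and lb: "\<And>w. w \<in> sphere x \<rho> \<Longrightarrow> Im w > 0 \<Longrightarrow> m * Im w \<le> h w"
  shows "m * \<rho> / 4 \<le> h x"
proof -
  have sub: "cball x \<rho> \<subseteq> ball x r" using \<rho> by auto
  have c: "continuous_on (cball x \<rho>) h" using harmonic_on_imp_continuous_on[OF h] sub continuous_on_subset by blast
  have cs: "continuous_on (sphere x \<rho>) h" using c continuous_on_subset sphere_cball by blast
  have "harmonic_on h (ball x \<rho>)" by (rule harmonic_on_subset[OF h]) (use sub in auto)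
  then have hx: "h x = circ_mean h x \<rho>" using harmonic_on_mean c \<rho> by blast
  define f where "f w = Re (- \<i> * w / 2 - (w - x)\<^sup>2 / (4 * of_real \<rho>))" for w
  have "harmonic_on f UNIV"
    unfolding f_def using \<rho> by (intro harmonic_on_Re holomorphic_intros) auto
  then have hf: "harmonic_on f S" for S using harmonic_on_subset by blast
  have cf: "continuous_on S f" for S by (rule harmonic_on_imp_continuous_on[OF hf])
  have fx: "circ_mean f x \<rho> = 0" using harmonic_on_mean[OF hf cf \<rho>(1), of x] x by (simp add: f_def)
  have fe: "f w + \<rho>/4 = Im w / 2 + (Im w)\<^sup>2 / (2 * \<rho>)" if "w \<in> sphere x \<rho>" for w
  proof -
    have "(norm (w - x))\<^sup>2 = \<rho>\<^sup>2" using that by (simp add: dist_norm norm_minus_commute)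
    then have e: "(Re (w - x))\<^sup>2 = \<rho>\<^sup>2 - (Im w)\<^sup>2" unfolding cmod_power2 using x by simp
    have "f w = Im w / 2 - ((Re (w - x))\<^sup>2 - (Im (w - x))\<^sup>2) / (4 * \<rho>)"
    proof -
      have "f w = Im w / 2 - Re ((w - x)\<^sup>2 / of_real (4 * \<rho>))" unfolding f_def by simp
      then show ?thesis by (simp only: Re_divide_of_real Re_power2)
    qed
    then show ?thesis unfolding e using x \<rho> by (simp add: field_simps power2_eq_square)
  qed
  have "m * \<rho> / 4 = circ_mean (\<lambda>w. m * (f w + \<rho>/4)) x \<rho>"
  proof -
    have "circ_mean (\<lambda>w. f w + \<rho>/4) x \<rho> = circ_mean f x \<rho> + circ_mean (\<lambda>_. \<rho>/4) x \<rho>"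
      by (rule circ_mean_add[OF cf continuous_on_const]) (use \<rho> in simp)
    then show ?thesis unfolding circ_mean_cmult using fx by simp
  qed
  also have "\<dots> \<le> circ_mean h x \<rho>"
  proof (rule circ_mean_mono)
    fix w assume w: "w \<in> sphere x \<rho>"
    have I: "\<bar>Im w\<bar> \<le> \<rho>" using abs_Im_le_cmod[of "w - x"] w x by (simp add: dist_norm norm_minus_commute)
    show "m * (f w + \<rho>/4) \<le> h w"
    proof (cases "Im w > 0")
      case True
      have "(Im w)\<^sup>2 \<le> Im w * \<rho>" using True I by (simp add: power2_eq_square)
      then have "Im w / 2 + (Im w)\<^sup>2 / (2 * \<rho>) \<le> Im w" using \<rho> by (simp add: field_simps)
      then have "m * (f w + \<rho>/4) \<le> m * Im w" unfolding fe[OF w] using m by (rule mult_left_mono)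
      then show ?thesis using lb[OF w True] by linarith
    next
      case False
      have "(Im w)\<^sup>2 \<le> (- Im w) * \<rho>" using False I mult_left_mono[of "- Im w" \<rho> "- Im w"] by (simp add: power2_eq_square)
      then have "Im w / 2 + (Im w)\<^sup>2 / (2 * \<rho>) \<le> 0" using \<rho> by (simp add: field_simps)
      then have "m * (f w + \<rho>/4) \<le> 0" unfolding fe[OF w] using m by (simp add: mult_nonneg_nonpos)
      then show ?thesis using nn[OF w] by linarith
    qed
  qed (use cs cf \<rho> in \<open>auto intro!: continuous_intros\<close>)
  finally show ?thesis by (simp add: hx)
qed

section \<open>Barriers and regular boundary points\<close>

lemma ext_plane_nbhd_Some:
  assumes "openin ext_plane T" "Some a \<in> T"
  obtains r where "r > 0" "\<And>z. z \<in> ball a r \<Longrightarrow> Some z \<in> T"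
proof -
  have "eventually (\<lambda>x. x \<in> T) (nhdsin ext_plane (Some a))"
    using assms unfolding eventually_nhdsin by blast
  then have "eventually (\<lambda>z. Some z \<in> T) (filtercomap Some (nhdsin ext_plane (Some a)))"
    by (rule eventually_filtercomapI)
  then have "eventually (\<lambda>z. Some z \<in> T) (nhds a)" unfolding filtercomap_Some_finite .
  then obtain r where "r > 0" "\<And>z. dist z a < r \<Longrightarrow> Some z \<in> T" unfolding eventually_nhds_metric by blast
  then show ?thesis using that by (simp add: dist_commute)
qed

lemma ext_plane_nbhd_None:
  assumes "openin ext_plane T" "None \<in> T"
  obtains B where "\<And>z. norm z \<ge> B \<Longrightarrow> Some z \<in> T"
proof -
  have "eventually (\<lambda>x. x \<in> T) (nhdsin ext_plane None)"
    using assms unfolding eventually_nhdsin by blast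
  then have "eventually (\<lambda>z. Some z \<in> T) (filtercomap Some (nhdsin ext_plane None))"
    by (rule eventually_filtercomapI)
  then have "eventually (\<lambda>z. Some z \<in> T) at_infinity" unfolding filtercomap_Some_infinity .
  then show ?thesis using that unfolding eventually_at_infinity by blast
qed

lemma tending_to_in: "eventually (\<lambda>w. w \<in> \<Omega>) (tending_to \<Omega> \<zeta>)"
  by (simp add: tending_to_def eventually_inf_principal)

text \<open>
  Near the boundary the data lie between \<open>\<phi> \<zeta> - \<epsilon> - C * b\<close> and
  \<open>\<phi> \<zeta> + \<epsilon> + C * b\<close>, where \<open>C\<close> absorbs the oscillation of
  \<open>\<phi>\<close> away from \<open>\<zeta>\<close>. The lower function belongs to the Perron family and the
  upper one dominates every member of it.
\<close>

lemma Dirichlet_regular_of_barrier: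
  assumes \<Omega>: "open \<Omega>" and fr: "ext_frontier \<Omega> = ext_compl \<Omega>" and \<zeta>: "\<zeta> \<in> ext_compl \<Omega>"
    and b: "harmonic_on b \<Omega>" and b0: "\<And>w. w \<in> \<Omega> \<Longrightarrow> b w \<ge> 0"
    and lim: "(b \<longlongrightarrow> 0) (tending_to \<Omega> \<zeta>)"
    and away: "\<And>S. openin ext_plane S \<Longrightarrow> \<zeta> \<in> S \<Longrightarrow> 
        \<exists>\<delta>>0. \<forall>\<eta>\<in>ext_compl \<Omega> - S. eventually (\<lambda>w. \<delta> \<le> b w) (tending_to \<Omega> \<eta>)"
  shows "Dirichlet_regular \<Omega> \<zeta>"
  unfolding Dirichlet_regular_def
proof (intro conjI allI impI)
  show "\<zeta> \<in> ext_frontier \<Omega>" using \<zeta> fr by simp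
  fix \<phi> assume \<phi>: "continuous_map (subtopology ext_plane (ext_frontier \<Omega>)) euclideanreal \<phi>"
  have "compactin ext_plane (ext_frontier \<Omega>)"
    unfolding ext_frontier_def
    by (intro closedin_compact_space compact_space_Alexandroff_compactification closedin_frontier_of)
  then have "compactin (subtopology ext_plane (ext_frontier \<Omega>)) (ext_frontier \<Omega>)"
    by (simp add: compactin_subtopology)
  from image_compactin[OF this \<phi>] have "bounded (\<phi> ` ext_frontier \<Omega>)"
    by (simp add: compact_imp_bounded)
  then obtain M where M: "\<And>\<eta>. \<eta> \<in> ext_compl \<Omega> \<Longrightarrow> \<bar>\<phi> \<eta>\<bar> \<le> M"
    unfolding bounded_iff fr by auto
  show "(Perron_solution \<Omega> \<phi> \<longlongrightarrow> \<phi> \<zeta>) (tending_to \<Omega> \<zeta>)"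
  proof (rule tendstoI)
    fix e :: real assume e: "e > 0"
    define \<epsilon> where "\<epsilon> = e / 3"
    have \<epsilon>: "\<epsilon> > 0" using e by (simp add: \<epsilon>_def)
    have "openin (subtopology ext_plane (ext_frontier \<Omega>))
        {\<eta> \<in> topspace (subtopology ext_plane (ext_frontier \<Omega>)). \<phi> \<eta> \<in> ball (\<phi> \<zeta>) \<epsilon>}"
      by (rule openin_continuous_map_preimage[OF \<phi>]) simp
    then obtain S where S: "openin ext_plane S" 
      "{\<eta> \<in> topspace (subtopology ext_plane (ext_frontier \<Omega>)). \<phi> \<eta> \<in> ball (\<phi> \<zeta>) \<epsilon>} = S \<inter> ext_frontier \<Omega>"
      unfolding openin_subtopology by auto
    have top: "topspace (subtopology ext_plane (ext_frontier \<Omega>)) = ext_compl \<Omega>"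
      using fr by (auto simp: ext_compl_def)
    have "\<zeta> \<in> {\<eta> \<in> topspace (subtopology ext_plane (ext_frontier \<Omega>)). \<phi> \<eta> \<in> ball (\<phi> \<zeta>) \<epsilon>}"
      using \<zeta> \<epsilon> unfolding top by simp
    then have "\<zeta> \<in> S" unfolding S(2) by simp
    have near: "\<bar>\<phi> \<eta> - \<phi> \<zeta>\<bar> < \<epsilon>" if "\<eta> \<in> ext_compl \<Omega>" "\<eta> \<in> S" for \<eta>
    proof -
      have "\<eta> \<in> S \<inter> ext_frontier \<Omega>" using that fr by simp
      then show ?thesis unfolding S(2)[symmetric] by (simp add: dist_real_def abs_minus_commute)
    qed
    obtain \<delta> where \<delta>: "\<delta> > 0" "\<And>\<eta>. \<eta> \<in> ext_compl \<Omega> - S \<Longrightarrow> eventually (\<lambda>w. \<delta> \<le> b w) (tending_to \<Omega> \<eta>)"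
      using away[OF S(1) \<open>\<zeta> \<in> S\<close>] by blast
    have M0: "M \<ge> 0" using M[OF \<zeta>] by linarith
    define C where "C = 2 * M / \<delta>"
    have C: "C \<ge> 0" using M0 \<delta> by (simp add: C_def)
    have bound: "eventually (\<lambda>w. \<phi> \<eta> \<le> \<phi> \<zeta> + \<epsilon> + C * b w \<and> \<phi> \<zeta> - \<epsilon> - C * b w \<le> \<phi> \<eta>) (tending_to \<Omega> \<eta>)"
      if \<eta>: "\<eta> \<in> ext_compl \<Omega>" for \<eta>
    proof (cases "\<eta> \<in> S")
      case True
      show ?thesis using tending_to_in
      proof eventually_elim
        case (elim w)
        have "C * b w \<ge> 0" using C b0[OF elim] by simp
        then show ?case using near[OF \<eta> True] by linarith
      qed
    next
      case False
      have "eventually (\<lambda>w. \<delta> \<le> b w) (tending_to \<Omega> \<eta>)" using \<delta>(2) \<eta> False by blast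
      then show ?thesis
      proof eventually_elim
        case (elim w)
        have "2 * M = C * \<delta>" using \<delta>(1) by (simp add: C_def)
        also have "\<dots> \<le> C * b w" using elim C by (rule mult_left_mono)
        finally show ?case using M[OF \<eta>] M[OF \<zeta>] \<epsilon> by linarith
      qed
    qed
    have up_harm: "harmonic_on (\<lambda>w. \<phi> \<zeta> + \<epsilon> + C * b w) \<Omega>" 
      by (intro harmonic_on_add harmonic_on_const harmonic_on_cmult b)
    have low_harm: "harmonic_on (\<lambda>w. \<phi> \<zeta> - \<epsilon> - C * b w) \<Omega>" 
      by (intro harmonic_on_diff harmonic_on_const harmonic_on_cmult b)
    have low: "(\<lambda>w. \<phi> \<zeta> - \<epsilon> - C * b w) \<in> Perron_family \<Omega> \<phi>"
      unfolding Perron_family_def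
    proof (intro CollectI conjI ballI)
      show "subharmonic_on (\<lambda>w. \<phi> \<zeta> - \<epsilon> - C * b w) \<Omega>" by (rule harmonic_imp_subharmonic_on[OF low_harm])
      fix \<eta> assume "\<eta> \<in> ext_frontier \<Omega>"
      then have "\<eta> \<in> ext_compl \<Omega>" using fr by simp
      from bound[OF this] show "Limsup (tending_to \<Omega> \<eta>) (\<lambda>w. ereal (\<phi> \<zeta> - \<epsilon> - C * b w)) \<le> ereal (\<phi> \<eta>)"
        by (intro Limsup_bounded) (auto elim: eventually_mono)
    qed
    have up: "u w \<le> \<phi> \<zeta> + \<epsilon> + C * b w" if u: "u \<in> Perron_family \<Omega> \<phi>" and w: "w \<in> \<Omega>" for u w
    proof -
      have su: "submean_on u \<Omega>" using u \<Omega> by (simp add: Perron_family_def subharmonic_imp_submean_on)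
      have ev: "eventually (\<lambda>w. u w < \<phi> \<zeta> + \<epsilon> + C * b w + d) (tending_to \<Omega> \<eta>)" 
        if \<eta>: "\<eta> \<in> ext_compl \<Omega>" and d: "d > 0" for \<eta> d
      proof -
        have "Limsup (tending_to \<Omega> \<eta>) (\<lambda>w. ereal (u w)) \<le> ereal (\<phi> \<eta>)"
          using u \<eta> fr by (simp add: Perron_family_def)
        also have "\<dots> < ereal (\<phi> \<eta> + d)" using d by simp
        finally have "eventually (\<lambda>w. ereal (u w) < ereal (\<phi> \<eta> + d)) (tending_to \<Omega> \<eta>)"
          by (rule Limsup_lessD)
        then show ?thesis using bound[OF \<eta>] by eventually_elim auto
      qed
      show ?thesis
      proof (rule maximum_principle_compare[OF su harmonic_imp_submean_on[OF harmonic_on_uminus[OF up_harm] \<Omega>] _ _ w])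
        fix p and d :: real assume p: "p \<notin> \<Omega>" and d: "d > 0"
        then have "Some p \<in> ext_compl \<Omega>" by (auto simp: ext_compl_def)
        from ev[OF this d] show "eventually (\<lambda>w. u w < \<phi> \<zeta> + \<epsilon> + C * b w + d) (at p within \<Omega>)"
          by (simp add: tending_to_Some[OF p])
      next
        fix d :: real assume d: "d > 0"
        have "None \<in> ext_compl \<Omega>" by (auto simp: ext_compl_def)
        from ev[OF this d] show "eventually (\<lambda>w. w \<in> \<Omega> \<longrightarrow> u w < \<phi> \<zeta> + \<epsilon> + C * b w + d) at_infinity"
          by (simp add: tending_to_None eventually_inf_principal)
      qed
    qed
    have main: "\<bar>Perron_solution \<Omega> \<phi> w - \<phi> \<zeta>\<bar> \<le> \<epsilon> + C * b w" if w: "w \<in> \<Omega>" for w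
    proof -
      have "Perron_solution \<Omega> \<phi> w \<le> \<phi> \<zeta> + \<epsilon> + C * b w"
        unfolding Perron_solution_def using low up w by (intro cSUP_least) auto
      moreover have "\<phi> \<zeta> - \<epsilon> - C * b w \<le> Perron_solution \<Omega> \<phi> w"
        unfolding Perron_solution_def using up[OF _ w] by (intro cSUP_upper2[OF _ low]) (auto intro!: bdd_aboveI)
      ultimately show ?thesis by linarith
    qed
    have L: "((\<lambda>w. \<epsilon> + C * b w) \<longlongrightarrow> \<epsilon> + C * 0) (tending_to \<Omega> \<zeta>)" by (intro tendsto_intros lim)
    have "eventually (\<lambda>w. \<epsilon> + C * b w < e) (tending_to \<Omega> \<zeta>)"
      by (rule order_tendstoD(2)[OF L]) (use e in \<open>simp add: \<epsilon>_def\<close>)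
    then show "eventually (\<lambda>w. dist (Perron_solution \<Omega> \<phi> w) (\<phi> \<zeta>) < e) (tending_to \<Omega> \<zeta>)"
      using tending_to_in by eventually_elim (use main in \<open>force simp: dist_real_def\<close>)
  qed
qed

text \<open>
  The fourth root maps the plane slit along the nonpositive axis into the sector of arguments at most
  \<open>pi / 4\<close>, where the real part is comparable with the modulus. The real part of the square root would
  vanish along the slit.
\<close>

definition quarter_root :: "complex \<Rightarrow> real" where
  "quarter_root v = Re (exp (Ln v / 4))"

lemma quarter_root_bounds:
  assumes v: "v \<noteq> 0"
  shows "1/2 * norm v powr (1/4) \<le> quarter_root v" "quarter_root v \<le> norm v powr (1/4)"
proof -
  have n: "norm (exp (Ln v / 4)) = norm v powr (1/4)"
    using v by (simp add: norm_exp_eq_Re powr_def)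
  have "quarter_root v = norm v powr (1/4) * cos (Im (Ln v) / 4)"
    using n by (simp add: quarter_root_def Re_exp norm_exp_eq_Re)
  moreover have "1/2 \<le> cos (Im (Ln v) / 4)"
  proof -
    have "\<bar>Im (Ln v) / 4\<bar> \<le> pi / 3" using Im_Ln_le_pi[OF v] mpi_less_Im_Ln[OF v] by auto
    then have "cos (pi/3) \<le> cos \<bar>Im (Ln v) / 4\<bar>" by (intro cos_monotone_0_pi_le) auto
    then show ?thesis by (simp only: cos_abs_real cos_60)
  qed
  ultimately show "1/2 * norm v powr (1/4) \<le> quarter_root v"
    using mult_left_mono[of "1/2" "cos (Im (Ln v) / 4)" "norm v powr (1/4)"] by (simp add: mult.commute)
  show "quarter_root v \<le> norm v powr (1/4)"
    unfolding quarter_root_def n[symmetric] by (rule complex_Re_le_cmod)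
qed

lemma quarter_root_pos: "v \<noteq> 0 \<Longrightarrow> quarter_root v > 0"
  by (rule less_le_trans[OF _ quarter_root_bounds(1)]) auto

lemma harmonic_on_quarter_root:
  assumes "f holomorphic_on S" "open S" "\<And>w. w \<in> S \<Longrightarrow> f w \<notin> \<real>\<^sub>\<le>\<^sub>0"
  shows "harmonic_on (\<lambda>w. quarter_root (f w)) S"
  unfolding quarter_root_def using assms by (intro harmonic_on_Re holomorphic_intros) auto

text \<open>
  A Moebius map of the complement of the segment from \<open>c\<close> to \<open>c + d\<close> onto the plane slit
  along the nonpositive axis, sending \<open>c\<close> to \<open>0\<close>.
\<close>

definition slit_map :: "real \<Rightarrow> real \<Rightarrow> complex \<Rightarrow> complex" where
  "slit_map c d w = (w - of_real c) / (w - of_real (c + d))"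

lemma slit_map_not_nonpos:
  assumes d: "d \<noteq> 0" and w: "\<And>t. 0 \<le> t \<Longrightarrow> t \<le> 1 \<Longrightarrow> w \<noteq> of_real (c + d * t)"
  shows "slit_map c d w \<notin> \<real>\<^sub>\<le>\<^sub>0"
proof
  assume "slit_map c d w \<in> \<real>\<^sub>\<le>\<^sub>0"
  then obtain s where s: "slit_map c d w = of_real s" "s \<le> 0" by (auto elim: nonpos_Reals_cases)
  have "w - of_real (c + d) \<noteq> 0" using w[of 1] by simp
  then have "w - of_real c = of_real s * (w - of_real (c + d))"
    using s(1) by (simp add: slit_map_def field_simps)
  then have "of_real (1 - s) * w = of_real ((1 - s) * c - s * d)" by (simp add: algebra_simps)
  then have "w = of_real (((1 - s) * c - s * d) / (1 - s))"
  proof -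
    have "1 - s \<noteq> 0" using s(2) by simp
    then have "of_real (1 - s) \<noteq> (0::complex)" by (simp only: of_real_eq_0_iff not_False_eq_True)
    then have "w = of_real ((1 - s) * c - s * d) / of_real (1 - s)"
      using \<open>of_real (1 - s) * w = of_real ((1 - s) * c - s * d)\<close> by (metis nonzero_mult_div_cancel_left)
    then show ?thesis by (simp only: of_real_divide)
  qed
  also have "((1 - s) * c - s * d) / (1 - s) = c + d * ((- s) / (1 - s))" using s(2) by (simp add: field_simps)
  finally show False using w[of "(- s) / (1 - s)"] s(2) by (auto simp: field_simps)
qed

lemma slit_map_tendsto: "d \<noteq> 0 \<Longrightarrow> (slit_map c d \<longlongrightarrow> 0) (at (of_real c) within S)"
proof -
  assume d: "d \<noteq> 0"
  have "(slit_map c d \<longlongrightarrow> (of_real c - of_real c) / (of_real c - of_real (c + d))) (at (of_real c) within S)"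
    unfolding slit_map_def using d by (intro tendsto_intros) auto
  then show ?thesis by simp
qed

lemma slit_barrier_lower:
  assumes d: "d \<noteq> 0" and w: "w \<noteq> of_real (c + d)" and r: "r > 0" "r \<le> norm (w - of_real c)"
  shows "1/2 * (r / (r + \<bar>d\<bar>)) powr (1/4) \<le> quarter_root (slit_map c d w)"
proof -
  have nz: "slit_map c d w \<noteq> 0" using r w by (auto simp: slit_map_def)
  have "r / (r + \<bar>d\<bar>) \<le> norm (w - of_real c) / (norm (w - of_real c) + \<bar>d\<bar>)"
    using r mult_right_mono[OF r(2) abs_ge_zero[of d]] by (simp add: field_simps)
  also have "\<dots> \<le> norm (w - of_real c) / norm (w - of_real (c + d))"
    using norm_triangle_ineq4[of "w - of_real c" "of_real d"] w r
    by (intro divide_left_mono mult_pos_pos) (auto simp: algebra_simps)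
  also have "\<dots> = norm (slit_map c d w)" by (simp add: slit_map_def norm_divide)
  finally have "(r / (r + \<bar>d\<bar>)) powr (1/4) \<le> norm (slit_map c d w) powr (1/4)"
    using r by (intro powr_mono2) auto
  then show ?thesis using quarter_root_bounds(1)[OF nz] by linarith
qed

section \<open>The domain with gaps on the positive axis\<close>

lemma power4_bracket:
  assumes "1 \<le> (t::real)"
  obtains k where "4 ^ k \<le> t" "t < 4 ^ Suc k"
proof -
  define n where "n = (LEAST n. t < 4 ^ n)"
  have n: "t < 4 ^ n" unfolding n_def by (rule LeastI_ex[OF real_arch_pow]) simp
  then obtain k where k: "n = Suc k" using assms by (cases n) auto
  have "\<not> t < 4 ^ k" using not_less_Least[of k "\<lambda>n. t < 4 ^ n", folded n_def] k by simp
  then show ?thesis using that[of k] n k by simp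
qed

lemma power4_exceeds:
  obtains k where "N \<le> k" "(x::real) < 4 ^ k"
proof -
  obtain m where m: "x < 4 ^ m" using real_arch_pow[of 4 x] by auto
  have "(4::real) ^ m \<le> 4 ^ max m N" by (intro power_increasing) auto
  with m have "x < 4 ^ max m N" by (rule less_le_trans)
  then show ?thesis using that[of "max m N"] by simp
qed

text \<open>
  The gap \<open>j\<close> lies between \<open>7/4 * 4 ^ j\<close> and \<open>9/4 * 4 ^ j\<close>, whence the circles
  of radius \<open>4 ^ k\<close> keep a proportional distance from all gaps. Empty gaps are allowed.
\<close>

locale gap_sequence =
  fixes l :: "nat \<Rightarrow> real"
  assumes l_nonneg: "0 \<le> l j" and l_le: "l j \<le> 4 ^ j / 4"
    and not_summable: "\<not> summable (\<lambda>j. (l j / 4 ^ j)\<^sup>2)"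
begin

definition ctr :: "nat \<Rightarrow> real" where "ctr j = 2 * 4 ^ j"

definition gaps :: "real set" where "gaps = (\<Union>j. {ctr j - l j<..<ctr j + l j})"

definition dom :: "complex set" where "dom = {z. Im z \<noteq> 0 \<or> Re z \<in> gaps}"

lemma gap_bounds: "7/4 * 4 ^ j \<le> ctr j - l j" "ctr j + l j \<le> 9/4 * 4 ^ j"
  using l_le[of j] by (auto simp: ctr_def)

lemma gap_index_less:
  assumes "i < j" shows "ctr i + l i \<le> 9/16 * 4 ^ j"
proof -
  have "(4::real) ^ Suc i \<le> 4 ^ j" using assms by (intro power_increasing) auto
  then show ?thesis using gap_bounds(2)[of i] by simp
qed

lemma closed_gaps_disjoint:
  assumes "t \<in> {ctr i - l i..ctr i + l i}" "t \<in> {ctr j - l j..ctr j + l j}"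
  shows "i = j"
proof -
  have False if ij: "i < j" "s \<in> {ctr i - l i..ctr i + l i}" "s \<in> {ctr j - l j..ctr j + l j}" for i j s
  proof -
    have "s \<le> 9/16 * 4 ^ j" using ij(2) gap_index_less[OF ij(1)] by auto
    moreover have "7/4 * 4 ^ j \<le> s" using ij(3) gap_bounds(1)[of j] by auto
    moreover have "(4::real) ^ j > 0" by simp
    ultimately show False by linarith
  qed
  then show ?thesis using assms by (metis linorder_neqE_nat)
qed

lemma gap_pos: "t \<in> gaps \<Longrightarrow> 1 < t"
proof -
  assume "t \<in> gaps"
  then obtain j where "ctr j - l j < t" by (auto simp: gaps_def)
  moreover have "(1::real) \<le> 4 ^ j" by simp
  ultimately show ?thesis using gap_bounds(1)[of j] by linarith
qed

lemma gap_near: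
  assumes "t \<in> gaps" "9/16 * 4 ^ k \<le> t" "t \<le> 7 * 4 ^ k"
  shows "t \<in> {ctr k - l k<..<ctr k + l k}"
proof -
  obtain i where i: "ctr i - l i < t" "t < ctr i + l i" using assms(1) by (auto simp: gaps_def)
  have "\<not> i < k" using gap_index_less[of i k] i assms(2) by auto
  moreover have "\<not> k < i"
  proof
    assume "k < i"
    then have "(4::real) ^ Suc k \<le> 4 ^ i" by (intro power_increasing) auto
    then show False using gap_bounds(1)[of i] i(1) assms(3) by simp
  qed
  ultimately have "i = k" by simp
  then show ?thesis using i by simp
qed

lemma ball_gap: "Im z = 0 \<Longrightarrow> z \<in> ball (of_real (ctr j)) (l j) \<longleftrightarrow> Re z \<in> {ctr j - l j<..<ctr j + l j}"
proof -
  assume "Im z = 0"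
  then have "z = of_real (Re z)" by (simp add: complex_eq_iff)
  then have "dist (of_real (ctr j)) z = \<bar>ctr j - Re z\<bar>" by (metis dist_of_real dist_real_def)
  then show ?thesis by (auto simp: abs_less_iff)
qed

lemma dom_eq: "dom = {z. Im z \<noteq> 0} \<union> (\<Union>j. ball (of_real (ctr j)) (l j))"
  using ball_gap by (auto simp: dom_def gaps_def)

lemma open_dom: "open dom"
proof -
  have "open {z::complex. Im z \<noteq> 0}" by (intro open_Collect_neq continuous_intros)
  then show ?thesis unfolding dom_eq by auto
qed

lemma upper_subset_dom: "upper \<subseteq> dom" by (auto simp: dom_def)

lemma ball_subset_dom: "ball (of_real (ctr j)) (l j) \<subseteq> dom" unfolding dom_eq by blast

lemma cnj_dom: "cnj ` dom = dom"
proof -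
  have "cnj z \<in> dom" if "z \<in> dom" for z using that by (simp add: dom_def)
  then show ?thesis by (auto intro: image_eqI[of _ _ "cnj z" for z])
qed

lemma not_in_dom: "z \<notin> dom \<longleftrightarrow> (\<exists>t. z = of_real t \<and> t \<notin> gaps)"
  by (auto simp: dom_def complex_eq_iff intro!: exI[of _ "Re z"])

lemma nonpos_not_dom: "w \<in> dom \<Longrightarrow> w \<notin> \<real>\<^sub>\<le>\<^sub>0"
  using gap_pos by (force simp: dom_def complex_nonpos_Reals_iff)

text \<open>
  Every finite boundary point is an endpoint of a nondegenerate segment in the boundary: only the gap \<open>k\<close>
  can meet a neighbourhood of the range from \<open>4 ^ k\<close> to \<open>4 ^ Suc k\<close>, and the point lies on
  one side of it.
\<close>

lemma side_segment:
  assumes t: "t \<notin> gaps"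
  obtains d where "d \<noteq> 0" "\<And>s. 0 \<le> s \<Longrightarrow> s \<le> 1 \<Longrightarrow> t + d * s \<notin> gaps"
proof (cases "t < 1")
  case True
  have "t + (-1) * s \<notin> gaps" if "0 \<le> s" for s :: real using gap_pos[of "t - s"] True that by auto
  then show ?thesis using that[of "-1"] by auto
next
  case False
  then have "1 \<le> t" by simp
  then obtain k where "4 ^ k \<le> t" "t < 4 ^ Suc k" by (rule power4_bracket)
  then have kt: "4 ^ k \<le> t" "t < 4 * 4 ^ k" by simp_all
  have p: "(4::real) ^ k > 0" by simp
  show ?thesis
  proof (cases "t \<le> ctr k - l k")
    case True
    have "t + (- (4 ^ k / 4)) * u \<notin> gaps" if u: "0 \<le> u" "u \<le> 1" for u :: real
    proof
      assume g: "t + (- (4 ^ k / 4)) * u \<in> gaps"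
      define v where "v = 4 ^ k / 4 * u"
      have v: "0 \<le> v" "v \<le> 4 ^ k / 4" using u p mult_left_mono[OF u(2), of "4 ^ k / 4"] by (auto simp: v_def)
      have g': "t - v \<in> gaps" using g by (simp add: v_def)
      have "9/16 * 4 ^ k \<le> t - v" "t - v \<le> 7 * 4 ^ k" using v kt p by linarith+
      from gap_near[OF g' this] show False using v True by simp
    qed
    then show ?thesis using that[of "- (4 ^ k / 4)"] p by auto
  next
    case False
    have "t \<notin> {ctr k - l k<..<ctr k + l k}" using t unfolding gaps_def by blast
    then have F: "t \<ge> ctr k + l k" using False by simp
    have "t + (4 ^ k / 4) * u \<notin> gaps" if u: "0 \<le> u" "u \<le> 1" for u :: real
    proof
      assume g: "t + (4 ^ k / 4) * u \<in> gaps"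
      define v where "v = 4 ^ k / 4 * u"
      have v: "0 \<le> v" "v \<le> 4 ^ k / 4" using u p mult_left_mono[OF u(2), of "4 ^ k / 4"] by (auto simp: v_def)
      have g': "t + v \<in> gaps" using g by (simp add: v_def)
      have "9/16 * 4 ^ k \<le> t + v" "t + v \<le> 7 * 4 ^ k" using v kt p by linarith+
      from gap_near[OF g' this] show False using v F by simp
    qed
    then show ?thesis using that[of "4 ^ k / 4"] p by auto
  qed
qed

text \<open>
  The last property, a linear lower bound near the point, is what dominates \<open>\<bar>Im w\<bar>\<close> by a
  multiple of the barrier.
\<close>

lemma finite_barrier:
  assumes t: "t \<notin> gaps"
  obtains b where "harmonic_on b dom" "\<And>w. w \<in> dom \<Longrightarrow> b w > 0" "(b \<longlongrightarrow> 0) (at (of_real t) within dom)"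
    "\<And>r. r > 0 \<Longrightarrow> \<exists>\<delta>>0. \<forall>w\<in>dom. r \<le> norm (w - of_real t) \<longrightarrow> \<delta> \<le> b w"
    "\<exists>c>0. \<forall>w\<in>dom. norm (w - of_real t) \<le> 1 \<longrightarrow> c * norm (w - of_real t) \<le> b w"
proof -
  obtain d where d: "d \<noteq> 0" "\<And>s. 0 \<le> s \<Longrightarrow> s \<le> 1 \<Longrightarrow> t + d * s \<notin> gaps"
    using side_segment[OF t] by blast
  have ne: "w \<noteq> of_real (t + d * s)" if "w \<in> dom" "0 \<le> s" "s \<le> 1" for w s
    using that d(2) by (auto simp: dom_def)
  have ne0: "w \<noteq> of_real t" "w \<noteq> of_real (t + d)" if "w \<in> dom" for w using ne[OF that, of 0] ne[OF that, of 1] by auto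
  define b where "b w = quarter_root (slit_map t d w)" for w
  have nz: "slit_map t d w \<noteq> 0" if "w \<in> dom" for w using ne0[OF that] by (auto simp: slit_map_def)
  have "harmonic_on b dom"
    unfolding b_def
  proof (rule harmonic_on_quarter_root[OF _ open_dom])
    show "slit_map t d holomorphic_on dom"
      unfolding slit_map_def using ne0 by (auto intro!: holomorphic_intros)
    show "slit_map t d w \<notin> \<real>\<^sub>\<le>\<^sub>0" if "w \<in> dom" for w
      by (rule slit_map_not_nonpos[OF d(1)]) (use ne that in blast)
  qed
  moreover have bp: "b w > 0" if "w \<in> dom" for w unfolding b_def by (rule quarter_root_pos[OF nz[OF that]])
  moreover have "(b \<longlongrightarrow> 0) (at (of_real t) within dom)"
  proof (rule tendsto_sandwich[of "\<lambda>_. 0" _ _ "\<lambda>w. norm (slit_map t d w) powr (1/4)"])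
    have dm: "eventually (\<lambda>w. w \<in> dom) (at (of_real t) within dom)" by (simp add: eventually_at_filter)
    show "eventually (\<lambda>w. 0 \<le> b w) (at (of_real t) within dom)"
      using dm by eventually_elim (use bp in force)
    show "eventually (\<lambda>w. b w \<le> norm (slit_map t d w) powr (1/4)) (at (of_real t) within dom)"
      using dm by eventually_elim (unfold b_def, rule quarter_root_bounds(2)[OF nz])
    have "((\<lambda>w. norm (slit_map t d w)) \<longlongrightarrow> 0) (at (of_real t) within dom)"
      using tendsto_norm[OF slit_map_tendsto[OF d(1)]] by simp
    then show "((\<lambda>w. norm (slit_map t d w) powr (1/4)) \<longlongrightarrow> 0) (at (of_real t) within dom)"
      using tendsto_powr'[of "\<lambda>w. norm (slit_map t d w)" 0 _ "\<lambda>_. 1/4" "1/4"] by simp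
  qed simp
  moreover have "\<exists>\<delta>>0. \<forall>w\<in>dom. r \<le> norm (w - of_real t) \<longrightarrow> \<delta> \<le> b w" if "r > 0" for r
    unfolding b_def using slit_barrier_lower[OF d(1) ne0(2) that] that
    by (intro exI[of _ "1/2 * (r / (r + \<bar>d\<bar>)) powr (1/4)"]) auto
  moreover have "\<exists>c>0. \<forall>w\<in>dom. norm (w - of_real t) \<le> 1 \<longrightarrow> c * norm (w - of_real t) \<le> b w"
  proof (intro exI[of _ "1/2 * (1 / (1 + \<bar>d\<bar>))"] conjI ballI impI)
    show "0 < 1/2 * (1 / (1 + \<bar>d\<bar>))" by (simp add: add_pos_nonneg)
    fix w assume w: "w \<in> dom" "norm (w - of_real t) \<le> 1"
    define r where "r = norm (w - of_real t)"
    have r: "0 < r" "r \<le> 1" using ne0[OF w(1)] w(2) by (auto simp: r_def)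
    have "r / (1 + \<bar>d\<bar>) \<le> r / (r + \<bar>d\<bar>)" using r d by (intro divide_left_mono mult_pos_pos) auto
    also have "\<dots> = (r / (r + \<bar>d\<bar>)) powr 1" using r by (simp add: powr_one)
    also have "\<dots> \<le> (r / (r + \<bar>d\<bar>)) powr (1/4)" using r by (intro powr_mono') (auto simp: field_simps)
    finally have 1: "r / (1 + \<bar>d\<bar>) \<le> (r / (r + \<bar>d\<bar>)) powr (1/4)" .
    have "1/2 * (1 / (1 + \<bar>d\<bar>)) * r = 1/2 * (r / (1 + \<bar>d\<bar>))" by simp
    also have "\<dots> \<le> 1/2 * (r / (r + \<bar>d\<bar>)) powr (1/4)" using 1 by (intro mult_left_mono) auto
    also have "\<dots> \<le> b w" unfolding b_def
      by (rule slit_barrier_lower[OF d(1) ne0(2)[OF w(1)] r(1)]) (simp add: r_def)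
    finally show "1/2 * (1 / (1 + \<bar>d\<bar>)) * norm (w - of_real t) \<le> b w" unfolding r_def .
  qed
  ultimately show ?thesis using that by blast
qed

lemma ext_frontier_dom: "ext_frontier dom = ext_compl dom"
proof -
  have "openin ext_plane (Some ` dom)"
    using open_dom unfolding openin_Alexandroff_compactification by auto
  moreover have "ext_plane closure_of (Some ` dom) = topspace ext_plane"
  proof (intro antisym closure_of_subset_topspace subsetI)
    fix \<eta> assume top: "\<eta> \<in> topspace ext_plane"
    show "\<eta> \<in> ext_plane closure_of (Some ` dom)"
      unfolding in_closure_of
    proof (intro conjI top allI impI)
      fix T assume T: "\<eta> \<in> T \<and> openin ext_plane T"
      show "\<exists>y. y \<in> Some ` dom \<and> y \<in> T"
      proof (cases \<eta>)
        case None
        then obtain B where "\<And>z. norm z \<ge> B \<Longrightarrow> Some z \<in> T" using ext_plane_nbhd_None T by metis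
        then have "Some (\<i> * of_real (\<bar>B\<bar> + 1)) \<in> T" by (simp add: norm_mult)
        moreover have "\<bar>B\<bar> + 1 \<noteq> 0" by linarith
        then have "\<i> * of_real (\<bar>B\<bar> + 1) \<in> dom" by (simp add: dom_def)
        ultimately show ?thesis by blast
      next
        case (Some a)
        then obtain r where r: "r > 0" "\<And>z. z \<in> ball a r \<Longrightarrow> Some z \<in> T" using ext_plane_nbhd_Some T by metis
        show ?thesis
        proof (cases "Im a = 0")
          case True
          have "a + \<i> * of_real (r/2) \<in> ball a r" "a + \<i> * of_real (r/2) \<in> dom"
            using r(1) True by (auto simp: dist_norm norm_mult dom_def)
          then show ?thesis using r(2) by blast
        next
          case False
          then have "a \<in> dom" by (simp add: dom_def)
          then show ?thesis using Some T by blast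
        qed
      qed
    qed
  qed
  ultimately show ?thesis
    by (simp add: ext_frontier_def frontier_of_def ext_compl_def interior_of_openin)
qed

lemma dom_regular:
  assumes \<zeta>: "\<zeta> \<in> ext_compl dom"
  shows "Dirichlet_regular dom \<zeta>"
proof (cases \<zeta>)
  case (Some a)
  then have a: "a \<notin> dom" using \<zeta> by (auto simp: ext_compl_def)
  then obtain t where t: "a = of_real t" "t \<notin> gaps" using not_in_dom by blast
  obtain b where b: "harmonic_on b dom" "\<And>w. w \<in> dom \<Longrightarrow> b w > 0" "(b \<longlongrightarrow> 0) (at a within dom)"
    "\<And>r. r > 0 \<Longrightarrow> \<exists>\<delta>>0. \<forall>w\<in>dom. r \<le> norm (w - a) \<longrightarrow> \<delta> \<le> b w"
    using finite_barrier[OF t(2)] unfolding t(1) by metis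
  show ?thesis
  proof (rule Dirichlet_regular_of_barrier[OF open_dom ext_frontier_dom \<zeta> b(1)])
    show "(b \<longlongrightarrow> 0) (tending_to dom \<zeta>)" using b(3) a by (simp add: Some tending_to_Some)
    show "0 \<le> b w" if "w \<in> dom" for w using b(2)[OF that] by simp
    fix S assume S: "openin ext_plane S" "\<zeta> \<in> S"
    then obtain r where r: "r > 0" "\<And>z. z \<in> ball a r \<Longrightarrow> Some z \<in> S" using ext_plane_nbhd_Some Some by metis
    obtain \<delta> where \<delta>: "\<delta> > 0" "\<And>w. w \<in> dom \<Longrightarrow> r/2 \<le> norm (w - a) \<Longrightarrow> \<delta> \<le> b w"
      using b(4)[of "r/2"] r by auto
    show "\<exists>\<delta>>0. \<forall>\<eta>\<in>ext_compl dom - S. eventually (\<lambda>w. \<delta> \<le> b w) (tending_to dom \<eta>)"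
    proof (intro exI[of _ \<delta>] conjI ballI \<delta>(1))
      fix \<eta> assume \<eta>: "\<eta> \<in> ext_compl dom - S"
      show "eventually (\<lambda>w. \<delta> \<le> b w) (tending_to dom \<eta>)"
      proof (cases \<eta>)
        case None
        have "eventually (\<lambda>w. norm w \<ge> norm a + r) at_infinity" by (auto simp: eventually_at_infinity)
        then show ?thesis unfolding None tending_to_None eventually_inf_principal
        proof eventually_elim
          case (elim w)
          then show ?case using \<delta>(2)[of w] norm_triangle_ineq2[of w a] r(1) by auto
        qed
      next
        case (Some c)
        then have c: "c \<notin> dom" "c \<notin> ball a r" using \<eta> r(2) by (auto simp: ext_compl_def)
        have "eventually (\<lambda>w. w \<in> dom \<and> dist w c < r/2) (at c within dom)"
          using r(1) by (auto simp: eventually_at intro!: exI[of _ "r/2"])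
        then show ?thesis unfolding Some tending_to_Some[OF c(1)]
        proof eventually_elim
          case (elim w)
          have "r \<le> dist a c" using c(2) by auto
          also have "\<dots> \<le> dist w a + dist w c" by (metis dist_commute dist_triangle2 add.commute)
          finally show ?case using elim \<delta>(2)[of w] by (simp add: dist_norm)
        qed
      qed
    qed
  qed
next
  case None
  define b where "b w = quarter_root (1 / w)" for w
  have nz: "w \<noteq> 0" "1 / w \<notin> \<real>\<^sub>\<le>\<^sub>0" if "w \<in> dom" for w
  proof -
    have w: "w \<notin> \<real>\<^sub>\<le>\<^sub>0" by (rule nonpos_not_dom[OF that])
    then show "w \<noteq> 0" by auto
    show "1 / w \<notin> \<real>\<^sub>\<le>\<^sub>0"
    proof
      assume "1 / w \<in> \<real>\<^sub>\<le>\<^sub>0"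
      then obtain s where "1 / w = of_real s" "s \<le> 0" by (auto elim: nonpos_Reals_cases)
      then have "w = of_real (1 / s)" by (metis div_by_1 divide_divide_eq_right mult_1 of_real_1 of_real_divide)
      then show False using w \<open>s \<le> 0\<close> by (auto simp: divide_nonpos_nonpos simp del: of_real_divide)
    qed
  qed
  show ?thesis
  proof (rule Dirichlet_regular_of_barrier[OF open_dom ext_frontier_dom \<zeta>])
    show "harmonic_on b dom" unfolding b_def
      by (rule harmonic_on_quarter_root[OF _ open_dom]) (use nz in \<open>auto intro!: holomorphic_intros\<close>)
    have bp: "b w > 0" if "w \<in> dom" for w unfolding b_def using nz[OF that] by (intro quarter_root_pos) auto
    then show "0 \<le> b w" if "w \<in> dom" for w using that by force
    have l0: "((\<lambda>w::complex. norm (1 / w) powr (1/4)) \<longlongrightarrow> 0) (inf at_infinity (principal dom))"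
    proof -
      have "((\<lambda>w::complex. norm (1 / w)) \<longlongrightarrow> 0) at_infinity"
        using tendsto_norm[OF tendsto_inverse_0] by (simp add: inverse_eq_divide)
      then have "((\<lambda>w::complex. norm (1 / w)) \<longlongrightarrow> 0) (inf at_infinity (principal dom))"
        by (rule tendsto_mono[rotated]) simp
      then show ?thesis
        using tendsto_powr'[of "\<lambda>w::complex. norm (1/w)" 0 _ "\<lambda>_. 1/4" "1/4"] by simp
    qed
    have dm: "eventually (\<lambda>w. w \<in> dom) (inf at_infinity (principal dom))" by (simp add: eventually_inf_principal)
    show "(b \<longlongrightarrow> 0) (tending_to dom \<zeta>)"
      unfolding None tending_to_None
    proof (rule tendsto_sandwich[OF _ _ tendsto_const l0])
      show "eventually (\<lambda>w. 0 \<le> b w) (inf at_infinity (principal dom))"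
        using dm by eventually_elim (use bp in force)
      show "eventually (\<lambda>w. b w \<le> norm (1 / w) powr (1/4)) (inf at_infinity (principal dom))"
        using dm by eventually_elim (unfold b_def, rule quarter_root_bounds(2), use nz in auto)
    qed
    fix S assume S: "openin ext_plane S" "\<zeta> \<in> S"
    then obtain B where B: "\<And>z. norm z \<ge> B \<Longrightarrow> Some z \<in> S" using ext_plane_nbhd_None None by metis
    define \<delta> where "\<delta> = 1/2 * (1 / (\<bar>B\<bar> + 1)) powr (1/4)"
    have \<delta>: "\<delta> > 0" by (simp add: \<delta>_def add_nonneg_eq_0_iff)
    show "\<exists>\<delta>>0. \<forall>\<eta>\<in>ext_compl dom - S. eventually (\<lambda>w. \<delta> \<le> b w) (tending_to dom \<eta>)"
    proof (intro exI[of _ \<delta>] conjI ballI \<delta>)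
      fix \<eta> assume \<eta>: "\<eta> \<in> ext_compl dom - S"
      then obtain c where c: "\<eta> = Some c" using S None by (cases \<eta>) auto
      then have c1: "c \<notin> dom" "norm c < B" using \<eta> B by (auto simp: ext_compl_def not_le[symmetric])
      have "eventually (\<lambda>w. w \<in> dom \<and> dist w c < 1) (at c within dom)"
        by (auto simp: eventually_at intro!: exI[of _ 1])
      then show "eventually (\<lambda>w. \<delta> \<le> b w) (tending_to dom \<eta>)"
        unfolding c tending_to_Some[OF c1(1)]
      proof eventually_elim
        case (elim w)
        have "norm w \<le> \<bar>B\<bar> + 1" using norm_triangle_ineq2[of w c] conjunct2[OF elim] c1(2) unfolding dist_norm by linarith
        then have "1 / (\<bar>B\<bar> + 1) \<le> norm (1 / w)"
          using nz(1)[of w] elim by (simp add: norm_divide divide_left_mono)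
        then have "(1 / (\<bar>B\<bar> + 1)) powr (1/4) \<le> norm (1 / w) powr (1/4)"
          by (intro powr_mono2) auto
        then show ?case using quarter_root_bounds(1)[of "1/w"] nz(1)[of w] elim by (simp add: \<delta>_def b_def)
      qed
    qed
  qed
qed

text \<open>
  The centre of a nonempty gap together with the nonreal points of \<open>D\<close> forms a starlike set, and this set
  is dense in the slice.
\<close>

lemma connected_slice:
  assumes D: "convex D" "open D" and j: "l j > 0" "of_real (ctr j) \<in> D"
  shows "connected (dom \<inter> D)"
proof (rule connected_intermediate_closure)
  let ?x = "complex_of_real (ctr j)"
  let ?S = "insert ?x {p\<in>D. Im p \<noteq> 0}"
  have "starlike ?S"
    unfolding starlike_def
  proof (intro bexI[of _ ?x] ballI subsetI)
    fix p q assume p: "p \<in> ?S" and q: "q \<in> closed_segment ?x p"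
    have "p \<in> D" using p j by auto
    then have qD: "q \<in> D" using q j(2) D(1) convex_contains_segment by blast
    obtain u where u: "0 \<le> u" "u \<le> 1" "q = (1 - u) *\<^sub>R ?x + u *\<^sub>R p" using q by (auto simp: closed_segment_def)
    show "q \<in> ?S"
    proof (cases "p = ?x \<or> u = 0")
      case True
      then have "q = ?x" using u(3) by (auto simp: scaleR_left_diff_distrib)
      then show ?thesis by simp
    next
      case False
      then show ?thesis using u p qD by (auto simp: scaleR_conv_of_real)
    qed
  qed auto
  then show "connected ?S" by (rule starlike_imp_connected)
  have "ctr j \<in> gaps" using j(1) unfolding gaps_def by (intro UN_I[of j]) auto
  then show "?S \<subseteq> dom \<inter> D" using j(2) by (auto simp: dom_def)
  show "dom \<inter> D \<subseteq> closure ?S"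
  proof
    fix p assume p: "p \<in> dom \<inter> D"
    show "p \<in> closure ?S"
      unfolding closure_approachable
    proof (intro allI impI)
      fix e :: real assume e: "e > 0"
      obtain r where r: "r > 0" "ball p r \<subseteq> D" using p D(2) open_contains_ball by blast
      show "\<exists>y\<in>?S. dist y p < e"
      proof (cases "Im p = 0")
        case True
        define y where "y = p + \<i> * of_real (min e r / 2)"
        have "dist y p = min e r / 2" using e r by (simp add: y_def dist_norm norm_mult)
        moreover have "min e r / 2 < e" "min e r / 2 < r" using e r(1) by linarith+
        ultimately have "dist y p < e" "y \<in> ball p r" by (simp_all add: dist_commute)
        moreover have "Im y \<noteq> 0" using True e r by (simp add: y_def)
        ultimately show ?thesis using r by blast
      next
        case False
        then show ?thesis using p e by (intro bexI[of _ p]) auto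
      qed
    qed
  qed
qed

definition j0 :: nat where "j0 = (SOME j. l j > 0)"
definition z0 :: complex where "z0 = of_real (ctr j0)"

lemma l_j0: "l j0 > 0"
proof -
  have "\<exists>j. l j > 0"
  proof (rule ccontr)
    assume "\<not> (\<exists>j. l j > 0)"
    then have "l j = 0" for j using l_nonneg[of j] by (metis less_eq_real_def)
    then show False using not_summable by simp
  qed
  then show ?thesis unfolding j0_def by (rule someI_ex)
qed

lemma z0_dom: "z0 \<in> dom" "ball z0 (l j0) \<subseteq> dom"
  using ball_subset_dom[of j0] l_j0 by (auto simp: z0_def)

lemma connected_dom: "connected dom"
  using connected_slice[of UNIV j0] l_j0 by auto

end

lemma submean_on_cong:
  assumes u: "submean_on u S" and eq: "\<And>z. z \<in> S \<Longrightarrow> u z = v z"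
  shows "submean_on v S"
  unfolding submean_on_def
proof (intro conjI ballI)
  show "continuous_on S v" using u eq continuous_on_cong unfolding submean_on_def by blast
  fix a assume a: "a \<in> S"
  obtain d where d: "d > 0" "\<And>r. 0 < r \<Longrightarrow> r < d \<Longrightarrow> cball a r \<subseteq> S \<and> u a \<le> circ_mean u a r"
    using u a unfolding submean_on_def by metis
  have "cball a r \<subseteq> S \<and> v a \<le> circ_mean v a r" if r: "0 < r" "r < d" for r
  proof -
    have S: "cball a r \<subseteq> S" using d(2)[OF r] by simp
    have "circ_mean u a r = circ_mean v a r" using r S by (intro circ_mean_cong eq) auto
    then show ?thesis using d(2)[OF r] eq[OF a] by simp
  qed
  then show "\<exists>d>0. \<forall>r. 0 < r \<and> r < d \<longrightarrow> cball a r \<subseteq> S \<and> v a \<le> circ_mean v a r" using d(1) by blast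
qed

lemma harmonic_on_ln_norm: "harmonic_on (\<lambda>w. ln (norm (w - z))) (- {z})"
proof (rule harmonic_on_locally)
  fix p assume p: "p \<in> - {z}"
  define r where "r = norm (p - z)"
  have r: "r > 0" using p by (auto simp: r_def)
  have pos: "Re ((w - z) / (p - z)) > 0" if w: "w \<in> ball p r" for w
  proof -
    have "(w - z) / (p - z) = 1 + (w - p) / (p - z)" using r by (simp add: r_def field_simps)
    moreover have "norm ((w - p) / (p - z)) < 1" using w r by (simp add: r_def norm_divide dist_norm norm_minus_commute)
    ultimately show ?thesis using abs_Re_le_cmod[of "(w - p) / (p - z)"] by simp
  qed
  have "harmonic_on (\<lambda>w. Re (Ln ((w - z) / (p - z)) + of_real (ln r))) (ball p r)"
  proof (rule harmonic_on_Re[OF _ open_ball], intro holomorphic_intros)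
    show "(w - z) / (p - z) \<notin> \<real>\<^sub>\<le>\<^sub>0" if "w \<in> ball p r" for w
      using pos[OF that] by (simp add: complex_nonpos_Reals_iff del: Re_divide)
  qed (use r in \<open>auto simp: r_def\<close>)
  then have "harmonic_on (\<lambda>w. ln (norm (w - z))) (ball p r)"
  proof (rule harmonic_on_cong[OF _ open_ball])
    fix w assume w: "w \<in> ball p r"
    have nz: "(w - z) / (p - z) \<noteq> 0" using pos[OF w] by force
    then have wz: "norm (w - z) > 0" by auto
    show "Re (Ln ((w - z) / (p - z)) + of_real (ln r)) = ln (norm (w - z))"
      using nz wz r by (simp add: norm_divide ln_div r_def del: divide_eq_0_iff)
  qed
  then show "\<exists>T. open T \<and> p \<in> T \<and> harmonic_on (\<lambda>w. ln (norm (w - z))) T"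
    using r by (intro exI[of _ "ball p r"]) auto
qed

section \<open>Lower bounds from the gaps and the Green function\<close>

context gap_sequence
begin

lemma large_gap_sum:
  obtains J where "finite J" "\<And>j. j \<in> J \<Longrightarrow> l j > 0 \<and> j \<noteq> k" "C < (\<Sum>j\<in>J. (l j / 4 ^ j)\<^sup>2)"
proof -
  let ?f = "\<lambda>j. (l j / 4 ^ j)\<^sup>2"
  have "\<exists>N. C + ?f k < sum ?f {..<N}"
  proof (rule ccontr)
    assume "\<nexists>N. C + ?f k < sum ?f {..<N}"
    then have "sum ?f {..<N} \<le> C + ?f k" for N by (meson not_less)
    then have "summable ?f" by (intro summableI_nonneg_bounded) auto
    then show False using not_summable by simp
  qed
  then obtain N where N: "C + ?f k < sum ?f {..<N}" by blast
  define J where "J = {j \<in> {..<N}. l j > 0 \<and> j \<noteq> k}"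
  have fJ: "finite J" by (simp add: J_def)
  have "sum ?f {..<N} \<le> sum ?f (insert k {..<N})" by (intro sum_mono2) auto
  also have "\<dots> = sum ?f (insert k J)"
  proof (rule sum.mono_neutral_right)
    show "\<forall>i\<in>insert k {..<N} - insert k J. ?f i = 0"
    proof
      fix i assume "i \<in> insert k {..<N} - insert k J"
      then have "\<not> l i > 0" by (auto simp: J_def)
      then have "l i = 0" using l_nonneg[of i] by simp
      then show "?f i = 0" by simp
    qed
  qed (auto simp: J_def)
  also have "\<dots> = ?f k + sum ?f J" using fJ by (simp add: J_def)
  finally have "C < sum ?f J" using N by simp
  then show ?thesis using that[OF fJ] by (simp add: J_def)
qed

text \<open>
  On the middle quarter of a gap the half disc bound applies with radius \<open>l j / 2\<close>, and these values are
  carried into the half plane by harmonic measure.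
\<close>

lemma gap_minorant:
  assumes J: "finite J" "\<And>j. j \<in> J \<Longrightarrow> l j > 0" and c: "\<And>j. j \<in> J \<Longrightarrow> c j \<ge> 0"
    and hb: "\<And>j. j \<in> J \<Longrightarrow> harmonic_on h (ball (of_real (ctr j)) (l j))"
    and hu: "harmonic_on h upper" and nu: "\<And>w. w \<in> upper \<Longrightarrow> h w \<ge> 0"
    and nb: "\<And>j w. j \<in> J \<Longrightarrow> w \<in> ball (of_real (ctr j)) (l j) \<Longrightarrow> h w \<ge> 0"
    and lb: "\<And>j w. j \<in> J \<Longrightarrow> w \<in> ball (of_real (ctr j)) (l j) \<Longrightarrow> Im w > 0 \<Longrightarrow> c j * Im w \<le> h w"
    and w: "w \<in> upper"
  shows "(\<Sum>j\<in>J. c j * l j / 8 * ang (ctr j - l j / 4) (ctr j + l j / 4) w / pi) \<le> h w"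
proof (rule half_plane_minorant[OF J(1) _ _ _ hu nu _ w])
  show "ctr j - l j / 4 < ctr j + l j / 4" if "j \<in> J" for j using J(2)[OF that] by simp
  show "0 \<le> c j * l j / 8" if "j \<in> J" for j using c[OF that] l_nonneg[of j] by simp
  show "i = j" if "i \<in> J" "j \<in> J" "x \<in> {ctr i - l i / 4..ctr i + l i / 4}" "x \<in> {ctr j - l j / 4..ctr j + l j / 4}" for i j x
    by (rule closed_gaps_disjoint[of x]) (use that l_nonneg[of i] l_nonneg[of j] in auto)
  fix j x and e :: real assume j: "j \<in> J" and x: "x \<in> {ctr j - l j / 4..ctr j + l j / 4}" and e: "e > 0"
  have lj: "l j > 0" by (rule J(2)[OF j])
  have sub: "ball (complex_of_real x) (3/4 * l j) \<subseteq> ball (of_real (ctr j)) (l j)"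
  proof
    fix v assume "v \<in> ball (complex_of_real x) (3/4 * l j)"
    moreover have "\<bar>ctr j - x\<bar> \<le> l j / 4" using x unfolding atLeastAtMost_iff by arith
    then have "dist (of_real (ctr j)) (complex_of_real x) \<le> l j / 4"
      by (simp add: dist_real_def)
    ultimately show "v \<in> ball (of_real (ctr j)) (l j)"
      using dist_triangle[of "of_real (ctr j)" v "of_real x"] by simp
  qed
  have hx: "harmonic_on h (ball (of_real x) (3/4 * l j))" by (rule harmonic_on_subset[OF hb[OF j] sub])
  have "c j * (l j / 2) / 4 \<le> h (of_real x)"
  proof (rule half_disc_lower_bound[OF hx])
    fix v assume "v \<in> sphere (complex_of_real x) (l j / 2)"
    then have "v \<in> ball (complex_of_real x) (3/4 * l j)" using lj by simp
    then have v: "v \<in> ball (of_real (ctr j)) (l j)" using sub by blast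
    show "h v \<ge> 0" by (rule nb[OF j v])
    show "c j * Im v \<le> h v" if "Im v > 0" by (rule lb[OF j v that])
  qed (use lj c j in auto)
  moreover have "isCont h (of_real x)"
    using harmonic_on_imp_continuous_on[OF hx] lj by (simp add: continuous_on_eq_continuous_at)
  then have "(h \<longlongrightarrow> h (of_real x)) (at (of_real x) within upper)"
    by (meson continuous_at_imp_continuous_at_within continuous_within)
  then have "eventually (\<lambda>w. h (of_real x) - e < h w) (at (of_real x) within upper)"
    by (rule order_tendstoD(1)) (use e in simp)
  ultimately show "eventually (\<lambda>w. c j * l j / 8 - e < h w) (at (of_real x) within upper)"
    by (auto elim!: eventually_mono)
qed

text \<open>
  A function \<open>h\<close> is a candidate exactly if \<open>h w + ln (norm (w - z0))\<close> extends to a harmonic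
  majorant of the logarithm. Truncating the logarithm from below on a small disc does not change its harmonic
  majorants and removes the singularity. A majorant is \<open>2 * ln (norm (csqrt w + q))\<close> with
  \<open>q ^ 2 = z0\<close>, since \<open>w - z0\<close> factors as \<open>(csqrt w - q) * (csqrt w + q)\<close> and
  the first factor is the smaller one.
\<close>

lemma Green_function_exists:
  obtains g where "is_Green_function dom z0 g" "harmonic_on g (dom - {z0})"
    "\<And>w. w \<in> dom - {z0} \<Longrightarrow> g w \<ge> 0" "\<And>w. w \<noteq> z0 \<Longrightarrow> norm (w - z0) \<le> l j0 / 6 \<Longrightarrow> g w \<ge> 1"
proof -
  define r where "r = l j0 / 2"
  have r: "r > 0" "cball z0 r \<subseteq> dom" "ball z0 r \<subseteq> dom" using l_j0 z0_dom(2) by (auto simp: r_def)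
  define v0 where "v0 w = ln (max r (norm (w - z0)))" for w
  have hln: "harmonic_on (\<lambda>w. ln (norm (w - z0))) (dom - {z0})"
    by (rule harmonic_on_subset[OF harmonic_on_ln_norm]) auto
  have od: "open (dom - {z0})" using open_dom by auto
  have s0: "submean_on v0 dom"
  proof (rule submean_on_local)
    show "continuous_on dom v0" unfolding v0_def using r by (intro continuous_intros) (auto simp: max_def)
    fix a assume a: "a \<in> dom"
    show "\<exists>T. a \<in> T \<and> T \<subseteq> dom \<and> submean_on v0 T"
    proof (cases "a = z0")
      case True
      have "submean_on v0 (ball z0 r)"
        by (rule submean_on_cong[OF harmonic_imp_submean_on[OF harmonic_on_const open_ball, of "ln r"]])
          (simp add: v0_def dist_norm norm_minus_commute)
      then show ?thesis using True r by (intro exI[of _ "ball z0 r"]) auto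
    next
      case False
      have "submean_on (\<lambda>w. max (ln r) (ln (norm (w - z0)))) (dom - {z0})"
        by (intro submean_on_max harmonic_imp_submean_on hln harmonic_on_const od)
      then have "submean_on v0 (dom - {z0})"
        by (rule submean_on_cong) (use r in \<open>auto simp: v0_def max_def\<close>)
      then show ?thesis using False a by (intro exI[of _ "dom - {z0}"]) auto
    qed
  qed
  define q where "q = sqrt (ctr j0)"
  have q: "q > 0" "q\<^sup>2 = ctr j0" "complex_of_real (q\<^sup>2) = z0" by (simp_all add: q_def ctr_def z0_def)
  define h0 where "h0 w = Re (2 * Ln (csqrt w + of_real q))" for w
  have Rp: "Re (csqrt w + of_real q) \<ge> q" for w 
    unfolding plus_complex.sel Re_complex_of_real using Re_csqrt[of w] by linarith
  have hh0: "harmonic_on h0 dom" unfolding h0_def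
  proof (rule harmonic_on_Re[OF _ open_dom], intro holomorphic_intros)
    show "w \<notin> \<real>\<^sub>\<le>\<^sub>0" if "w \<in> dom" for w using nonpos_not_dom[OF that] .
    show "csqrt w + of_real q \<notin> \<real>\<^sub>\<le>\<^sub>0" for w 
      unfolding complex_nonpos_Reals_iff using Rp[of w] q(1) by linarith
  qed
  have v0h0: "v0 w \<le> h0 w" for w
  proof -
    let ?s = "csqrt w"
    have Rs: "Re ?s \<ge> 0" using Re_csqrt[of w] by linarith
    have n: "norm (?s + of_real q) \<ge> q" using Rp[of w] complex_Re_le_cmod[of "?s + of_real q"] by linarith
    have "w - z0 = (?s - of_real q) * (?s + of_real q)"
      using q(3) by (simp add: algebra_simps power2_eq_square[symmetric])
    then have "norm (w - z0) = norm (?s - of_real q) * norm (?s + of_real q)" by (simp add: norm_mult)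
    also have "norm (?s - of_real q) \<le> norm (?s + of_real q)"
    proof (rule power2_le_imp_le)
      have "0 \<le> Re ?s * q" using Rs q by simp
      then show "(norm (?s - of_real q))\<^sup>2 \<le> (norm (?s + of_real q))\<^sup>2"
        unfolding cmod_power2 by (simp add: power2_eq_square algebra_simps)
    qed simp
    finally have 1: "norm (w - z0) \<le> (norm (?s + of_real q))\<^sup>2" by (simp add: power2_eq_square mult_right_mono)
    have "(4::real) ^ j0 > 0" by simp
    then have "r \<le> q\<^sup>2" unfolding q(2) r_def ctr_def using l_le[of j0] by linarith
    also have "\<dots> \<le> (norm (?s + of_real q))\<^sup>2" using n q by (intro power_mono) auto
    finally have "max r (norm (w - z0)) \<le> (norm (?s + of_real q))\<^sup>2" using 1 by simp
    then have "v0 w \<le> ln ((norm (?s + of_real q))\<^sup>2)" unfolding v0_def using r by (intro ln_mono) auto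
    also have "\<dots> = h0 w"
    proof -
      have "?s + of_real q \<noteq> 0" using n q(1) by auto
      then show ?thesis by (simp add: h0_def ln_realpow Re_Ln)
    qed
    finally show ?thesis .
  qed
  obtain k where k: "harmonic_on k dom" "\<And>w. w \<in> dom \<Longrightarrow> v0 w \<le> k w"
    "\<And>h w. submean_on (\<lambda>z. - h z) dom \<Longrightarrow> (\<And>z. z \<in> dom \<Longrightarrow> v0 z \<le> h z) \<Longrightarrow> w \<in> dom \<Longrightarrow> k w \<le> h w"
    using least_harmonic_majorant[OF s0 harmonic_imp_submean_on[OF harmonic_on_uminus[OF hh0] open_dom] v0h0] by metis
  define g where "g w = k w - ln (norm (w - z0))" for w
  have gh: "harmonic_on g (dom - {z0})" unfolding g_def
    by (intro harmonic_on_diff hln harmonic_on_subset[OF k(1)]) auto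
  have lnv0: "ln (norm (w - z0)) \<le> v0 w" if "w \<noteq> z0" for w unfolding v0_def using that by (intro ln_mono) auto
  have g0: "g w \<ge> 0" if "w \<in> dom - {z0}" for w
    using k(2)[of w] lnv0[of w] that by (simp add: g_def)
  have "is_Green_function dom z0 g"
    unfolding is_Green_function_def
  proof (intro conjI ballI z0_dom(1))
    show "g \<in> Green_candidates dom z0"
      unfolding Green_candidates_def has_log_pole_def using gh g0 k(1) by (auto simp: g_def)
    fix h w assume h: "h \<in> Green_candidates dom z0" and w: "w \<in> dom - {z0}"
    obtain k' where k': "harmonic_on k' dom" "\<And>w. w \<in> dom - {z0} \<Longrightarrow> k' w = h w + ln (norm (w - z0))"
      using h by (auto simp: Green_candidates_def has_log_pole_def)
    have hn: "h w \<ge> 0" if "w \<in> dom - {z0}" for w using h that by (auto simp: Green_candidates_def)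
    have out: "v0 v \<le> k' v" if "v \<in> dom" "norm (v - z0) \<ge> r" for v
    proof -
      have "v \<in> dom - {z0}" using that r by auto
      then show ?thesis using hn[of v] k'(2)[of v] that by (simp add: v0_def max_def)
    qed
    have "v0 v \<le> k' v" if v: "v \<in> dom" for v
    proof (cases "v \<in> ball z0 r")
      case True
      have "ln r - k' v \<le> 0"
      proof (rule harmonic_le_0_on_ball[OF _ _ _ True])
        show "harmonic_on (\<lambda>v. ln r - k' v) (ball z0 r)"
          by (intro harmonic_on_diff harmonic_on_const harmonic_on_subset[OF k'(1) r(3)])
        show "continuous_on (cball z0 r) (\<lambda>v. ln r - k' v)"
          by (intro continuous_intros continuous_on_subset[OF harmonic_on_imp_continuous_on[OF k'(1)] r(2)])
        show "ln r - k' u \<le> 0" if "u \<in> sphere z0 r" for u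
          using out[of u] that r by (auto simp: v0_def dist_norm norm_minus_commute)
      qed
      then show ?thesis using True by (simp add: v0_def dist_norm norm_minus_commute max_def)
    next
      case False
      then show ?thesis using out[OF v] by (simp add: dist_norm norm_minus_commute)
    qed
    then have "k w \<le> k' w"
      using w by (intro k(3) harmonic_imp_submean_on harmonic_on_uminus k'(1) open_dom) auto
    then show "g w \<le> h w" using k'(2)[OF w] by (simp add: g_def)
  qed
  moreover have "g w \<ge> 1" if w: "w \<noteq> z0" "norm (w - z0) \<le> l j0 / 6" for w
  proof -
    have "w \<in> ball z0 r" using w l_j0 by (simp add: r_def dist_norm norm_minus_commute)
    then have "v0 w \<le> k w" using r by (intro k(2)) auto
    then have "ln r \<le> k w" using w l_j0 by (simp add: v0_def r_def max_def split: if_splits)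
    moreover have "1 \<le> ln r - ln (norm (w - z0))"
    proof -
      have "exp 1 * norm (w - z0) \<le> 3 * (l j0 / 6)"
        using exp_le w(2) by (intro mult_mono) auto
      then have "exp 1 * norm (w - z0) \<le> r" by (simp add: r_def)
      then have "ln (exp 1 * norm (w - z0)) \<le> ln r" using w(1) by (intro ln_mono) auto
      then show ?thesis using w(1) by (simp add: ln_mult)
    qed
    ultimately show ?thesis by (simp add: g_def)
  qed
  ultimately show ?thesis using that gh g0 by blast
qed

text \<open>
  Near the pole \<open>g \<ge> 1\<close>, so \<open>g\<close> dominates the harmonic measure of an interval around the
  pole, which is of order \<open>Im w / 16 ^ j\<close> over the gap \<open>j\<close>. At height \<open>Y\<close> the
  middle quarter of that gap has harmonic measure of order \<open>l j / Y\<close>; thus each gap contributes a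
  multiple of \<open>(l j / 4 ^ j)\<^sup>2\<close> to \<open>Y * g (\<i> * Y)\<close>.
\<close>

lemma Green_Limsup:
  assumes gh: "harmonic_on g (dom - {z0})" and g0: "\<And>w. w \<in> dom - {z0} \<Longrightarrow> g w \<ge> 0"
    and g1: "\<And>w. w \<noteq> z0 \<Longrightarrow> norm (w - z0) \<le> l j0 / 6 \<Longrightarrow> g w \<ge> 1"
  shows "Limsup (tending_to dom None) (\<lambda>t. ereal (g t * cmod t)) = \<infinity>"
proof -
  have up: "upper \<subseteq> dom - {z0}" using upper_subset_dom by (auto simp: z0_def)
  have gu: "harmonic_on g upper" by (rule harmonic_on_subset[OF gh up])
  have gu0: "g w \<ge> 0" if "w \<in> upper" for w using g0 that up by blast
  \<comment> \<open>half the radius on which \<open>g \<ge> 1\<close>, so that the end points of the interval have whole neighbourhoods where \<open>g \<ge> 1\<close>\<close>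
  define \<rho> where "\<rho> = l j0 / 12"
  have \<rho>: "\<rho> > 0" using l_j0 by (simp add: \<rho>_def)
  have first: "ang (ctr j0 - \<rho>) (ctr j0 + \<rho>) w / pi \<le> g w" if w: "w \<in> upper" for w
  proof -
    have "(\<Sum>j\<in>{j0}. 1 * ang (ctr j - \<rho>) (ctr j + \<rho>) w / pi) \<le> g w"
    proof (rule half_plane_minorant[OF _ _ _ _ gu gu0 _ w])
      fix j x and e :: real assume j: "j \<in> {j0}" and x: "x \<in> {ctr j - \<rho>..ctr j + \<rho>}" and e: "e > 0"
      have dx: "dist (of_real x) z0 \<le> \<rho>" using x j by (simp add: z0_def dist_real_def abs_le_iff)
      have "eventually (\<lambda>w. w \<in> upper \<and> dist w (of_real x) < \<rho>) (at (of_real x) within upper)"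
        using \<rho> by (auto simp: eventually_at intro!: exI[of _ \<rho>])
      then show "eventually (\<lambda>w. 1 - e < g w) (at (of_real x) within upper)"
      proof eventually_elim
        case (elim w)
        have "norm (w - z0) \<le> l j0 / 6"
          using dist_triangle[of w z0 "of_real x"] dx conjunct2[OF elim] by (simp add: dist_norm \<rho>_def)
        moreover have "w \<noteq> z0" using elim by (auto simp: z0_def)
        ultimately have "g w \<ge> 1" by (rule g1[rotated])
        then show ?case using e by simp
      qed
    qed (use \<rho> in auto)
    then show ?thesis by simp
  qed
  define \<beta> where "\<beta> = ctr j0 + \<rho>"
  have \<beta>: "\<beta> \<ge> 0" using \<rho> by (simp add: \<beta>_def ctr_def)
  define c where "c = 2 * \<rho> / (pi * (9 + (3 + \<beta>)\<^sup>2))"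
  have dpos: "9 + (3 + \<beta>)\<^sup>2 > 0" by (simp add: add_pos_nonneg)
  have c: "c > 0" unfolding c_def using \<rho> dpos by simp
  have second: "c / 16 ^ j * Im w \<le> g w" if w: "w \<in> ball (of_real (ctr j)) (l j)" "Im w > 0" for j w
  proof -
    have p4: "(1::real) \<le> 4 ^ j" by simp
    have p16: "(16::real) ^ j = 4 ^ j * 4 ^ j" by (simp flip: power_mult_distrib)
    have nw: "norm w \<le> 3 * 4 ^ j"
    proof -
      have "norm (complex_of_real (ctr j)) = ctr j" unfolding norm_of_real by (simp add: ctr_def)
      moreover have "norm (w - of_real (ctr j)) < l j" using w(1) by (simp add: dist_norm norm_minus_commute)
      ultimately have "norm w \<le> ctr j + l j" using norm_triangle_ineq2[of w "of_real (ctr j)"] by linarith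
      also have "\<dots> \<le> 3 * 4 ^ j" using gap_bounds(2)[of j] p4 by linarith
      finally show ?thesis .
    qed
    define M where "M = \<bar>Re w\<bar> + \<beta>"
    have M0: "M \<ge> 0" using \<beta> by (simp add: M_def)
    have "\<beta> \<le> \<beta> * 4 ^ j" using \<beta> p4 by (metis mult.right_neutral mult_left_mono)
    then have "M \<le> (3 + \<beta>) * 4 ^ j" using abs_Re_le_cmod[of w] nw unfolding M_def by (simp add: algebra_simps)
    then have "M\<^sup>2 \<le> ((3 + \<beta>) * 4 ^ j)\<^sup>2" using M0 by (rule power_mono)
    also have "\<dots> = (3 + \<beta>)\<^sup>2 * 16 ^ j" by (simp only: p16 power2_eq_square mult_ac)
    finally have M2: "M\<^sup>2 \<le> (3 + \<beta>)\<^sup>2 * 16 ^ j" .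
    have "\<bar>Im w\<bar> \<le> 3 * 4 ^ j" using abs_Im_le_cmod[of w] nw by linarith
    then have "(Im w)\<^sup>2 \<le> 9 * 16 ^ j" using power_mono[of "\<bar>Im w\<bar>" "3 * 4 ^ j" 2]
      by (simp add: power_mult_distrib p16 power2_eq_square)
    then have D: "(Im w)\<^sup>2 + M\<^sup>2 \<le> (9 + (3 + \<beta>)\<^sup>2) * 16 ^ j" using M2 by (simp add: algebra_simps)
    have pos: "(Im w)\<^sup>2 + M\<^sup>2 > 0" using w(2) by (simp add: add_pos_nonneg)
    have "c / 16 ^ j * Im w = (2 * \<rho> * Im w / ((9 + (3 + \<beta>)\<^sup>2) * 16 ^ j)) / pi"
      by (simp add: c_def field_simps)
    also have "\<dots> \<le> (2 * \<rho> * Im w / ((Im w)\<^sup>2 + M\<^sup>2)) / pi"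
      using D pos w(2) \<rho> dpos by (intro divide_right_mono divide_left_mono mult_pos_pos) auto
    also have "\<dots> = (((ctr j0 + \<rho>) - (ctr j0 - \<rho>)) * Im w / ((Im w)\<^sup>2 + M\<^sup>2)) / pi" by simp
    also have "\<dots> \<le> ang (ctr j0 - \<rho>) (ctr j0 + \<rho>) w / pi"
    proof (intro divide_right_mono ang_ge)
      have c0: "ctr j0 \<ge> 0" by (simp add: ctr_def)
      show "\<bar>ctr j0 - \<rho> - Re w\<bar> \<le> M" "\<bar>ctr j0 + \<rho> - Re w\<bar> \<le> M"
        unfolding M_def \<beta>_def using c0 \<rho> by linarith+
    qed (use \<rho> w(2) in auto)
    also have "\<dots> \<le> g w" using first w(2) by simp
    finally show ?thesis .
  qed
  show ?thesis
  proof (rule ccontr)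
    assume "Limsup (tending_to dom None) (\<lambda>t. ereal (g t * cmod t)) \<noteq> \<infinity>"
    then obtain C where "Limsup (tending_to dom None) (\<lambda>t. ereal (g t * cmod t)) < ereal C"
      using less_PInf_Ex_of_nat by blast
    then have "eventually (\<lambda>t. ereal (g t * cmod t) < ereal C) (tending_to dom None)" by (rule Limsup_lessD)
    then obtain B where B: "\<And>w. norm w \<ge> B \<Longrightarrow> w \<in> dom \<Longrightarrow> g w * norm w < C"
      unfolding tending_to_None eventually_inf_principal eventually_at_infinity by auto
    obtain J where J: "finite J" "\<And>j. j \<in> J \<Longrightarrow> l j > 0 \<and> j \<noteq> j0" "C * (32 * pi) / c < (\<Sum>j\<in>J. (l j / 4 ^ j)\<^sup>2)"
      using large_gap_sum[of j0 "C * (32 * pi) / c"] by metis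
    define N where "N = Max (insert 0 J)"
    have N: "j \<le> N" if "j \<in> J" for j unfolding N_def using J(1) that by simp
    define Y where "Y = \<bar>B\<bar> + 3 * 4 ^ N"
    have "(4::real) ^ N > 0" by simp
    then have Y0: "Y > 0" "Y \<ge> B" unfolding Y_def by linarith+
    define w where "w = \<i> * of_real Y"
    have w: "w \<in> upper" "Re w = 0" "Im w = Y" "norm w = Y" using Y0 by (simp_all add: w_def norm_mult)
    have bz: "ball (of_real (ctr j)) (l j) \<subseteq> dom - {z0}" if "j \<in> J" for j
    proof -
      have "z0 \<notin> ball (of_real (ctr j)) (l j)"
      proof
        assume "z0 \<in> ball (of_real (ctr j)) (l j)"
        then have "ctr j0 \<in> {ctr j - l j<..<ctr j + l j}" using ball_gap[of z0 j] by (simp add: z0_def)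
        then have "j0 = j" by (intro closed_gaps_disjoint[of "ctr j0"]) (use l_nonneg[of j0] in auto)
        then show False using J(2)[OF that] by simp
      qed
      then show ?thesis using ball_subset_dom by blast
    qed
    have gm: "(\<Sum>j\<in>J. (c / 16 ^ j) * l j / 8 * ang (ctr j - l j / 4) (ctr j + l j / 4) w / pi) \<le> g w"
    proof (rule gap_minorant[OF J(1) _ _ _ gu gu0 _ _ w(1)])
      show "harmonic_on g (ball (of_real (ctr j)) (l j))" if "j \<in> J" for j
        by (rule harmonic_on_subset[OF gh bz[OF that]])
      show "0 \<le> g v" if "j \<in> J" "v \<in> ball (of_real (ctr j)) (l j)" for j v
        by (rule g0[OF subsetD[OF bz[OF that(1)] that(2)]])
      show "c / 16 ^ j * Im v \<le> g v" if "v \<in> ball (of_real (ctr j)) (l j)" "Im v > 0" for j v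
        by (rule second[OF that])
    qed (use J(2) c in auto)
    have tm: "(c / (32 * pi)) * (l j / 4 ^ j)\<^sup>2 / Y \<le> (c / 16 ^ j) * l j / 8 * ang (ctr j - l j / 4) (ctr j + l j / 4) w / pi"
      if j: "j \<in> J" for j
    proof -
      have lj: "l j > 0" using J(2)[OF j] by simp
      have "(4::real) ^ j \<le> 4 ^ N" using N[OF j] by (intro power_increasing) auto
      then have YM: "3 * 4 ^ j \<le> Y" unfolding Y_def by linarith
      have "l j / 2 / (2 * Y) = ((ctr j + l j / 4) - (ctr j - l j / 4)) * Im w / ((Im w)\<^sup>2 + Y\<^sup>2)"
        using Y0 by (simp add: w(3) field_simps power2_eq_square)
      also have "\<dots> \<le> ang (ctr j - l j / 4) (ctr j + l j / 4) w"
        using gap_bounds[of j] lj YM Y0 by (intro ang_ge) (auto simp: w abs_le_iff)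
      finally have A: "l j / (4 * Y) \<le> ang (ctr j - l j / 4) (ctr j + l j / 4) w" by simp
      have p16: "(16::real) ^ j = 4 ^ j * 4 ^ j" by (simp flip: power_mult_distrib)
      have "(c / (32 * pi)) * (l j / 4 ^ j)\<^sup>2 / Y = ((c / 16 ^ j) * l j / 8 * (l j / (4 * Y))) / pi"
        using Y0 by (simp add: p16 field_simps power2_eq_square)
      also have "\<dots> \<le> (c / 16 ^ j) * l j / 8 * ang (ctr j - l j / 4) (ctr j + l j / 4) w / pi"
        using A c lj by (intro divide_right_mono mult_left_mono) auto
      finally show ?thesis .
    qed
    have "(\<Sum>j\<in>J. (c / (32 * pi)) * (l j / 4 ^ j)\<^sup>2 / Y) \<le> g w"
      by (rule order_trans[OF sum_mono[OF tm] gm])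
    then have "(c / (32 * pi)) * (\<Sum>j\<in>J. (l j / 4 ^ j)\<^sup>2) / Y \<le> g w"
      by (simp add: sum_distrib_left sum_divide_distrib)
    then have "(c / (32 * pi)) * (\<Sum>j\<in>J. (l j / 4 ^ j)\<^sup>2) \<le> g w * norm w"
      unfolding w(4) pos_divide_le_eq[OF Y0(1)] .
    moreover have "C < (c / (32 * pi)) * (\<Sum>j\<in>J. (l j / 4 ^ j)\<^sup>2)"
      using J(3) c by (simp add: field_simps)
    moreover have "g w * norm w < C" using B[of w] w Y0 upper_subset_dom by auto
    ultimately show False by linarith
  qed
qed

end

section \<open>Functions with vanishing boundary values on slices of the domain\<close>

text \<open>
  Tychonoff's theorem for the product of the intervals from \<open>0\<close> to \<open>B w\<close>. Closeness at
  finitely many points is enough for equicontinuous families.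
\<close>

lemma pointwise_cluster_function:
  fixes F :: "nat \<Rightarrow> 'a \<Rightarrow> real"
  assumes "\<And>n w. 0 \<le> F n w \<and> F n w \<le> B w"
  obtains f where "\<And>P e N. finite P \<Longrightarrow> e > 0 \<Longrightarrow> \<exists>n\<ge>N. \<forall>p\<in>P. \<bar>F n p - f p\<bar> < e"
proof -
  define U where "U = (PiE UNIV (\<lambda>w. {0..B w}) :: ('a \<Rightarrow> real) set)"
  have "compactin (product_topology (\<lambda>w::'a. euclidean :: real topology) UNIV) U"
    unfolding U_def compactin_PiE by simp
  then have "compact U" by (simp add: euclidean_product_topology)
  moreover have "filtermap F sequentially \<noteq> bot" by (simp add: filtermap_bot_iff)
  moreover have "eventually (\<lambda>g. g \<in> U) (filtermap F sequentially)"
    using assms by (simp add: eventually_filtermap U_def PiE_iff)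
  ultimately obtain f where f: "inf (nhds f) (filtermap F sequentially) \<noteq> bot"
    unfolding compact_filter by blast
  have "\<exists>n\<ge>N. \<forall>p\<in>P. \<bar>F n p - f p\<bar> < e" if P: "finite P" and e: "e > 0" for P e N
  proof (rule ccontr)
    assume neg: "\<not> (\<exists>n\<ge>N. \<forall>p\<in>P. \<bar>F n p - f p\<bar> < e)"
    define S where "S = (\<Inter>p\<in>P. {g :: 'a \<Rightarrow> real. \<bar>g p - f p\<bar> < e})"
    have "open {g :: 'a \<Rightarrow> real. \<bar>g p - f p\<bar> < e}" for p
      by (intro open_Collect_less continuous_intros continuous_on_product_coordinates)
    then have "open S" unfolding S_def using P by auto
    moreover have "f \<in> S" using e by (simp add: S_def)
    ultimately have "eventually (\<lambda>g. g \<in> S) (nhds f)" by (simp add: eventually_nhds_in_open)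
    moreover have "eventually (\<lambda>g. g \<notin> S) (filtermap F sequentially)"
      unfolding eventually_filtermap eventually_sequentially using neg by (auto simp: S_def)
    ultimately have "eventually (\<lambda>g. False) (inf (nhds f) (filtermap F sequentially))"
      unfolding eventually_inf by (intro exI[of _ "\<lambda>g. g \<in> S"] exI[of _ "\<lambda>g. g \<notin> S"]) auto
    then show False using f by (simp add: trivial_limit_def)
  qed
  then show ?thesis using that by blast
qed

lemma maximum_principle_slice:
  assumes R: "R > 0" and s: "submean_on s (W \<inter> ball 0 (2 * R))" and W: "open W"
    and bd: "\<And>a e. a \<notin> W \<Longrightarrow> norm a \<le> R \<Longrightarrow> e > 0 \<Longrightarrow> eventually (\<lambda>w. s w < e) (at a within W)"
    and circ: "\<And>a. a \<in> W \<Longrightarrow> norm a = R \<Longrightarrow> s a \<le> 0"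
    and w: "w \<in> W" "norm w < R"
  shows "s w \<le> 0"
proof -
  define U where "U = W \<inter> ball (0::complex) R"
  have "open U" unfolding U_def using W by auto
  moreover have "U \<subseteq> W \<inter> ball 0 (2 * R)" using R by (auto simp: U_def)
  ultimately have sU: "submean_on s U" using submean_on_subset[OF s] by blast
  show ?thesis
  proof (rule maximum_principle[OF sU])
    show "w \<in> U" using w by (simp add: U_def)
    fix e :: real assume e: "e > 0"
    have "eventually (\<lambda>w::complex. norm w \<ge> R) at_infinity" by (auto simp: eventually_at_infinity)
    then show "eventually (\<lambda>w. w \<in> U \<longrightarrow> s w < e) at_infinity" by eventually_elim (simp add: U_def)
    fix a assume a: "a \<notin> U"
    show "eventually (\<lambda>w. s w < e) (at a within U)"
    proof (cases "norm a \<le> R")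
      case False
      have "closure U \<subseteq> cball 0 R" by (rule closure_minimal) (auto simp: U_def)
      then have "a \<notin> closure U" using False by auto
      then have "at a within U = bot" by (rule not_in_closure_trivial_limitI)
      then show ?thesis by simp
    next
      case True
      show ?thesis
      proof (cases "a \<in> W")
        case False
        have "at a within U \<le> at a within W" by (rule at_le) (auto simp: U_def)
        then show ?thesis using bd[OF False True e] by (rule filter_leD)
      next
        case aW: True
        then have na: "norm a = R" using a True by (auto simp: U_def)
        have "a \<in> W \<inter> ball 0 (2 * R)" using aW na R by auto
        moreover have "open (W \<inter> ball (0::complex) (2 * R))" using W by auto
        ultimately have "isCont s a"
          using s unfolding submean_on_def by (simp add: continuous_on_eq_continuous_at)
        then have "(s \<longlongrightarrow> s a) (at a within U)"
          by (meson continuous_at_imp_continuous_at_within continuous_within)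
        then show ?thesis
          by (rule order_tendstoD(2)) (use circ[OF aW na] e in simp)
      qed
    qed
  qed
qed

context gap_sequence
begin

text \<open>
  The limits are taken within the whole domain, which for open \<open>D\<close> is the same as within the slice.
  Allowing a slice makes the estimates applicable to solutions in truncated domains.
\<close>

definition vanishing_positive :: "(complex \<Rightarrow> real) \<Rightarrow> complex set \<Rightarrow> bool" where
  "vanishing_positive u D \<longleftrightarrow> harmonic_on u (dom \<inter> D) \<and> (\<forall>w\<in>dom \<inter> D. 0 \<le> u w) \<and>
     (\<forall>t. t \<notin> gaps \<longrightarrow> of_real t \<in> D \<longrightarrow> (u \<longlongrightarrow> 0) (at (of_real t) within dom))"

lemma vanishing_positive_subset: "vanishing_positive u D \<Longrightarrow> D' \<subseteq> D \<Longrightarrow> vanishing_positive u D'"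
  unfolding vanishing_positive_def using harmonic_on_subset[of u "dom \<inter> D" "dom \<inter> D'"] by blast

lemma vanishing_positive_cmult: "vanishing_positive u D \<Longrightarrow> 0 \<le> c \<Longrightarrow> vanishing_positive (\<lambda>w. c * u w) D"
  unfolding vanishing_positive_def by (auto intro: harmonic_on_cmult tendsto_mult_right_zero)

lemma vanishing_positive_cnj:
  assumes u: "vanishing_positive u D" and D: "cnj ` D = D" "open D"
  shows "vanishing_positive (\<lambda>w. u (cnj w)) D"
  unfolding vanishing_positive_def
proof (intro conjI ballI allI impI)
  have im: "cnj ` (dom \<inter> D) = dom \<inter> D"
    using cnj_dom D by (simp add: image_Int inj_on_def)
  have "open (dom \<inter> D)" using open_dom D by auto
  then show "harmonic_on (\<lambda>w. u (cnj w)) (dom \<inter> D)"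
    using harmonic_on_cnj[of u "dom \<inter> D"] u unfolding im vanishing_positive_def by blast
  show "0 \<le> u (cnj w)" if "w \<in> dom \<inter> D" for w
  proof -
    have "cnj w \<in> dom \<inter> D" using that im by blast
    then show ?thesis using u by (auto simp: vanishing_positive_def)
  qed
  fix t assume t: "t \<notin> gaps" "of_real t \<in> D"
  have l: "(u \<longlongrightarrow> 0) (at (of_real t) within dom)" using u t by (auto simp: vanishing_positive_def)
  have "filterlim cnj (at (of_real t) within dom) (at (of_real t) within dom)"
    unfolding filterlim_at
  proof
    have "(cnj \<longlongrightarrow> cnj (of_real t)) (at (of_real t) within dom)" by (intro tendsto_intros)
    then show "(cnj \<longlongrightarrow> of_real t) (at (of_real t) within dom)" by simp
    have "cnj w \<noteq> of_real t" if "w \<noteq> of_real t" for w using that by (metis complex_cnj_cnj complex_cnj_complex_of_real)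
    moreover have "cnj w \<in> dom" if "w \<in> dom" for w using that cnj_dom by blast
    ultimately show "eventually (\<lambda>x. cnj x \<in> dom \<and> cnj x \<noteq> of_real t) (at (of_real t) within dom)"
      by (auto simp: eventually_at_filter)
  qed
  then show "((\<lambda>w. u (cnj w)) \<longlongrightarrow> 0) (at (of_real t) within dom)"
    by (rule filterlim_compose[OF l])
qed

lemma cnj_UNIV: "cnj ` UNIV = UNIV"
  by (metis complex_cnj_cnj surjI)

lemma cnj_ball_0: "cnj ` ball 0 r = ball 0 r"
  by (auto intro: image_eqI[of _ _ "cnj z" for z])

text \<open>
  The annulus in which the boundary Harnack inequality needs zero boundary values is free of gaps.
\<close>

lemma circle_point_not_gap: "norm a \<in> {3/4 * 4 ^ k..5/4 * 4 ^ k} \<Longrightarrow> Im a = 0 \<Longrightarrow> a = of_real (Re a) \<and> Re a \<notin> gaps"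
proof -
  assume a: "norm a \<in> {3/4 * 4 ^ k..5/4 * 4 ^ k}" "Im a = 0"
  have "a = of_real (Re a)" using a(2) by (simp add: complex_eq_iff)
  moreover have "Re a \<notin> gaps"
  proof
    assume g: "Re a \<in> gaps"
    then have "Re a > 1" by (rule gap_pos)
    then have "norm a = Re a" using \<open>a = of_real (Re a)\<close> by (metis norm_of_real abs_of_pos less_trans zero_less_one)
    moreover have "(4::real) ^ k > 0" by simp
    moreover note a(1)
    ultimately have "9/16 * 4 ^ k \<le> Re a" "Re a \<le> 7 * 4 ^ k" "Re a < 7/4 * 4 ^ k"
      unfolding atLeastAtMost_iff by linarith+
    then show False using gap_near[OF g, of k] gap_bounds(1)[of k] by auto
  qed
  ultimately show ?thesis by simp
qed

lemma boundary_harnack_circle: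
  assumes u: "vanishing_positive u (ball 0 (2 * 4 ^ k))" and z: "norm z = 4 ^ k" "Im z > 0"
  shows "u z \<le> bhp_const * (Im z / 4 ^ k * u (\<i> * of_real (4 ^ k)))"
    "Im z / 4 ^ k * u (\<i> * of_real (4 ^ k)) \<le> bhp_const * u z"
proof -
  have uu: "harmonic_on u ({z. norm z < 2 * 4 ^ k} \<inter> upper)"
    by (rule harmonic_on_subset[of u "dom \<inter> ball 0 (2 * 4 ^ k)"])
      (use u upper_subset_dom in \<open>auto simp: vanishing_positive_def\<close>)
  have nn: "u w \<ge> 0" if "norm w < 2 * 4 ^ k" "Im w > 0" for w
    using u that upper_subset_dom by (auto simp: vanishing_positive_def)
  have lim: "(u \<longlongrightarrow> 0) (at x within upper)" if "Im x = 0" "3/4 * 4 ^ k < norm x" "norm x < 5/4 * 4 ^ k" for x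
  proof -
    have "x = of_real (Re x) \<and> Re x \<notin> gaps" using that by (intro circle_point_not_gap[of x k]) auto
    moreover have "x \<in> ball 0 (2 * 4 ^ k)" using that by simp
    ultimately have "(u \<longlongrightarrow> 0) (at x within dom)" using u unfolding vanishing_positive_def by metis
    then show ?thesis using upper_subset_dom tendsto_within_subset by blast
  qed
  show "u z \<le> bhp_const * (Im z / 4 ^ k * u (\<i> * of_real (4 ^ k)))"
    "Im z / 4 ^ k * u (\<i> * of_real (4 ^ k)) \<le> bhp_const * u z"
    using boundary_harnack[OF uu nn lim _ z] by auto
qed

lemma P_infinity_iff:
  "u \<in> P_infinity dom \<longleftrightarrow> vanishing_positive u UNIV \<and> (\<forall>w\<in>dom. 0 < u w)"
proof -
  have "(\<forall>\<zeta>\<in>ext_compl dom - {None}. (u \<longlongrightarrow> 0) (tending_to dom \<zeta>)) \<longleftrightarrow>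
     (\<forall>t. t \<notin> gaps \<longrightarrow> (u \<longlongrightarrow> 0) (at (of_real t) within dom))"
  proof (intro iffI ballI allI impI)
    fix t assume A: "\<forall>\<zeta>\<in>ext_compl dom - {None}. (u \<longlongrightarrow> 0) (tending_to dom \<zeta>)" and t: "t \<notin> gaps"
    have "of_real t \<notin> dom" using t by (simp add: dom_def)
    moreover from this have "Some (of_real t) \<in> ext_compl dom - {None}" by (auto simp: ext_compl_def)
    ultimately show "(u \<longlongrightarrow> 0) (at (of_real t) within dom)" using A tending_to_Some by metis
  next
    fix \<zeta> assume A: "\<forall>t. t \<notin> gaps \<longrightarrow> (u \<longlongrightarrow> 0) (at (of_real t) within dom)" and z: "\<zeta> \<in> ext_compl dom - {None}"
    then obtain a where a: "\<zeta> = Some a" "a \<notin> dom" by (auto simp: ext_compl_def)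
    then obtain t where "a = of_real t" "t \<notin> gaps" using not_in_dom by blast
    then show "(u \<longlongrightarrow> 0) (tending_to dom \<zeta>)" using A a tending_to_Some by simp
  qed
  then show ?thesis unfolding P_infinity_def vanishing_positive_def by (auto simp: less_imp_le)
qed

lemma submean_upper: "vanishing_positive u UNIV \<Longrightarrow> harmonic_on u upper"
  using harmonic_on_subset upper_subset_dom unfolding vanishing_positive_def by (metis Int_UNIV_right)

section \<open>Uniqueness in the cone\<close>

text \<open>
  Otherwise the boundary Harnack inequality on all large circles and the maximum principle give
  \<open>u w \<ge> c * Im w\<close> in the upper half plane. Seen from \<open>\<i>\<close>, the middle quarter of the
  gap \<open>j\<close> has harmonic measure of order \<open>l j / 16 ^ j\<close>, so \<open>u \<i>\<close> would
  exceed a fixed multiple of every partial sum of \<open>\<Sum> (l j / 4 ^ j)\<^sup>2\<close>.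
\<close>

lemma vanishing_positive_small:
  assumes u: "vanishing_positive u UNIV" and \<delta>: "\<delta> > 0"
  shows "\<exists>k\<ge>n. u (\<i> * of_real (4 ^ k)) / 4 ^ k < \<delta>"
proof (rule ccontr)
  assume "\<not> (\<exists>k\<ge>n. u (\<i> * of_real (4 ^ k)) / 4 ^ k < \<delta>)"
  then have big: "u (\<i> * of_real (4 ^ k)) / 4 ^ k \<ge> \<delta>" if "k \<ge> n" for k using that not_less by blast
  note K = bhp_const_pos
  define c where "c = \<delta> / bhp_const"
  have c: "c > 0" using \<delta> K by (simp add: c_def)
  have hu: "harmonic_on u upper" by (rule submean_upper[OF u])
  have un: "u w \<ge> 0" if "w \<in> dom" for w using u that by (simp add: vanishing_positive_def)
  have hIm: "harmonic_on (\<lambda>w. c * Im w - u w) upper"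
    by (intro harmonic_on_diff hu harmonic_on_Im)
  have lin: "c * Im w \<le> u w" if w: "w \<in> upper" for w
  proof -
    obtain k where kn: "n \<le> k" and wk: "norm w < 4 ^ k" by (rule power4_exceeds)
    have "c * Im w - u w \<le> 0"
    proof (rule maximum_principle_slice[where R = "4 ^ k" and W = upper and s = "\<lambda>w. c * Im w - u w"])
      show "submean_on (\<lambda>w. c * Im w - u w) (upper \<inter> ball 0 (2 * 4 ^ k))"
        by (rule submean_on_subset[OF harmonic_imp_submean_on[OF hIm open_upper]]) (auto simp: open_upper)
      fix a assume a: "a \<in> upper" "norm a = 4 ^ k"
      have "Im a * \<delta> \<le> Im a * (u (\<i> * of_real (4 ^ k)) / 4 ^ k)"
        using big[OF kn] a by (intro mult_left_mono) auto
      also have "\<dots> \<le> bhp_const * u a"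
        using boundary_harnack_circle(2)[OF vanishing_positive_subset[OF u subset_UNIV] a(2)] a by simp
      finally show "c * Im a - u a \<le> 0" using K by (simp add: c_def field_simps)
    next
      fix a and e :: real assume a: "a \<notin> upper" "norm a \<le> 4 ^ k" and e: "e > 0"
      show "eventually (\<lambda>w. c * Im w - u w < e) (at a within upper)"
      proof (cases "Im a < 0")
        case True
        then show ?thesis by (simp add: at_within_upper_bot)
      next
        case False
        then have "Im a = 0" using a by simp
        have "((\<lambda>w. c * Im w) \<longlongrightarrow> c * Im a) (at a within upper)" by (intro tendsto_intros)
        then have "eventually (\<lambda>w. c * Im w < e) (at a within upper)"
          by (rule order_tendstoD(2)) (use \<open>Im a = 0\<close> e in simp)
        moreover have "eventually (\<lambda>w. w \<in> upper) (at a within upper)" by (simp add: eventually_at_filter)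
        ultimately show ?thesis
        proof eventually_elim
          case (elim w)
          have "u w \<ge> 0" using elim(2) upper_subset_dom by (intro un) auto
          then show ?case using elim by simp
        qed
      qed
    qed (use w wk open_upper in auto)
    then show ?thesis by simp
  qed
  define c' where "c' = c / (160 * pi)"
  have c': "c' > 0" using c by (simp add: c'_def)
  obtain J where J: "finite J" "\<And>j. j \<in> J \<Longrightarrow> l j > 0 \<and> j \<noteq> j0" "u \<i> / c' < (\<Sum>j\<in>J. (l j / 4 ^ j)\<^sup>2)"
    using large_gap_sum[of j0 "u \<i> / c'"] by metis
  have gm: "(\<Sum>j\<in>J. c * l j / 8 * ang (ctr j - l j / 4) (ctr j + l j / 4) \<i> / pi) \<le> u \<i>"
  proof (rule gap_minorant[OF J(1) _ _ _ hu])
    show "harmonic_on u (ball (of_real (ctr j)) (l j))" for j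
      using harmonic_on_subset[of u dom] ball_subset_dom u by (simp add: vanishing_positive_def)
    show "u w \<ge> 0" if "w \<in> upper" for w using that upper_subset_dom by (intro un) auto
    show "u w \<ge> 0" if "w \<in> ball (of_real (ctr j)) (l j)" for w j
      by (rule un[OF subsetD[OF ball_subset_dom that]])
  qed (use J(2) c lin in auto)
  have tm: "c' * (l j / 4 ^ j)\<^sup>2 \<le> c * l j / 8 * ang (ctr j - l j / 4) (ctr j + l j / 4) \<i> / pi" if "j \<in> J" for j
  proof -
    have lj: "l j > 0" using J(2)[OF that] by simp
    have p16: "(16::real) ^ j = 4 ^ j * 4 ^ j" by (simp flip: power_mult_distrib)
    have p1: "(1::real) \<le> 16 ^ j" "(4::real) ^ j > 0" by simp_all
    have M: "\<bar>ctr j - l j / 4\<bar> \<le> 3 * 4 ^ j" "\<bar>ctr j + l j / 4\<bar> \<le> 3 * 4 ^ j"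
      using gap_bounds[of j] lj p1 unfolding abs_le_iff by linarith+
    have "l j / 2 / (10 * 16 ^ j) \<le> l j / 2 / (1 + (3 * 4 ^ j)\<^sup>2)"
    proof (rule divide_left_mono)
      have "(3 * 4 ^ j)\<^sup>2 = 9 * (16::real) ^ j" by (simp add: p16 power2_eq_square)
      then show "1 + (3 * 4 ^ j)\<^sup>2 \<le> 10 * (16::real) ^ j" using p1 by linarith
    qed (use lj in \<open>auto intro!: mult_pos_pos add_pos_nonneg\<close>)
    also have "\<dots> = ((ctr j + l j / 4) - (ctr j - l j / 4)) * Im \<i> / ((Im \<i>)\<^sup>2 + (3 * 4 ^ j)\<^sup>2)" by simp
    also have "\<dots> \<le> ang (ctr j - l j / 4) (ctr j + l j / 4) \<i>"
      using lj M by (intro ang_ge) auto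
    finally have A: "l j / 2 / (10 * 16 ^ j) \<le> ang (ctr j - l j / 4) (ctr j + l j / 4) \<i>" .
    have "c' * (l j / 4 ^ j)\<^sup>2 = c * l j / 8 * (l j / 2 / (10 * 16 ^ j)) / pi"
      by (simp add: c'_def p16 field_simps power2_eq_square)
    also have "\<dots> \<le> c * l j / 8 * ang (ctr j - l j / 4) (ctr j + l j / 4) \<i> / pi"
      using A c lj by (intro divide_right_mono mult_left_mono) auto
    finally show ?thesis .
  qed
  have "(\<Sum>j\<in>J. c' * (l j / 4 ^ j)\<^sup>2) \<le> u \<i>"
    by (rule order_trans[OF sum_mono[OF tm] gm])
  then have "c' * (\<Sum>j\<in>J. (l j / 4 ^ j)\<^sup>2) \<le> u \<i>" by (simp add: sum_distrib_left)
  then show False using J(3) c' by (simp add: pos_divide_less_eq mult.commute)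
qed

lemma vanishing_positive_add:
  assumes "vanishing_positive u D" "vanishing_positive v D"
  shows "vanishing_positive (\<lambda>w. u w + v w) D"
  using assms unfolding vanishing_positive_def by (auto intro: harmonic_on_add tendsto_add_zero)

text \<open>
  On a circle where \<open>u z + u (cnj z)\<close> is at most \<open>\<epsilon> * Im z\<close>, so is the difference
  \<open>u z - u (cnj z)\<close>. The difference vanishes on the real axis, in the gaps by continuity, so the bound
  holds inside the circle.
\<close>

lemma vanishing_positive_le_cnj:
  assumes u: "vanishing_positive u UNIV" and z: "z \<in> upper"
  shows "u z \<le> u (cnj z)"
proof (rule field_le_epsilon)
  fix e0 :: real assume e0: "e0 > 0"
  define \<epsilon> where "\<epsilon> = e0 / Im z"
  have \<epsilon>: "\<epsilon> > 0" using e0 z by (simp add: \<epsilon>_def)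
  note K = bhp_const_pos
  have uc: "vanishing_positive (\<lambda>w. u (cnj w)) UNIV"
    by (rule vanishing_positive_cnj[OF u]) (auto simp: cnj_UNIV)
  define U where "U w = u w + u (cnj w)" for w
  have vU: "vanishing_positive U UNIV" unfolding U_def by (rule vanishing_positive_add[OF u uc])
  obtain m where m: "norm z < 4 ^ m" using real_arch_pow[of 4 "norm z"] by auto
  obtain k where k: "k \<ge> m" "U (\<i> * of_real (4 ^ k)) / 4 ^ k < \<epsilon> / bhp_const"
    using vanishing_positive_small[OF vU, of "\<epsilon> / bhp_const" m] \<epsilon> K by auto
  have "(4::real) ^ m \<le> 4 ^ k" using k by (intro power_increasing) auto
  with m have zk: "norm z < 4 ^ k" by (rule less_le_trans)
  define s where "s w = u w - u (cnj w) - \<epsilon> * Im w" for w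
  have hs: "harmonic_on s upper"
    unfolding s_def
    by (intro harmonic_on_diff submean_upper[OF u] submean_upper[OF uc] harmonic_on_Im)
  have un: "u w \<ge> 0" if "w \<in> dom" for w using u that by (simp add: vanishing_positive_def)
  have "s z \<le> 0"
  proof (rule maximum_principle_slice[where R = "4 ^ k" and W = upper and s = s])
    show "submean_on s (upper \<inter> ball 0 (2 * 4 ^ k))"
      by (rule submean_on_subset[OF harmonic_imp_submean_on[OF hs open_upper]]) (auto simp: open_upper)
    fix a assume a: "a \<in> upper" "norm a = 4 ^ k"
    have "u (cnj a) \<ge> 0" using a by (intro un) (auto simp: dom_def)
    then have "u a - u (cnj a) \<le> U a" by (simp add: U_def)
    also have "\<dots> \<le> bhp_const * (Im a / 4 ^ k * U (\<i> * of_real (4 ^ k)))"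
      using boundary_harnack_circle(1)[OF vanishing_positive_subset[OF vU subset_UNIV] a(2)] a by simp
    also have "\<dots> = bhp_const * Im a * (U (\<i> * of_real (4 ^ k)) / 4 ^ k)" by simp
    also have "\<dots> \<le> bhp_const * Im a * (\<epsilon> / bhp_const)"
      using k K a by (intro mult_left_mono) auto
    also have "\<dots> = \<epsilon> * Im a" using K by simp
    finally show "s a \<le> 0" by (simp add: s_def)
  next
    fix a and e :: real assume a: "a \<notin> upper" "norm a \<le> 4 ^ k" and e: "e > 0"
    show "eventually (\<lambda>w. s w < e) (at a within upper)"
    proof (cases "Im a < 0")
      case True
      then show ?thesis by (simp add: at_within_upper_bot)
    next
      case False
      then have Ia: "Im a = 0" using a by simp
      then have ca: "cnj a = a" by (simp add: complex_eq_iff)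
      have "((\<lambda>w. u w - u (cnj w)) \<longlongrightarrow> 0) (at a within upper)"
      proof (cases "a \<in> dom")
        case True
        have ic: "isCont v a" if "vanishing_positive v UNIV" for v
          using that True open_dom harmonic_on_imp_continuous_on[of v dom]
          by (simp add: vanishing_positive_def continuous_on_eq_continuous_at)
        have "isCont (\<lambda>w. u w - u (cnj w)) a" using ic[OF u] ic[OF uc] by (intro continuous_intros)
        then have "((\<lambda>w. u w - u (cnj w)) \<longlongrightarrow> u a - u (cnj a)) (at a within upper)"
          by (meson continuous_at_imp_continuous_at_within continuous_within)
        then show ?thesis by (simp add: ca)
      next
        case F: False
        then obtain t where t: "a = of_real t" "t \<notin> gaps" using not_in_dom by blast
        have lim: "(v \<longlongrightarrow> 0) (at a within upper)" if "vanishing_positive v UNIV" for v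
          using that t upper_subset_dom tendsto_within_subset unfolding vanishing_positive_def by blast
        show ?thesis using tendsto_diff[OF lim[OF u] lim[OF uc]] by simp
      qed
      then have "eventually (\<lambda>w. u w - u (cnj w) < e) (at a within upper)" using e by (rule order_tendstoD(2))
      moreover have "eventually (\<lambda>w. w \<in> upper) (at a within upper)" by (simp add: eventually_at_filter)
      ultimately show ?thesis
      proof eventually_elim
        case (elim w)
        have "\<epsilon> * Im w \<ge> 0" using \<epsilon> elim(2) by simp
        then show ?case using elim by (simp add: s_def)
      qed
    qed
  qed (use z zk open_upper in auto)
  then show "u z \<le> u (cnj z) + e0" using z by (simp add: s_def \<epsilon>_def)
qed

lemma vanishing_positive_symmetric:
  assumes u: "vanishing_positive u UNIV"
  shows "u (cnj z) = u z"
proof -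
  have uc: "vanishing_positive (\<lambda>w. u (cnj w)) UNIV"
    by (rule vanishing_positive_cnj[OF u]) (auto simp: cnj_UNIV)
  have up: "u (cnj w) = u w" if "Im w > 0" for w
    using vanishing_positive_le_cnj[OF u, of w] vanishing_positive_le_cnj[OF uc, of w] that by simp
  consider "Im z > 0" | "Im z < 0" | "Im z = 0" by linarith
  then show ?thesis
  proof cases
    case 2
    then show ?thesis using up[of "cnj z"] by simp
  next
    case 3
    then have "cnj z = z" by (simp add: complex_eq_iff)
    then show ?thesis by simp
  qed (rule up)
qed

text \<open>
  In the upper half of the circle both functions are comparable with \<open>Im a\<close>; symmetry carries the
  estimate to the lower half.
\<close>

lemma circle_compare:
  assumes u: "vanishing_positive u UNIV" and v: "vanishing_positive v UNIV"
    and w: "w \<in> dom" "norm w < 4 ^ k"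
  shows "u (\<i> * of_real (4 ^ k)) * v w \<le> bhp_const\<^sup>2 * v (\<i> * of_real (4 ^ k)) * u w"
proof -
  note K = bhp_const_pos
  define A where "A = u (\<i> * of_real (4 ^ k))"
  define B where "B = v (\<i> * of_real (4 ^ k))"
  have "\<i> * of_real (4 ^ k) \<in> dom" by (simp add: dom_def)
  then have AB: "A \<ge> 0" "B \<ge> 0" using u v by (auto simp: A_def B_def vanishing_positive_def)
  define s where "s w = A * v w - bhp_const\<^sup>2 * B * u w" for w
  have hs: "harmonic_on s dom"
    unfolding s_def using u v by (intro harmonic_on_diff harmonic_on_cmult) (auto simp: vanishing_positive_def)
  have up: "s a \<le> 0" if a: "Im a > 0" "norm a = 4 ^ k" for a
  proof -
    have "A * v a \<le> A * (bhp_const * (Im a / 4 ^ k * B))"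
      unfolding B_def using AB
      by (intro mult_left_mono boundary_harnack_circle(1)[OF vanishing_positive_subset[OF v subset_UNIV] a(2,1)])
    also have "\<dots> = bhp_const * B * (Im a / 4 ^ k * A)" by (simp add: mult_ac)
    also have "\<dots> \<le> bhp_const * B * (bhp_const * u a)"
      unfolding A_def using AB K
      by (intro mult_left_mono boundary_harnack_circle(2)[OF vanishing_positive_subset[OF u subset_UNIV] a(2,1)]) auto
    finally show ?thesis by (simp add: s_def power2_eq_square mult_ac)
  qed
  have sc: "s (cnj a) = s a" for a
    unfolding s_def using vanishing_positive_symmetric[OF u] vanishing_positive_symmetric[OF v] by simp
  have "s w \<le> 0"
  proof (rule maximum_principle_slice[where R = "4 ^ k" and W = dom and s = s])
    show "submean_on s (dom \<inter> ball 0 (2 * 4 ^ k))"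
      by (rule submean_on_subset[OF harmonic_imp_submean_on[OF hs open_dom]]) (auto simp: open_dom)
    fix a assume a: "a \<in> dom" "norm a = 4 ^ k"
    then have "Im a \<noteq> 0" using circle_point_not_gap[of a k] by (auto simp: dom_def)
    then consider "Im a > 0" | "Im (cnj a) > 0" by fastforce
    then show "s a \<le> 0" using up[of a] up[of "cnj a"] a sc by cases auto
  next
    fix a and e :: real assume a: "a \<notin> dom" "norm a \<le> 4 ^ k" and e: "e > 0"
    then obtain t where t: "a = of_real t" "t \<notin> gaps" using not_in_dom by blast
    have lim: "(v \<longlongrightarrow> 0) (at a within dom)" if "vanishing_positive v UNIV" for v
      using that t unfolding vanishing_positive_def by blast
    have "(s \<longlongrightarrow> A * 0 - bhp_const\<^sup>2 * B * 0) (at a within dom)"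
      unfolding s_def by (intro tendsto_intros lim u v)
    then show "eventually (\<lambda>w. s w < e) (at a within dom)" by (rule order_tendstoD(2)) (use e in simp)
  qed (use w open_dom in auto)
  then show ?thesis by (simp add: s_def A_def B_def)
qed

text \<open>
  The comparison in both directions is used: at \<open>w\<close> itself, and at the fixed point \<open>z0\<close> in
  order to control the ratio of the values on the imaginary axis. The latter cancels, so the constant is independent
  of the circle.
\<close>

lemma P_infinity_comparable:
  assumes u: "u \<in> P_infinity dom" and v: "v \<in> P_infinity dom"
  shows "\<exists>\<epsilon>>0. \<forall>w\<in>dom. \<epsilon> * v w \<le> u w"
proof (intro exI conjI ballI)
  note K = bhp_const_pos
  have u': "vanishing_positive u UNIV" "\<And>w. w \<in> dom \<Longrightarrow> u w > 0" using u P_infinity_iff by auto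
  have v': "vanishing_positive v UNIV" "\<And>w. w \<in> dom \<Longrightarrow> v w > 0" using v P_infinity_iff by auto
  show "0 < u z0 / (bhp_const ^ 4 * v z0)" using u'(2) v'(2) z0_dom K by simp
  fix w assume w: "w \<in> dom"
  obtain k where k: "max (norm w) (norm z0) < 4 ^ k" using real_arch_pow[of 4 "max (norm w) (norm z0)"] by auto
  define A where "A = u (\<i> * of_real (4 ^ k))"
  define B where "B = v (\<i> * of_real (4 ^ k))"
  have "\<i> * of_real (4 ^ k) \<in> dom" by (simp add: dom_def)
  then have AB: "A > 0" "B > 0" using u' v' by (auto simp: A_def B_def)
  have 1: "A * v w \<le> bhp_const\<^sup>2 * B * u w"
    unfolding A_def B_def by (rule circle_compare[OF u'(1) v'(1) w]) (use k in simp)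
  have 2: "B * u z0 \<le> bhp_const\<^sup>2 * A * v z0"
    unfolding A_def B_def by (rule circle_compare[OF v'(1) u'(1) z0_dom(1)]) (use k in simp)
  have p: "v w > 0" "u w > 0" "u z0 > 0" "v z0 > 0" using u'(2) v'(2) w z0_dom by auto
  have "(A * v w) * (B * u z0) \<le> (bhp_const\<^sup>2 * B * u w) * (bhp_const\<^sup>2 * A * v z0)"
    by (rule mult_mono[OF 1 2]) (use AB p K in auto)
  then have "(A * B) * (u z0 * v w) \<le> (A * B) * (bhp_const ^ 4 * v z0 * u w)"
    by (simp add: power2_eq_square power4_eq_xxxx mult_ac)
  then have "u z0 * v w \<le> bhp_const ^ 4 * v z0 * u w" using AB by simp
  then show "u z0 / (bhp_const ^ 4 * v z0) * v w \<le> u w"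
    using p K by (simp add: divide_simps mult_ac)
qed

text \<open>
  If \<open>c\<close> is the largest constant with \<open>c * v \<le> u\<close> and the difference were positive, it
  would belong to the cone and dominate a positive multiple of \<open>v\<close>, contradicting the choice of
  \<open>c\<close>.
\<close>

lemma P_infinity_proportional:
  assumes u: "u \<in> P_infinity dom" and v: "v \<in> P_infinity dom"
  shows "\<exists>c. \<forall>z\<in>dom. u z = c * v z"
proof -
  have u': "vanishing_positive u UNIV" "\<And>w. w \<in> dom \<Longrightarrow> u w > 0" using u P_infinity_iff by auto
  have v': "vanishing_positive v UNIV" "\<And>w. w \<in> dom \<Longrightarrow> v w > 0" using v P_infinity_iff by auto
  define c where "c = (INF w\<in>dom. u w / v w)"
  have bb: "bdd_below ((\<lambda>w. u w / v w) ` dom)"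
    using u'(2) v'(2) by (intro bdd_belowI[of _ 0]) (auto intro: less_imp_le)
  have ge: "c * v w \<le> u w" if "w \<in> dom" for w
  proof -
    have "c \<le> u w / v w" unfolding c_def by (rule cINF_lower[OF bb that])
    then show ?thesis using v'(2)[OF that] by (simp add: field_simps)
  qed
  define d where "d w = u w - c * v w" for w
  have hd: "harmonic_on d dom" unfolding d_def using u'(1) v'(1)
    by (intro harmonic_on_diff harmonic_on_cmult) (auto simp: vanishing_positive_def)
  have d0: "d w \<ge> 0" if "w \<in> dom" for w using ge[OF that] by (simp add: d_def)
  have "\<exists>p\<in>dom. d p = 0"
  proof (rule ccontr)
    assume "\<not> (\<exists>p\<in>dom. d p = 0)"
    then have dp: "d w > 0" if "w \<in> dom" for w using d0[OF that] that by force
    have "(d \<longlongrightarrow> 0 - c * 0) (at (of_real t) within dom)" if "t \<notin> gaps" for t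
      unfolding d_def using u'(1) v'(1) that by (intro tendsto_intros) (auto simp: vanishing_positive_def)
    then have "d \<in> P_infinity dom" using hd dp d0 by (auto simp: P_infinity_iff vanishing_positive_def)
    then obtain \<epsilon> where \<epsilon>: "\<epsilon> > 0" "\<And>w. w \<in> dom \<Longrightarrow> \<epsilon> * v w \<le> d w"
      using P_infinity_comparable[OF _ v] by blast
    have "c + \<epsilon> \<le> c" unfolding c_def[symmetric]
      unfolding c_def
    proof (rule cINF_greatest)
      show "dom \<noteq> {}" using z0_dom by auto
      fix w assume w: "w \<in> dom"
      have "(c + \<epsilon>) * v w \<le> u w" using \<epsilon>(2)[OF w] by (simp add: d_def algebra_simps)
      then show "(INF w\<in>dom. u w / v w) + \<epsilon> \<le> u w / v w"
        using v'(2)[OF w] by (simp add: field_simps c_def)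
    qed
    then show False using \<epsilon>(1) by simp
  qed
  then obtain p where p: "p \<in> dom" "d p = 0" by blast
  have "d w = 0" if "w \<in> dom" for w
    by (rule harmonic_nonneg_zero[OF open_dom connected_dom hd d0 p that])
  then show ?thesis by (intro exI[of _ c]) (simp add: d_def)
qed

section \<open>Existence in the cone\<close>

text \<open>
  The boundary Harnack inequality bounds \<open>h\<close> on the half circles by its values at the two points on the
  imaginary axis, and these are controlled by \<open>h z0\<close> in the connected slice.
\<close>

lemma vanishing_positive_bound:
  assumes "4 ^ k > norm z0"
  shows "\<exists>M>0. \<forall>h. vanishing_positive h (ball 0 (2 * 4 ^ k)) \<longrightarrow> h z0 = 1 \<longrightarrow> 
      (\<forall>a. norm a = 4 ^ k \<longrightarrow> Im a \<noteq> 0 \<longrightarrow> h a \<le> M)"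
proof -
  note K = bhp_const_pos
  define D where "D = dom \<inter> ball 0 (2 * 4 ^ k)"
  have z0D: "z0 \<in> ball 0 (2 * 4 ^ k)"
  proof -
    have "(4::real) ^ k > 0" by simp
    then have "norm z0 < 2 * 4 ^ k" using assms by linarith
    then show ?thesis by simp
  qed
  have D: "open D" "connected D" "z0 \<in> D"
    unfolding D_def using open_dom z0_dom(1) z0D l_j0 by (auto intro!: connected_slice[of _ j0] simp: z0_def)
  define p where "p = \<i> * complex_of_real (4 ^ k)"
  have p: "p \<in> D" "cnj p \<in> D" by (auto simp: D_def p_def dom_def norm_mult norm_power)
  obtain C C' where C: "C > 0" "\<And>h. harmonic_on h D \<Longrightarrow> (\<forall>z\<in>D. h z \<ge> 0) \<Longrightarrow> h p \<le> C * h z0"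
    and C': "C' > 0" "\<And>h. harmonic_on h D \<Longrightarrow> (\<forall>z\<in>D. h z \<ge> 0) \<Longrightarrow> h (cnj p) \<le> C' * h z0"
    using harnack_connected_pair[OF D(1,2) p(1) D(3)] harnack_connected_pair[OF D(1,2) p(2) D(3)] by blast
  show ?thesis
  proof (intro exI[of _ "bhp_const * (C + C')"] conjI allI impI)
    show "bhp_const * (C + C') > 0" using K C C' by simp
    fix h a assume h: "vanishing_positive h (ball 0 (2 * 4 ^ k))" "h z0 = 1" and a: "norm a = 4 ^ k" "Im a \<noteq> 0"
    have hD: "harmonic_on h D" "\<forall>z\<in>D. h z \<ge> 0" using h by (auto simp: vanishing_positive_def D_def)
    have hp: "0 \<le> h p" "h p \<le> C" "0 \<le> h (cnj p)" "h (cnj p) \<le> C'"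
      using C(2)[OF hD] C'(2)[OF hD] hD(2) p h(2) by auto
    have step: "v b \<le> bhp_const * v p" 
      if v: "vanishing_positive v (ball 0 (2 * 4 ^ k))" and b: "norm b = 4 ^ k" "Im b > 0" and vp: "v p \<ge> 0" for v b
    proof -
      have "v b \<le> bhp_const * (Im b / 4 ^ k * v p)" unfolding p_def by (rule boundary_harnack_circle(1)[OF v b])
      also have "\<dots> \<le> bhp_const * (1 * v p)"
        using abs_Im_le_cmod[of b] b vp K by (intro mult_left_mono mult_right_mono) auto
      finally show ?thesis by simp
    qed
    have hc: "vanishing_positive (\<lambda>w. h (cnj w)) (ball 0 (2 * 4 ^ k))"
      by (rule vanishing_positive_cnj[OF h(1) cnj_ball_0 open_ball])
    have "h a \<le> bhp_const * h p \<or> h a \<le> bhp_const * h (cnj p)"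
      using step[OF h(1) a(1) _ hp(1)] step[OF hc _ _ hp(3), of "cnj a"] a by (cases "Im a > 0") auto
    moreover have "bhp_const * h p \<le> bhp_const * (C + C')" "bhp_const * h (cnj p) \<le> bhp_const * (C + C')"
      using hp C(1) C'(1) K by (auto intro!: mult_left_mono)
    ultimately show "h a \<le> bhp_const * (C + C')" by linarith
  qed
qed

lemma vanishing_positive_le_barrier:
  assumes h: "vanishing_positive h (ball 0 (2 * 4 ^ k))" and b: "harmonic_on b dom" "\<And>w. w \<in> dom \<Longrightarrow> b w \<ge> 0"
    and le: "\<And>a. norm a = 4 ^ k \<Longrightarrow> Im a \<noteq> 0 \<Longrightarrow> h a \<le> b a"
    and w: "w \<in> dom" "norm w < 4 ^ k"
  shows "h w \<le> b w"
proof -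
  have "h w - b w \<le> 0"
  proof (rule maximum_principle_slice[where R = "4 ^ k" and W = dom and s = "\<lambda>w. h w - b w"])
    have "harmonic_on (\<lambda>w. h w - b w) (dom \<inter> ball 0 (2 * 4 ^ k))"
      using h by (intro harmonic_on_diff harmonic_on_subset[OF b(1)]) (auto simp: vanishing_positive_def)
    then show "submean_on (\<lambda>w. h w - b w) (dom \<inter> ball 0 (2 * 4 ^ k))"
      by (rule harmonic_imp_submean_on) (use open_dom in auto)
    fix a assume a: "a \<in> dom" "norm a = 4 ^ k"
    then have "Im a \<noteq> 0" using circle_point_not_gap[of a k] by (auto simp: dom_def)
    then show "h a - b a \<le> 0" using le[OF a(2)] by simp
  next
    fix a and e :: real assume a: "a \<notin> dom" "norm a \<le> 4 ^ k" and e: "e > 0"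
    then obtain t where t: "a = of_real t" "t \<notin> gaps" using not_in_dom by blast
    have "norm a < 2 * 4 ^ k" using a(2) by (rule le_less_trans) simp
    then have "(h \<longlongrightarrow> 0) (at a within dom)"
      using h t unfolding vanishing_positive_def by auto
    then have "eventually (\<lambda>w. h w < e) (at a within dom)" using e by (rule order_tendstoD(2))
    moreover have "eventually (\<lambda>w. w \<in> dom) (at a within dom)" by (simp add: eventually_at_filter)
    ultimately show "eventually (\<lambda>w. h w - b w < e) (at a within dom)"
    proof eventually_elim
      case (elim w)
      then show ?case using b(2)[of w] by simp
    qed
  qed (use w open_dom in auto)
  then show ?thesis by simp
qed

text \<open>
  The least harmonic majorant of \<open>\<bar>Im w\<bar>\<close> in the truncated domain is at most any multiple of a
  barrier that dominates \<open>\<bar>Im w\<bar>\<close>, hence vanishes at the real boundary points.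
\<close>

lemma truncated_solution:
  assumes n: "norm z0 < 4 ^ n"
  shows "\<exists>f. vanishing_positive f (ball 0 (4 ^ n)) \<and> f z0 = 1"
proof -
  define D where "D = dom \<inter> ball 0 (4 ^ n)"
  have z0D: "z0 \<in> ball 0 (4 ^ n)" using n by simp
  have D: "open D" "connected D" "z0 \<in> D"
    unfolding D_def using open_dom z0_dom(1) z0D l_j0 by (auto intro!: connected_slice[of _ j0] simp: z0_def)
  have "submean_on (\<lambda>w. max (1 * Im w) ((-1) * Im w)) D"
    by (intro submean_on_max harmonic_imp_submean_on harmonic_on_Im D)
  then have sub: "submean_on (\<lambda>w. \<bar>Im w\<bar>) D" by (rule submean_on_cong) (simp add: max_def abs_if)
  have sup: "submean_on (\<lambda>w. - (4 ^ n)) D" by (intro harmonic_imp_submean_on harmonic_on_const D)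
  have "\<bar>Im w\<bar> \<le> 4 ^ n" if "w \<in> D" for w using that abs_Im_le_cmod[of w] by (simp add: D_def)
  then obtain v where v: "harmonic_on v D" "\<And>w. w \<in> D \<Longrightarrow> \<bar>Im w\<bar> \<le> v w"
    "\<And>h w. submean_on (\<lambda>z. - h z) D \<Longrightarrow> (\<And>z. z \<in> D \<Longrightarrow> \<bar>Im z\<bar> \<le> h z) \<Longrightarrow> w \<in> D \<Longrightarrow> v w \<le> h w"
    using least_harmonic_majorant[OF sub sup] by metis
  have v0: "v w \<ge> 0" if "w \<in> D" for w using v(2)[OF that] by linarith
  have "v z0 \<noteq> 0"
  proof
    assume "v z0 = 0"
    have "(1::real) \<le> 4 ^ n" by simp
    then have "norm (\<i> / 2) < 4 ^ n" unfolding norm_divide norm_ii norm_numeral by linarith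
    then have iD: "\<i> / 2 \<in> D" by (simp add: D_def dom_def)
    have "v (\<i> / 2) = 0" by (rule harmonic_nonneg_zero[OF D(1,2) v(1) v0 D(3) \<open>v z0 = 0\<close> iD])
    then show False using v(2)[OF iD] by simp
  qed
  then have vz: "v z0 > 0" using v0[OF D(3)] by simp
  have "vanishing_positive v (ball 0 (4 ^ n))"
    unfolding vanishing_positive_def
  proof (intro conjI ballI allI impI)
    show "harmonic_on v (dom \<inter> ball 0 (4 ^ n))" using v(1) by (simp add: D_def)
    show "0 \<le> v w" if "w \<in> dom \<inter> ball 0 (4 ^ n)" for w using v0 that by (simp add: D_def)
    fix t assume t: "t \<notin> gaps" "complex_of_real t \<in> ball 0 (4 ^ n)"
    obtain b where b: "harmonic_on b dom" "\<And>w. w \<in> dom \<Longrightarrow> b w > 0" "(b \<longlongrightarrow> 0) (at (of_real t) within dom)"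
      "\<And>r. r > 0 \<Longrightarrow> \<exists>\<delta>>0. \<forall>w\<in>dom. r \<le> norm (w - of_real t) \<longrightarrow> \<delta> \<le> b w"
      "\<exists>c>0. \<forall>w\<in>dom. norm (w - of_real t) \<le> 1 \<longrightarrow> c * norm (w - of_real t) \<le> b w"
      using finite_barrier[OF t(1)] by metis
    obtain c where c: "c > 0" "\<And>w. w \<in> dom \<Longrightarrow> norm (w - of_real t) \<le> 1 \<Longrightarrow> c * norm (w - of_real t) \<le> b w"
      using b(5) by blast
    obtain \<delta> where \<delta>: "\<delta> > 0" "\<And>w. w \<in> dom \<Longrightarrow> 1 \<le> norm (w - of_real t) \<Longrightarrow> \<delta> \<le> b w"
      using b(4)[of 1] by auto
    define C where "C = 1 / c + 4 ^ n / \<delta>"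
    have Imb: "\<bar>Im w\<bar> \<le> C * b w" if w: "w \<in> D" for w
    proof -
      have wd: "w \<in> dom" "\<bar>Im w\<bar> \<le> 4 ^ n" using w abs_Im_le_cmod[of w] by (auto simp: D_def)
      have bw: "b w > 0" by (rule b(2)[OF wd(1)])
      have It: "\<bar>Im w\<bar> \<le> norm (w - of_real t)" using abs_Im_le_cmod[of "w - of_real t"] by simp
      have parts: "0 \<le> 1 / c * b w" "0 \<le> 4 ^ n / \<delta> * b w" using bw c \<delta> by simp_all
      have "\<bar>Im w\<bar> \<le> 1 / c * b w \<or> \<bar>Im w\<bar> \<le> 4 ^ n / \<delta> * b w"
      proof (cases "norm (w - of_real t) \<le> 1")
        case True
        have "c * \<bar>Im w\<bar> \<le> c * norm (w - of_real t)" using It c by simp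
        also have "\<dots> \<le> b w" by (rule c(2)[OF wd(1) True])
        finally show ?thesis using c(1) by (simp add: field_simps)
      next
        case False
        then have "\<delta> \<le> b w" using \<delta>(2)[OF wd(1)] by simp
        then have "4 ^ n / \<delta> * \<delta> \<le> 4 ^ n / \<delta> * b w" using \<delta>(1) by (intro mult_left_mono) auto
        then show ?thesis using wd(2) \<delta>(1) by simp
      qed
      then show ?thesis using parts by (auto simp: C_def distrib_right)
    qed
    have vb: "v w \<le> C * b w" if "w \<in> D" for w
      by (rule v(3)[OF harmonic_imp_submean_on[OF harmonic_on_uminus[OF harmonic_on_cmult[OF harmonic_on_subset[OF b(1)]]] D(1)] Imb that])
        (auto simp: D_def)
    have evD: "eventually (\<lambda>w. w \<in> D) (at (of_real t) within dom)"
    proof -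
      have "eventually (\<lambda>w. w \<in> ball 0 (4 ^ n)) (at (of_real t) within dom)"
        unfolding eventually_at_filter by (rule eventually_mono[OF eventually_nhds_in_open[OF open_ball t(2)]]) simp
      moreover have "eventually (\<lambda>w. w \<in> dom) (at (of_real t) within dom)" by (simp add: eventually_at_filter)
      ultimately show ?thesis by eventually_elim (simp add: D_def)
    qed
    show "(v \<longlongrightarrow> 0) (at (of_real t) within dom)"
    proof (rule tendsto_sandwich[OF _ _ tendsto_const])
      show "eventually (\<lambda>w. 0 \<le> v w) (at (of_real t) within dom)" using evD by eventually_elim (rule v0)
      show "eventually (\<lambda>w. v w \<le> C * b w) (at (of_real t) within dom)" using evD by eventually_elim (rule vb)
      show "((\<lambda>w. C * b w) \<longlongrightarrow> 0) (at (of_real t) within dom)" using tendsto_mult_left[OF b(3), of C] by simp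
    qed
  qed
  then have "vanishing_positive (\<lambda>w. (1 / v z0) * v w) (ball 0 (4 ^ n))"
    by (rule vanishing_positive_cmult) (use vz in simp)
  then show ?thesis using vz by (intro exI[of _ "\<lambda>w. (1 / v z0) * v w"]) simp
qed

text \<open>
  The normalised solutions in the discs of radius \<open>4 ^ n\<close> are bounded on each slice, uniformly in
  \<open>n\<close>, and therefore equicontinuous by the Lipschitz form of Harnack's inequality. A pointwise cluster
  point is then a locally uniform one, hence harmonic. The bounds by multiples of barriers are closed conditions and
  give the boundary values.
\<close>

lemma P_infinity_nonempty: "P_infinity dom \<noteq> {}"
proof -
  obtain N where N: "norm z0 < 4 ^ N" using real_arch_pow[of 4 "norm z0"] by auto
  have big: "norm z0 < 4 ^ k" if "k \<ge> N" for k
  proof -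
    have "(4::real) ^ N \<le> 4 ^ k" using that by (intro power_increasing) auto
    with N show ?thesis by (rule less_le_trans)
  qed
  have "\<exists>f. \<forall>n\<ge>N. vanishing_positive (f n) (ball 0 (4 ^ n)) \<and> f n z0 = 1"
    using truncated_solution big by metis
  then obtain f where f: "\<And>n. n \<ge> N \<Longrightarrow> vanishing_positive (f n) (ball 0 (4 ^ n))" "\<And>n. n \<ge> N \<Longrightarrow> f n z0 = 1"
    by blast
  have fk: "vanishing_positive (f n) (ball 0 (2 * 4 ^ k))" if "n > k" "k \<ge> N" for n k
  proof (rule vanishing_positive_subset[OF f(1)])
    have "(4::real) ^ Suc k \<le> 4 ^ n" using that by (intro power_increasing) auto
    moreover have "(4::real) ^ k > 0" by simp
    ultimately have "2 * 4 ^ k \<le> (4::real) ^ n" unfolding power_Suc by linarith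
    then show "ball (0::complex) (2 * 4 ^ k) \<subseteq> ball 0 (4 ^ n)" by (rule subset_ball)
  qed (use that in simp)
  obtain M where M: "\<And>k. k \<ge> N \<Longrightarrow> M k > 0"
    "\<And>k h a. k \<ge> N \<Longrightarrow> vanishing_positive h (ball 0 (2 * 4 ^ k)) \<Longrightarrow> h z0 = 1 \<Longrightarrow> norm a = 4 ^ k \<Longrightarrow> Im a \<noteq> 0 \<Longrightarrow> h a \<le> M k"
    using vanishing_positive_bound big by metis
  have fM: "f n w \<le> M k" if "n > k" "k \<ge> N" "w \<in> dom" "norm w < 4 ^ k" for n k w
    by (rule vanishing_positive_le_barrier[OF fk[OF that(1,2)] harmonic_on_const])
       (use M(1)[OF that(2)] M(2)[OF that(2) fk[OF that(1,2)] f(2)] that in auto)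
  have f0: "0 \<le> f n w" if "n \<ge> N" "w \<in> dom" "norm w < 4 ^ n" for n w
    using f(1)[OF that(1)] that(2,3) by (simp add: vanishing_positive_def)
  \<comment> \<open>the cutoff makes every \<open>F n\<close> nonnegative on the whole plane, as the product of intervals requires\<close>
  define F where "F n w = (if n \<ge> N \<and> w \<in> dom \<and> norm w < 4 ^ n then f n w else 0)" for n w
  have Ff: "F n w = f n w" if "n > k" "k \<ge> N" "w \<in> dom" "norm w < 4 ^ k" for n k w
  proof -
    have "(4::real) ^ k \<le> 4 ^ n" using that(1) by (intro power_increasing) auto
    with that(4) have "norm w < 4 ^ n" by (rule less_le_trans)
    then show ?thesis using that by (simp add: F_def)
  qed
  have F0: "0 \<le> F n w" for n w using f0 by (simp add: F_def)
  have "\<exists>B. \<forall>n. F n w \<le> B" for w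
  proof -
    obtain k where kN: "N \<le> k" and wk: "norm w < 4 ^ k" by (rule power4_exceeds)
    have "F n w \<le> (\<Sum>i\<le>k. F i w) + M k" for n
    proof (cases "n \<le> k")
      case True
      then have "F n w \<le> (\<Sum>i\<le>k. F i w)" using F0 by (intro member_le_sum) auto
      then show ?thesis using M(1)[OF kN] by simp
    next
      case False
      have s0: "(\<Sum>i\<le>k. F i w) \<ge> 0" using F0 by (intro sum_nonneg) auto
      have "F n w \<le> M k"
      proof (cases "w \<in> dom")
        case True
        then show ?thesis using Ff[OF _ kN True wk, of n] fM[OF _ kN True wk, of n] False by simp
      next
        case F: False
        then show ?thesis using M(1)[OF kN] by (simp add: F_def)
      qed
      then show ?thesis using s0 by simp
    qed
    then show ?thesis by blast
  qed
  then obtain B where B: "\<And>n w. F n w \<le> B w" by metis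
  obtain g where g: "\<And>P e N. finite P \<Longrightarrow> e > 0 \<Longrightarrow> \<exists>n\<ge>N. \<forall>p\<in>P. \<bar>F n p - g p\<bar> < e"
    using pointwise_cluster_function[of F B] F0 B by metis
  have glim: "g w \<le> y" if "\<And>n. n > m \<Longrightarrow> F n w \<le> y" for w y m
  proof (rule field_le_epsilon)
    fix e :: real assume "e > 0"
    then obtain n where "n \<ge> Suc m" "\<bar>F n w - g w\<bar> < e" using g[of "{w}" e "Suc m"] by auto
    then show "g w \<le> y + e" using that[of n] by simp
  qed
  have g0: "0 \<le> g w" for w
  proof (rule field_le_epsilon)
    fix e :: real assume "e > 0"
    then obtain n where "\<bar>F n w - g w\<bar> < e" using g[of "{w}" e 0] by auto
    then show "0 \<le> g w + e" using F0[of n w] by simp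
  qed
  have gz0: "g z0 = 1"
  proof -
    have F1: "F n z0 = 1" if "n > N" for n using Ff[OF that order_refl z0_dom(1) N] f(2) that by simp
    have "\<bar>g z0 - 1\<bar> \<le> 0"
    proof (rule field_le_epsilon)
      fix e :: real assume "e > 0"
      then obtain n where "n \<ge> Suc N" "\<bar>F n z0 - g z0\<bar> < e" using g[of "{z0}" e "Suc N"] by auto
      then show "\<bar>g z0 - 1\<bar> \<le> 0 + e" using F1[of n] by simp
    qed
    then show ?thesis by simp
  qed
  have gharm: "harmonic_on g dom"
  proof (rule harmonic_on_approx[OF open_dom])
    fix p assume p: "p \<in> dom"
    obtain r where r: "r > 0" "ball p r \<subseteq> dom" using p open_dom open_contains_ball by blast
    obtain k where kN: "N \<le> k" and pk: "norm p + r < 4 ^ k" by (rule power4_exceeds)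
    have inb: "w \<in> dom" "norm w < 4 ^ k" if "w \<in> ball p r" for w
    proof -
      show "w \<in> dom" using that r(2) by blast
      show "norm w < 4 ^ k" using that pk norm_triangle_ineq2[of w p] by (simp add: dist_norm norm_minus_commute)
    qed
    have Fh: "harmonic_on (F n) (ball p r)" if n: "n > k" for n
    proof (rule harmonic_on_cong[OF _ open_ball])
      show "harmonic_on (f n) (ball p r)"
      proof (rule harmonic_on_subset[of _ "dom \<inter> ball 0 (2 * 4 ^ k)"])
        show "harmonic_on (f n) (dom \<inter> ball 0 (2 * 4 ^ k))" using fk[OF n kN] by (simp add: vanishing_positive_def)
        show "ball p r \<subseteq> dom \<inter> ball 0 (2 * 4 ^ k)"
        proof
          fix w assume "w \<in> ball p r"
          from inb[OF this] have "w \<in> dom" "norm w < 4 ^ k" .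
          moreover have "(4::real) ^ k > 0" by simp
          ultimately have "norm w < 2 * 4 ^ k" by linarith
          then show "w \<in> dom \<inter> ball 0 (2 * 4 ^ k)" using \<open>w \<in> dom\<close> by simp
        qed
      qed
      show "f n z = F n z" if "z \<in> ball p r" for z using Ff[OF n kN inb[OF that]] by simp
    qed
    \<comment> \<open>two points of the disc of radius \<open>d\<close> are at most \<open>r / 4\<close> apart, half the radius \<open>r / 2\<close> of the disc used in the Lipschitz estimate\<close>
    define d where "d = r / 8"
    have d: "d > 0" "cball p d \<subseteq> ball p r" using r by (auto simp: d_def)
    define L where "L = 8 * M k / r"
    have L: "L > 0" using M(1)[OF kN] r by (simp add: L_def)
    have lip: "\<bar>F n z - F n w\<bar> \<le> L * norm (z - w)" if n: "n > k" and zw: "z \<in> cball p d" "w \<in> cball p d" for n z w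
    proof -
      have sub: "ball w (r/2) \<subseteq> ball p r"
      proof
        fix v assume "v \<in> ball w (r/2)"
        then show "v \<in> ball p r" using dist_triangle[of p v w] zw r by (simp add: d_def)
      qed
      have "norm (z - w) \<le> r/2/2"
        using dist_triangle[of z w p] zw r by (simp add: d_def dist_norm norm_minus_commute)
      then have "\<bar>F n z - F n w\<bar> \<le> 4 * F n w / (r/2) * norm (z - w)"
        using r by (intro harnack_lipschitz[OF harmonic_on_subset[OF Fh[OF n] sub]] F0) auto
      also have "\<dots> \<le> L * norm (z - w)"
      proof (rule mult_right_mono)
        have wb: "w \<in> ball p r" using zw d by blast
        have "F n w \<le> M k" using Ff[OF n kN inb[OF wb]] fM[OF n kN inb[OF wb]] by simp
        then show "4 * F n w / (r/2) \<le> L" using r by (simp add: L_def divide_right_mono)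
      qed simp
      finally show ?thesis .
    qed
    have glip: "\<bar>g z - g w\<bar> \<le> L * norm (z - w)" if zw: "z \<in> cball p d" "w \<in> cball p d" for z w
    proof (rule field_le_epsilon)
      fix e :: real assume "e > 0"
      then obtain n where "n \<ge> Suc k" "\<bar>F n z - g z\<bar> < e/2" "\<bar>F n w - g w\<bar> < e/2"
        using g[of "{z, w}" "e/2" "Suc k"] by auto
      moreover from this have "\<bar>F n z - F n w\<bar> \<le> L * norm (z - w)" by (intro lip[OF _ zw]) simp
      ultimately show "\<bar>g z - g w\<bar> \<le> L * norm (z - w) + e"
        unfolding abs_le_iff abs_less_iff by linarith
    qed
    have "\<exists>h. harmonic_on h (ball p d) \<and> (\<forall>z\<in>ball p d. \<bar>h z - g z\<bar> \<le> e)" if e: "e > 0" for e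
    proof -
      define \<eta> where "\<eta> = e / (3 * L)"
      have \<eta>: "\<eta> > 0" using e L by (simp add: \<eta>_def)
      obtain P where P: "P \<subseteq> cball p d" "finite P" "cball p d \<subseteq> (\<Union>c\<in>P. ball c \<eta>)"
      proof (rule compactE_image[OF compact_cball[of p d]])
        show "cball p d \<subseteq> (\<Union>c\<in>cball p d. ball c \<eta>)" using \<eta> by force
      qed auto
      obtain n where n: "n \<ge> Suc k" "\<And>c. c \<in> P \<Longrightarrow> \<bar>F n c - g c\<bar> < e/3"
        using g[of P "e/3" "Suc k"] P(2) e by auto
      have "\<bar>F n z - g z\<bar> \<le> e" if "z \<in> ball p d" for z
      proof -
        have z: "z \<in> cball p d" using that by simp
        then obtain c where c: "c \<in> P" "z \<in> ball c \<eta>" using P(3) by blast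
        have cd: "c \<in> cball p d" using c P(1) by blast
        have nz: "norm (z - c) \<le> \<eta>" using c(2) by (simp add: dist_norm norm_minus_commute)
        have "L * norm (z - c) \<le> L * \<eta>" using nz L by simp
        also have "\<dots> = e/3" using L by (simp add: \<eta>_def)
        finally have Lz: "L * norm (z - c) \<le> e/3" .
        have "\<bar>F n z - F n c\<bar> \<le> e/3" using lip[OF _ z cd, of n] n(1) Lz by simp
        moreover have "\<bar>g z - g c\<bar> \<le> e/3" using glip[OF z cd] Lz by simp
        ultimately show ?thesis using n(2)[OF c(1)] by linarith
      qed
      moreover have "harmonic_on (F n) (ball p d)"
        by (rule harmonic_on_subset[OF Fh]) (use n(1) d ball_subset_cball in auto)
      ultimately show ?thesis by blast
    qed
    moreover have "cball p d \<subseteq> dom" using d(2) r(2) by blast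
    ultimately show "\<exists>d>0. cball p d \<subseteq> dom \<and> (\<forall>e>0. \<exists>h. harmonic_on h (ball p d) \<and> (\<forall>z\<in>ball p d. \<bar>h z - g z\<bar> \<le> e))"
      using d(1) by blast
  qed
  have gpos: "g w > 0" if w: "w \<in> dom" for w
  proof (rule ccontr)
    assume "\<not> g w > 0"
    then have "g w = 0" using g0[of w] by simp
    from harmonic_nonneg_zero[OF open_dom connected_dom gharm g0 w this z0_dom(1)] show False using gz0 by simp
  qed
  have glim0: "(g \<longlongrightarrow> 0) (at (of_real t) within dom)" if t: "t \<notin> gaps" for t
  proof -
    obtain k where kN: "N \<le> k" and tk: "\<bar>t\<bar> < 4 ^ k" by (rule power4_exceeds)
    obtain b where b: "harmonic_on b dom" "\<And>w. w \<in> dom \<Longrightarrow> b w > 0" "(b \<longlongrightarrow> 0) (at (of_real t) within dom)"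
      "\<And>r. r > 0 \<Longrightarrow> \<exists>\<delta>>0. \<forall>w\<in>dom. r \<le> norm (w - of_real t) \<longrightarrow> \<delta> \<le> b w"
      using finite_barrier[OF t] by metis
    obtain \<delta> where \<delta>: "\<delta> > 0" "\<And>w. w \<in> dom \<Longrightarrow> 4 ^ k - \<bar>t\<bar> \<le> norm (w - of_real t) \<Longrightarrow> \<delta> \<le> b w"
      using b(4)[of "4 ^ k - \<bar>t\<bar>"] tk by auto
    define C where "C = M k / \<delta>"
    have C: "C > 0" using M(1)[OF kN] \<delta> by (simp add: C_def)
    have fb: "f n w \<le> C * b w" if n: "n > k" and w: "w \<in> dom" "norm w < 4 ^ k" for n w
    proof (rule vanishing_positive_le_barrier[OF fk[OF n kN] harmonic_on_cmult[OF b(1)] _ _ w])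
      show "0 \<le> C * b w" if "w \<in> dom" for w using C b(2)[OF that] by simp
      fix a assume a: "norm a = 4 ^ k" "Im a \<noteq> 0"
      have "a \<in> dom" using a by (simp add: dom_def)
      moreover have "4 ^ k - \<bar>t\<bar> \<le> norm (a - of_real t)" using norm_triangle_ineq2[of a "of_real t"] a by simp
      ultimately have "\<delta> \<le> b a" by (rule \<delta>(2))
      then have "C * \<delta> \<le> C * b a" using C by simp
      then have "M k \<le> C * b a" using \<delta>(1) by (simp add: C_def)
      moreover have "f n a \<le> M k" using M(2)[OF kN fk[OF n kN] f(2) a] n kN by simp
      ultimately show "f n a \<le> C * b a" by simp
    qed
    have gb: "g w \<le> C * b w" if "w \<in> dom" "norm w < 4 ^ k" for w
      by (rule glim[of k]) (use Ff[OF _ kN that] fb[OF _ that] in simp)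
    have ev: "eventually (\<lambda>w. w \<in> dom \<and> norm w < 4 ^ k) (at (of_real t) within dom)"
      unfolding eventually_at
    proof (intro exI[of _ "4 ^ k - \<bar>t\<bar>"] conjI ballI impI)
      fix w assume w: "w \<in> dom" "w \<noteq> of_real t \<and> dist w (of_real t) < 4 ^ k - \<bar>t\<bar>"
      show "w \<in> dom" by (rule w)
      show "norm w < 4 ^ k" using norm_triangle_ineq2[of w "of_real t"] w(2) by (simp add: dist_norm)
    qed (use tk in simp)
    show ?thesis
    proof (rule tendsto_sandwich[OF _ _ tendsto_const])
      show "eventually (\<lambda>w. 0 \<le> g w) (at (of_real t) within dom)" using g0 by simp
      show "eventually (\<lambda>w. g w \<le> C * b w) (at (of_real t) within dom)"
        using ev by eventually_elim (use gb in blast)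
      show "((\<lambda>w. C * b w) \<longlongrightarrow> 0) (at (of_real t) within dom)" using tendsto_mult_left[OF b(3), of C] by simp
    qed
  qed
  have "g \<in> P_infinity dom"
    using gharm gpos glim0 g0 by (simp add: P_infinity_iff vanishing_positive_def)
  then show ?thesis by blast
qed

lemma P_infinity_dim_one_dom: "P_infinity_dim_one dom"
  unfolding P_infinity_dim_one_def using P_infinity_nonempty P_infinity_proportional by blast

end

section \<open>The gap lengths belonging to the given majorant\<close>

text \<open>
  Put \<open>e j = \<theta> (4 ^ j) / 4 ^ j\<close>. From \<open>e (Suc j) = e j / 4 + d (Suc j) / 4 ^ Suc j\<close>
  the square of \<open>e (Suc j)\<close> is at most \<open>(e j)\<^sup>2 / 8\<close> plus twice the square of the
  increment, so square summability of the increments would pass to \<open>e\<close>. The integral over the range from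
  \<open>4 ^ j\<close> to \<open>4 ^ Suc j\<close> is at most \<open>48 * (e (Suc j))\<^sup>2\<close> by monotonicity.
\<close>

lemma power4_increments_not_summable:
  fixes \<theta> :: "real \<Rightarrow> real"
  assumes incr: "mono_on {1..} \<theta>"
    and bounds: "\<And>t. 1 \<le> t \<Longrightarrow> 0 < \<theta> t \<and> \<theta> t \<le> 2 * t"
    and diverges: "(\<integral>\<^sup>+t\<in>{1..}. ennreal ((\<theta> t)\<^sup>2 / t ^ 3) \<partial>lborel) = \<infinity>"
  defines "d \<equiv> \<lambda>j. \<theta> (4 ^ j) - (if j = 0 then 0 else \<theta> (4 ^ (j - 1)))"
  shows "\<not> summable (\<lambda>j. (d j / 4 ^ j)\<^sup>2)"
proof
  assume sd: "summable (\<lambda>j. (d j / 4 ^ j)\<^sup>2)"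
  define e where "e j = \<theta> (4 ^ j) / 4 ^ j" for j :: nat
  define S where "S = (\<Sum>j. (d (Suc j) / 4 ^ Suc j)\<^sup>2)"
  have sd': "summable (\<lambda>j. (d (Suc j) / 4 ^ Suc j)\<^sup>2)" using sd by (subst summable_Suc_iff)
  have step: "(e (Suc j))\<^sup>2 \<le> (e j)\<^sup>2 / 8 + 2 * (d (Suc j) / 4 ^ Suc j)\<^sup>2" for j
  proof -
    have "e (Suc j) = e j / 4 + d (Suc j) / 4 ^ Suc j" by (simp add: e_def d_def field_simps)
    moreover have "(x + y)\<^sup>2 \<le> 2 * x\<^sup>2 + 2 * y\<^sup>2" for x y :: real
      using zero_le_power2[of "x - y"] by (simp add: power2_eq_square algebra_simps)
    ultimately have "(e (Suc j))\<^sup>2 \<le> 2 * (e j / 4)\<^sup>2 + 2 * (d (Suc j) / 4 ^ Suc j)\<^sup>2" by presburger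
    then show ?thesis by (simp add: power_divide)
  qed
  have "(\<Sum>j<n. (e j)\<^sup>2) \<le> 8/7 * ((e 0)\<^sup>2 + 2 * S)" for n
  proof -
    have "(\<Sum>j<n. (e j)\<^sup>2) \<le> (\<Sum>j<Suc n. (e j)\<^sup>2)" by simp
    also have "\<dots> = (e 0)\<^sup>2 + (\<Sum>j<n. (e (Suc j))\<^sup>2)" by (rule sum.lessThan_Suc_shift)
    also have "\<dots> \<le> (e 0)\<^sup>2 + (\<Sum>j<n. (e j)\<^sup>2 / 8 + 2 * (d (Suc j) / 4 ^ Suc j)\<^sup>2)"
      by (intro add_left_mono sum_mono step)
    also have "\<dots> = (e 0)\<^sup>2 + (\<Sum>j<n. (e j)\<^sup>2) / 8 + 2 * (\<Sum>j<n. (d (Suc j) / 4 ^ Suc j)\<^sup>2)"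
      by (simp only: sum.distrib sum_distrib_left sum_divide_distrib add.assoc)
    finally have "(\<Sum>j<n. (e j)\<^sup>2) \<le> (e 0)\<^sup>2 + (\<Sum>j<n. (e j)\<^sup>2) / 8 + 2 * (\<Sum>j<n. (d (Suc j) / 4 ^ Suc j)\<^sup>2)" .
    moreover have "(\<Sum>j<n. (d (Suc j) / 4 ^ Suc j)\<^sup>2) \<le> S"
      unfolding S_def by (rule sum_le_suminf[OF sd']) auto
    moreover have "x \<le> a + x / 8 + 2 * s \<Longrightarrow> s \<le> S \<Longrightarrow> x \<le> 8/7 * (a + 2 * S)" for x a s :: real
      by (simp add: field_simps)
    ultimately show ?thesis by blast
  qed
  then have se: "summable (\<lambda>j. (e j)\<^sup>2)" by (intro summableI_nonneg_bounded) (rule zero_le_power2)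
  then have se': "summable (\<lambda>j. 48 * (e (Suc j))\<^sup>2)" by (intro summable_mult) (subst summable_Suc_iff)
  define c where "c j = (\<theta> (4 ^ Suc j))\<^sup>2 / (4 ^ j) ^ 3" for j :: nat
  have c0: "c j \<ge> 0" for j by (simp add: c_def)
  have ptw: "ennreal ((\<theta> t)\<^sup>2 / t ^ 3) * indicator {1..} t \<le> (\<Sum>j. ennreal (c j) * indicator {4 ^ j..<4 ^ Suc j :: real} t)" for t :: real
  proof (cases "1 \<le> t")
    case True
    then obtain k where k: "4 ^ k \<le> t" "t < 4 ^ Suc k" by (rule power4_bracket)
    have p: "(1::real) \<le> 4 ^ Suc k" by (rule one_le_power) simp
    have "\<theta> t \<le> \<theta> (4 ^ Suc k)" using True k p by (intro mono_onD[OF incr]) auto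
    then have sq: "(\<theta> t)\<^sup>2 \<le> (\<theta> (4 ^ Suc k))\<^sup>2" using bounds[OF True] by (intro power_mono) auto
    have cube: "(4 ^ k) ^ 3 \<le> t ^ 3" using k(1) by (intro power_mono) auto
    have "(\<theta> t)\<^sup>2 / t ^ 3 \<le> c k"
      unfolding c_def by (rule frac_le[OF _ sq _ cube]) auto
    then have "ennreal ((\<theta> t)\<^sup>2 / t ^ 3) * indicator {1..} t \<le> ennreal (c k) * indicator {4 ^ k..<4 ^ Suc k} t"
      using True k by (simp add: ennreal_leI)
    also have "\<dots> \<le> (\<Sum>j. ennreal (c j) * indicator {4 ^ j..<4 ^ Suc j :: real} t)"
    proof -
      have "f k \<le> suminf f" for f :: "nat \<Rightarrow> ennreal" using sum_le_suminf[of f "{k}"] by simp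
      then show ?thesis .
    qed
    finally show ?thesis .
  qed simp
  have "(\<integral>\<^sup>+t\<in>{1..}. ennreal ((\<theta> t)\<^sup>2 / t ^ 3) \<partial>lborel)
      \<le> (\<integral>\<^sup>+t. (\<Sum>j. ennreal (c j) * indicator {4 ^ j..<4 ^ Suc j :: real} t) \<partial>lborel)"
    by (intro nn_integral_mono ptw)
  also have "\<dots> = (\<Sum>j. \<integral>\<^sup>+t. ennreal (c j) * indicator {4 ^ j..<4 ^ Suc j :: real} t \<partial>lborel)"
    by (rule nn_integral_suminf) auto
  also have "\<dots> = (\<Sum>j. ennreal (48 * (e (Suc j))\<^sup>2))"
  proof (rule suminf_cong)
    fix j :: nat
    have "(\<integral>\<^sup>+t. ennreal (c j) * indicator {4 ^ j..<4 ^ Suc j :: real} t \<partial>lborel) = ennreal (c j) * ennreal (4 ^ Suc j - 4 ^ j)"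
      by (subst nn_integral_cmult_indicator) auto
    also have "\<dots> = ennreal (c j * (4 ^ Suc j - 4 ^ j))" by (rule ennreal_mult[symmetric]) (use c0 in auto)
    also have "c j * (4 ^ Suc j - 4 ^ j) = 48 * (e (Suc j))\<^sup>2"
      by (simp add: c_def e_def power2_eq_square power3_eq_cube field_simps)
    finally show "(\<integral>\<^sup>+t. ennreal (c j) * indicator {4 ^ j..<4 ^ Suc j :: real} t \<partial>lborel) = ennreal (48 * (e (Suc j))\<^sup>2)" .
  qed
  also have "\<dots> = ennreal (\<Sum>j. 48 * (e (Suc j))\<^sup>2)" by (rule suminf_ennreal2[OF _ se']) simp
  finally show False using diverges by (simp add: top_unique)
qed

theorem mainTheorem6:
  fixes \<theta> :: "real \<Rightarrow> real"
  assumes incr: "mono_on {1..} \<theta>"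
    and bounds: "\<And>t. 1 \<le> t \<Longrightarrow> 0 < \<theta> t \<and> \<theta> t \<le> 2 * t"
    and diverges: "(\<integral>\<^sup>+t\<in>{1..}. ennreal ((\<theta> t)\<^sup>2 / t ^ 3) \<partial>lborel) = \<infinity>"
  shows "\<exists>(E :: complex option set) \<Omega>.
           E \<subseteq> ext_real_line \<and>
           Denjoy_domain \<Omega> \<and> E = ext_compl \<Omega> \<and>
           None \<in> E \<and> (\<forall>\<zeta>\<in>E. Dirichlet_regular \<Omega> \<zeta>) \<and>
           (\<forall>t>2. theta_compl E t \<le> \<theta> t) \<and>
           P_infinity_dim_one \<Omega> \<and>
           (\<exists>z\<in>\<Omega>. \<exists>g. is_Green_function \<Omega> z g \<and>
              Limsup (tending_to \<Omega> None) (\<lambda>t. ereal (g t * cmod t)) = \<infinity>)"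
proof -
  define d where "d j = \<theta> (4 ^ j) - (if j = 0 then 0 else \<theta> (4 ^ (j - 1)))" for j :: nat
  have p1: "(1::real) \<le> 4 ^ j" for j by simp
  have mono: "\<theta> (4 ^ i) \<le> \<theta> (4 ^ j)" if "i \<le> j" for i j :: nat
    using that by (intro mono_onD[OF incr]) (auto intro: power_increasing)
  have \<theta>4: "0 < \<theta> (4 ^ j)" "\<theta> (4 ^ j) \<le> 2 * 4 ^ j" for j :: nat using bounds[OF p1] by auto
  have d0: "0 \<le> d j" for j using mono[of "j - 1" j] \<theta>4[of j] by (auto simp: d_def)
  have d2: "d j \<le> 2 * 4 ^ j" for j
  proof (cases "j = 0")
    case False
    then show ?thesis using \<theta>4(1)[of "j - 1"] \<theta>4(2)[of j] unfolding d_def by simp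
  qed (use \<theta>4[of j] in \<open>simp add: d_def\<close>)
  have dsum: "(\<Sum>j\<le>n. d j) = \<theta> (4 ^ n)" for n
    by (induction n) (simp_all add: d_def)
  interpret gap_sequence "\<lambda>j. d j / 8"
  proof
    show "0 \<le> d j / 8" "d j / 8 \<le> 4 ^ j / 4" for j using d0[of j] d2[of j] by simp_all
    have eq: "(d j / 8 / 4 ^ j)\<^sup>2 = 1/64 * (d j / 4 ^ j)\<^sup>2" for j by (simp add: power_divide)
    show "\<not> summable (\<lambda>j. (d j / 8 / 4 ^ j)\<^sup>2)"
      unfolding eq using power4_increments_not_summable[OF assms, folded d_def] by (subst summable_cmult_iff) simp
  qed
  have real_compl: "{x. Some (complex_of_real x) \<notin> ext_compl dom} = gaps"
    by (auto simp: ext_compl_def dom_def)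
  have theta: "theta_compl (ext_compl dom) t \<le> \<theta> t" if t: "t > 2" for t
  proof -
    have "1 \<le> t" using t by simp
    from this obtain k where k: "4 ^ k \<le> t" "t < 4 ^ Suc k" by (rule power4_bracket)
    let ?I = "\<lambda>j. {ctr j - d j / 8<..<ctr j + d j / 8}"
    have sub: "gaps \<inter> {-t..t} \<subseteq> (\<Union>j\<le>k. ?I j)"
    proof
      fix x assume x: "x \<in> gaps \<inter> {-t..t}"
      then obtain j where j: "x \<in> ?I j" by (auto simp: gaps_def)
      have "j \<le> k"
      proof (rule ccontr)
        assume "\<not> j \<le> k"
        then have "(4::real) ^ Suc k \<le> 4 ^ j" by (intro power_increasing) auto
        moreover have "7/4 * 4 ^ j < t" using gap_bounds(1)[of j] j x by auto
        ultimately show False using k(2) p1[of j] by linarith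
      qed
      then show "x \<in> (\<Union>j\<le>k. ?I j)" using j by blast
    qed
    have "open gaps" by (auto simp: gaps_def)
    moreover have "?I j \<in> fmeasurable lborel" for j using fmeasurable_box[of "ctr j - d j / 8" "ctr j + d j / 8"] by simp
    ultimately have "theta_compl (ext_compl dom) t \<le> measure lborel (\<Union>j\<le>k. ?I j)"
      unfolding theta_compl_def real_compl
      by (intro measure_mono_fmeasurable[OF sub]) (auto intro!: fmeasurable.finite_UN)
    also have "\<dots> \<le> (\<Sum>j\<le>k. measure lborel (?I j))" by (rule measure_UNION_le) auto
    also have "\<dots> = (\<Sum>j\<le>k. d j / 4)" using d0 by (intro sum.cong) auto
    also have "\<dots> = \<theta> (4 ^ k) / 4" by (simp add: dsum flip: sum_divide_distrib)
    also have "\<dots> \<le> \<theta> (4 ^ k)" using \<theta>4(1)[of k] by simp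
    also have "\<dots> \<le> \<theta> t" using k(1) p1[of k] \<open>1 \<le> t\<close> by (intro mono_onD[OF incr]) auto
    finally show ?thesis .
  qed
  have real: "ext_compl dom \<subseteq> ext_real_line"
  proof
    fix \<zeta> assume z: "\<zeta> \<in> ext_compl dom"
    show "\<zeta> \<in> ext_real_line"
    proof (cases \<zeta>)
      case (Some a)
      then have "a \<notin> dom" using z by (auto simp: ext_compl_def)
      then obtain t where "a = of_real t" using not_in_dom by blast
      then show ?thesis using Some by (simp add: ext_real_line_def)
    qed (simp add: ext_real_line_def)
  qed
  obtain g where "is_Green_function dom z0 g" "harmonic_on g (dom - {z0})"
    "\<And>w. w \<in> dom - {z0} \<Longrightarrow> g w \<ge> 0" "\<And>w. w \<noteq> z0 \<Longrightarrow> norm (w - z0) \<le> d j0 / 8 / 6 \<Longrightarrow> g w \<ge> 1"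
    using Green_function_exists by metis
  then have "\<exists>z\<in>dom. \<exists>g. is_Green_function dom z g \<and>
      Limsup (tending_to dom None) (\<lambda>t. ereal (g t * cmod t)) = \<infinity>"
    using Green_Limsup z0_dom(1) by blast
  moreover have "None \<in> ext_compl dom" by (auto simp: ext_compl_def)
  moreover have "Denjoy_domain dom" using open_dom real by (simp add: Denjoy_domain_def)
  ultimately show ?thesis
    using real dom_regular theta P_infinity_dim_one_dom
    by (intro exI[of _ "ext_compl dom"] exI[of _ dom]) auto
qed

end
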